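(* Let $\Omega\subset\mathbb R^3$ be a bounded polyhedral domain, let $\mathcal T$ be a conforming tetrahedral triangulation of $\Omega$, and for every edge $e$ of $\mathcal T$ fix (globally, i.e. the same for all tetrahedra containing $e$) two linearly independent vectors $\gamma_e^0,\gamma_e^1\in e^\perp$. Let $Z_3^{\mathrm{cub}}(\mathcal T)$ be the space of all $z\in L^2(\Omega)$ such that $z|_T\in Z_3^{\mathrm{cub}}(T)$ for all $T\in\mathcal T$ and such that the following quantities are single-valued (they agree when computed from any two tetrahedra of $\mathcal T$ sharing the respective vertex, edge, or face): the vertex values $z(v)$ and vertex gradients $\nabla z(v)$ for all vertices $v$, the edge-gradient values $4\,\nabla z(\mathrm{mid}(e))\cdot\gamma_e^j$, $j=0,1$, for all edges $e$, and for all faces $f$ the facet functional $$\mathcal C_f(z)=6z(\mathrm{mid}(f))-2\sum_{v\text{ vertex of }f}z(v)+\sum_{v\text{ vertex of }f}\nabla z(v)\cdot(v-\mathrm{mid}(f)),$$ where $\mathrm{mid}(f)$ is the barycenter of $f$. Then $$Z_3^{\mathrm{cub}}(\mathcal T)\subset H^2(\Omega).$$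
   Context: Let $T=[v_0,v_1,v_2,v_3]\subset\mathbb R^3$ be a (nondegenerate) tetrahedron with barycentric coordinates $\lambda_0,\dots,\lambda_3$. Set $I=\{0,1,2,3\}$, $J_i=I\setminus\{i\}$. Let $f_i=\{\lambda_i=0\}$ be the face opposite to $v_i$, $\nu_i$ its outer unit normal, and $d_{ji}=\nabla\lambda_j\cdot\nu_i$. For $\ell\neq m$ let $e_{\ell m}=[v_\ell,v_m]$; for an edge $e$, $\mathrm{mid}(e)$ is its midpoint and $e^\perp=\{\nu\in\mathbb R^3:\nu\perp e\}$. $\mathcal P_k$ denotes polynomials of total degree at most $k$. Polynomial Zienkiewicz space: $Z_3^0(T)=\mathcal P_2(T)\oplus\mathrm{span}\{\lambda_i^2\lambda_j-\lambda_j^2\lambda_i:0\le i<j\le3\}$. Singular edge bubbles: for $0\le\ell<m\le3$ and $n\in I\setminus\{\ell,m\}$, $$E_{\ell m}^n=\frac{\lambda_n\lambda_\ell^2\lambda_m^2}{(\lambda_n+\lambda_\ell)(\lambda_n+\lambda_m)}.$$ Edge-enriched space: $Z_3^e(T)=Z_3^0(T)+\mathrm{span}\{E_{\ell m}^n:0\le\ell<m\le3,\ n\in I\setminus\{\ell,m\}\}$. On the face $f_i$ put $\mu_j=\lambda_j|_{f_i}$ for $j\in J_i$. For an edge $e_{\ell m}\subset f_i$ ($\ell<m$) with $\{n\}=I\setminus\{i,\ell,m\}$ set $$\Phi_{\ell m,\ell}^{n,i}=\frac{\mu_n\mu_\ell\mu_m^2(2\mu_n+\mu_\ell)}{(\mu_n+\mu_\ell)^2(\mu_n+\mu_m)},\quad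 \Phi_{\ell m,m}^{n,i}=\frac{\mu_n\mu_\ell^2\mu_m(2\mu_n+\mu_m)}{(\mu_n+\mu_\ell)(\mu_n+\mu_m)^2},$$ $$\Phi_{\ell m,n}^{n,i}=\frac{\mu_\ell^2\mu_m^2(\mu_\ell\mu_m-\mu_n^2)}{(\mu_n+\mu_\ell)^2(\mu_n+\mu_m)^2}-\mu_\ell\mu_m,$$ and let $Q_{\mathrm{edge}}(f_i)$ be the span of these functions over all edges $e_{\ell m}\subset f_i$. For $q\in Q_{\mathrm{edge}}(f_i)$ the canonical barycentric extension $\widetilde q$ to $T$ is obtained by replacing $\mu_j$ by $\lambda_j$ for all $j\in J_i$ in these formulas (extended linearly). The normal lift is $$L_iq=\frac{\lambda_i}{d_{ii}}\Theta_i\,\widetilde q,\qquad \Theta_i=\prod_{j\in J_i}\frac{\lambda_j}{\lambda_i+\lambda_j}.$$ Every $z\in Z_3^e(T)$ has on each face a unique decomposition $\partial_{\nu_i}z|_{f_i}=p_i(z)+q_i(z)$ with $p_i(z)\in\mathcal P_2(f_i)$, $q_i(z)\in Q_{\mathrm{edge}}(f_i)$. Set $\mathcal R_Tz=z-\sum_{i=0}^3L_iq_i(z)$ and $Z_3^{\mathrm{sing}}(T)=\mathcal R_TZ_3^e(T)$. Cubic face bubbles: $B_i=\prod_{j\in J_i}\lambda_j$ for $i=0,\dots,3$ and $\mathcal B_{\mathrm{cub}}(T)=\mathrm{span}\{B_0,\dots,B_3\}$. The cubic singular Zienkiewicz space is $$Z_3^{\mathrm{cub}}(T)=Z_3^{\mathrm{sing}}(T)+\mathcal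 B_{\mathrm{cub}}(T).$$ Values and gradients at points of $\partial T$ are understood by continuous extension. *)

theory Defs
  imports "HOL-Analysis.Analysis" "HOL-Library.Function_Algebras"
begin

section \<open>Pointwise real vector space structure on functions\<close>

instantiation "fun" :: (type, real_vector) real_vector
begin

definition "scaleR c f = (\<lambda>x. c *\<^sub>R f x)"

instance
  by standard (simp_all add: scaleR_fun_def fun_eq_iff scaleR_add_right scaleR_add_left)

end

lemma scaleR_fun_apply [simp]: "(c *\<^sub>R f) x = c *\<^sub>R f x"
  by (simp add: scaleR_fun_def)


section \<open>Sobolev spaces\<close>

definition L2 :: "(real^3) set \<Rightarrow> (real^3 \<Rightarrow> real) set" where
  "L2 \<Omega> = {u. u \<in> borel_measurable (lebesgue_on \<Omega>) \<and> integrable (lebesgue_on \<Omega>) (\<lambda>x. (u x)\<^sup>2)}"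

text \<open>A multi-index of order \<open>k\<close> is encoded as a list of \<open>k\<close> basis vectors; repetitions are
  allowed, and the order is irrelevant for smooth functions.\<close>

definition partials :: "(real^3) list \<Rightarrow> (real^3 \<Rightarrow> real) \<Rightarrow> real^3 \<Rightarrow> real" where
  "partials bs f = foldr (\<lambda>b g x. frechet_derivative g (at x) b) bs f"

definition smooth :: "(real^3 \<Rightarrow> real) \<Rightarrow> bool" where
  "smooth f \<longleftrightarrow> (\<forall>bs \<in> lists Basis. \<forall>x. partials bs f differentiable (at x))"

definition test_functions :: "(real^3) set \<Rightarrow> (real^3 \<Rightarrow> real) set" where
  "test_functions \<Omega> =
     {\<phi>. smooth \<phi> \<and> compact (closure {x. \<phi> x \<noteq> 0}) \<and> closure {x. \<phi> x \<noteq> 0} \<subseteq> \<Omega>}"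

definition weak_derivative ::
  "(real^3) set \<Rightarrow> (real^3) list \<Rightarrow> (real^3 \<Rightarrow> real) \<Rightarrow> (real^3 \<Rightarrow> real) \<Rightarrow> bool" where
  "weak_derivative \<Omega> bs u v \<longleftrightarrow>
     (\<forall>\<phi> \<in> test_functions \<Omega>.
        (LINT x|lebesgue_on \<Omega>. u x * partials bs \<phi> x) =
        (-1) ^ length bs * (LINT x|lebesgue_on \<Omega>. v x * \<phi> x))"

definition sobolev_H :: "nat \<Rightarrow> (real^3) set \<Rightarrow> (real^3 \<Rightarrow> real) set" where
  "sobolev_H k \<Omega> =
     {u \<in> L2 \<Omega>. \<forall>bs \<in> lists Basis. length bs \<le> k \<longrightarrow> (\<exists>v \<in> L2 \<Omega>. weak_derivative \<Omega> bs u v)}"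


section \<open>Polynomials, gradients, boundary values\<close>

definition polys :: "nat \<Rightarrow> (real^3 \<Rightarrow> real) set" where
  "polys k = span {(\<lambda>x. \<Prod>b\<in>Basis. (x \<bullet> b) ^ \<alpha> b) | \<alpha>. sum \<alpha> Basis \<le> k}"

definition grad :: "(real^3 \<Rightarrow> real) \<Rightarrow> real^3 \<Rightarrow> real^3" where
  "grad f x = (THE D. GDERIV f x :> D)"

text \<open>Values and gradients on \<open>T\<close> are continuous extensions from the interior.\<close>

definition bval :: "(real^3) set \<Rightarrow> (real^3 \<Rightarrow> real) \<Rightarrow> real^3 \<Rightarrow> real" where
  "bval T f x = Lim (at x within interior T) f"

definition bgrad :: "(real^3) set \<Rightarrow> (real^3 \<Rightarrow> real) \<Rightarrow> real^3 \<Rightarrow> real^3" where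
  "bgrad T f x = Lim (at x within interior T) (grad f)"


section \<open>Geometry of a tetrahedron\<close>

text \<open>The vertices themselves serve as the index set \<open>I\<close>, so no ordering of them is chosen.
  Where the usual presentation has a pair of indices \<open>l < m\<close>, all ordered pairs of distinct vertices
  are used; the spans are the same, since swapping the pair only changes signs or permutes the
  generators.\<close>

definition verts :: "(real^3) set \<Rightarrow> (real^3) set" where
  "verts S = {v. v extreme_point_of S}"

definition mid :: "(real^3) set \<Rightarrow> real^3" where
  "mid S = (1 / real (card (verts S))) *\<^sub>R (\<Sum>v\<in>verts S. v)"

definition bary :: "(real^3) set \<Rightarrow> real^3 \<Rightarrow> real^3 \<Rightarrow> real" where
  "bary T i x =
     (THE c. \<exists>u. sum u (verts T) = 1 \<and> (\<Sum>v\<in>verts T. u v *\<^sub>R v) = x \<and> c = u i)"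

definition opp_face :: "(real^3) set \<Rightarrow> real^3 \<Rightarrow> (real^3) set" where
  "opp_face T i = convex hull (verts T - {i})"

definition outer_normal :: "(real^3) set \<Rightarrow> real^3 \<Rightarrow> real^3" where
  "outer_normal T i =
     (THE n. norm n = 1 \<and> (\<forall>x \<in> opp_face T i. \<forall>y \<in> opp_face T i. n \<bullet> (x - y) = 0) \<and>
             (\<forall>x \<in> opp_face T i. n \<bullet> (i - x) < 0))"

text \<open>The gradient of \<open>bary T j\<close> is constant; the evaluation point \<open>0\<close> is immaterial.\<close>

definition dcoef :: "(real^3) set \<Rightarrow> real^3 \<Rightarrow> real^3 \<Rightarrow> real" where
  "dcoef T j i = grad (bary T j) 0 \<bullet> outer_normal T i"


section \<open>Local spaces\<close>

text \<open>Elements of the local spaces are total functions given by rational expressions in the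
  barycentric coordinates. All denominators are positive in the interior of \<open>T\<close> (and, for the
  face functions, in the relative interior of the face). Only the values there are meaningful.\<close>

definition Z3_0 :: "(real^3) set \<Rightarrow> (real^3 \<Rightarrow> real) set" where
  "Z3_0 T = {p + s | p s. p \<in> polys 2 \<and>
     s \<in> span {(\<lambda>x. (bary T i x)\<^sup>2 * bary T j x - (bary T j x)\<^sup>2 * bary T i x) | i j.
                i \<in> verts T \<and> j \<in> verts T \<and> i \<noteq> j}}"

definition edge_bubble :: "(real^3) set \<Rightarrow> real^3 \<Rightarrow> real^3 \<Rightarrow> real^3 \<Rightarrow> real^3 \<Rightarrow> real" where
  "edge_bubble T l m n x =
     bary T n x * (bary T l x)\<^sup>2 * (bary T m x)\<^sup>2 /
     ((bary T n x + bary T l x) * (bary T n x + bary T m x))"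

definition Z3_e :: "(real^3) set \<Rightarrow> (real^3 \<Rightarrow> real) set" where
  "Z3_e T = {z + s | z s. z \<in> Z3_0 T \<and>
     s \<in> span {edge_bubble T l m n | l m n.
                l \<in> verts T \<and> m \<in> verts T \<and> l \<noteq> m \<and> n \<in> verts T - {l, m}}}"

definition Phi_l :: "(real^3) set \<Rightarrow> real^3 \<Rightarrow> real^3 \<Rightarrow> real^3 \<Rightarrow> real^3 \<Rightarrow> real" where
  "Phi_l T l m n x = (let L = bary T l x; M = bary T m x; N = bary T n x in
     N * L * M\<^sup>2 * (2 * N + L) / ((N + L)\<^sup>2 * (N + M)))"

definition Phi_m :: "(real^3) set \<Rightarrow> real^3 \<Rightarrow> real^3 \<Rightarrow> real^3 \<Rightarrow> real^3 \<Rightarrow> real" where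
  "Phi_m T l m n x = (let L = bary T l x; M = bary T m x; N = bary T n x in
     N * L\<^sup>2 * M * (2 * N + M) / ((N + L) * (N + M)\<^sup>2))"

definition Phi_n :: "(real^3) set \<Rightarrow> real^3 \<Rightarrow> real^3 \<Rightarrow> real^3 \<Rightarrow> real^3 \<Rightarrow> real" where
  "Phi_n T l m n x = (let L = bary T l x; M = bary T m x; N = bary T n x in
     L\<^sup>2 * M\<^sup>2 * (L * M - N\<^sup>2) / ((N + L)\<^sup>2 * (N + M)\<^sup>2) - L * M)"

text \<open>Since the generators are written in the coordinates of \<open>T\<close> with index different from \<open>i\<close>,
  an element of \<open>Q_edge T i\<close> is both a function on the face (by restriction) and its own canonical
  barycentric extension to \<open>T\<close>. The nine distinct generators are linearly independent on the face,
  even modulo quadratic polynomials.\<close>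

definition Q_edge :: "(real^3) set \<Rightarrow> real^3 \<Rightarrow> (real^3 \<Rightarrow> real) set" where
  "Q_edge T i = span (\<Union>{{Phi_l T l m n, Phi_m T l m n, Phi_n T l m n} | l m n.
     distinct [l, m, n] \<and> verts T - {i} = {l, m, n}})"

definition Theta :: "(real^3) set \<Rightarrow> real^3 \<Rightarrow> real^3 \<Rightarrow> real" where
  "Theta T i x = (\<Prod>j\<in>verts T - {i}. bary T j x / (bary T i x + bary T j x))"

definition normal_lift :: "(real^3) set \<Rightarrow> real^3 \<Rightarrow> (real^3 \<Rightarrow> real) \<Rightarrow> real^3 \<Rightarrow> real" where
  "normal_lift T i q x = bary T i x / dcoef T i i * Theta T i x * q x"

text \<open>The decomposition of the normal derivative into a quadratic part and an element of
  \<open>Q_edge T i\<close> exists and is unique for \<open>z\<close> in \<open>Z3_e T\<close>, so the choice operator below selects the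
  only candidate. Comparing on the relative interior of the face is comparing on the face, by
  continuity.\<close>

definition q_part :: "(real^3) set \<Rightarrow> real^3 \<Rightarrow> (real^3 \<Rightarrow> real) \<Rightarrow> (real^3 \<Rightarrow> real)" where
  "q_part T i z = (SOME q. q \<in> Q_edge T i \<and>
     (\<exists>p \<in> polys 2. \<forall>x \<in> rel_interior (opp_face T i).
        bgrad T z x \<bullet> outer_normal T i = p x + q x))"

definition R_op :: "(real^3) set \<Rightarrow> (real^3 \<Rightarrow> real) \<Rightarrow> (real^3 \<Rightarrow> real)" where
  "R_op T z = z - (\<Sum>i\<in>verts T. normal_lift T i (q_part T i z))"

definition Z3_sing :: "(real^3) set \<Rightarrow> (real^3 \<Rightarrow> real) set" where
  "Z3_sing T = R_op T ` Z3_e T"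

definition face_bubble :: "(real^3) set \<Rightarrow> real^3 \<Rightarrow> real^3 \<Rightarrow> real" where
  "face_bubble T i x = (\<Prod>j\<in>verts T - {i}. bary T j x)"

definition B_cub :: "(real^3) set \<Rightarrow> (real^3 \<Rightarrow> real) set" where
  "B_cub T = span (face_bubble T ` verts T)"

definition Z3_cub :: "(real^3) set \<Rightarrow> (real^3 \<Rightarrow> real) set" where
  "Z3_cub T = {z + b | z b. z \<in> Z3_sing T \<and> b \<in> B_cub T}"


section \<open>Meshes and the global space\<close>

definition polyhedral_domain :: "(real^3) set \<Rightarrow> bool" where
  "polyhedral_domain \<Omega> \<longleftrightarrow> open \<Omega> \<and> connected \<Omega> \<and> \<Omega> \<noteq> {} \<and>
     (\<exists>\<P>. finite \<P> \<and> (\<forall>P\<in>\<P>. polytope P \<and> aff_dim P = 2) \<and> frontier \<Omega> = \<Union>\<P>)"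

definition conforming_triangulation :: "(real^3) set set \<Rightarrow> (real^3) set \<Rightarrow> bool" where
  "conforming_triangulation \<T> \<Omega> \<longleftrightarrow>
     triangulation \<T> \<and> (\<forall>T\<in>\<T>. 3 simplex T) \<and> \<Union>\<T> = closure \<Omega>"

definition edge_perp :: "(real^3) set \<Rightarrow> (real^3) set" where
  "edge_perp e = {\<nu>. \<forall>x\<in>e. \<forall>y\<in>e. \<nu> \<bullet> (x - y) = 0}"

definition edge_functional ::
  "((real^3) set \<Rightarrow> nat \<Rightarrow> real^3) \<Rightarrow> (real^3) set \<Rightarrow> (real^3 \<Rightarrow> real) \<Rightarrow> (real^3) set \<Rightarrow> nat \<Rightarrow> real" where
  "edge_functional \<gamma> T z e j = 4 * (bgrad T z (mid e) \<bullet> \<gamma> e j)"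

definition facet_functional ::
  "(real^3) set \<Rightarrow> (real^3 \<Rightarrow> real) \<Rightarrow> (real^3) set \<Rightarrow> real" where
  "facet_functional T z f =
     6 * bval T z (mid f) - 2 * (\<Sum>v\<in>verts f. bval T z v)
       + (\<Sum>v\<in>verts f. bgrad T z v \<bullet> (v - mid f))"

text \<open>Membership of \<open>z\<close> restricted to \<open>T\<close> in the local space is understood almost everywhere, as
  \<open>z\<close> stands for an \<open>L\<^sup>2\<close> class; the functionals are evaluated on the representatives \<open>w T\<close>,
  which are determined on the interior of \<open>T\<close> by continuity.\<close>

definition Z3_cub_mesh ::
  "(real^3) set \<Rightarrow> (real^3) set set \<Rightarrow> ((real^3) set \<Rightarrow> nat \<Rightarrow> real^3) \<Rightarrow> (real^3 \<Rightarrow> real) set" where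
  "Z3_cub_mesh \<Omega> \<T> \<gamma> = {z \<in> L2 \<Omega>. \<exists>w.
     (\<forall>T\<in>\<T>. w T \<in> Z3_cub T \<and> (AE x in lebesgue_on T. z x = w T x)) \<and>
     (\<forall>T\<in>\<T>. \<forall>T'\<in>\<T>.
        (\<forall>v \<in> verts T \<inter> verts T'.
           bval T (w T) v = bval T' (w T') v \<and> bgrad T (w T) v = bgrad T' (w T') v) \<and>
        (\<forall>e. e edge_of T \<and> e edge_of T' \<longrightarrow>
           (\<forall>j\<in>{0, 1}. edge_functional \<gamma> T (w T) e j = edge_functional \<gamma> T' (w T') e j)) \<and>
        (\<forall>f. f facet_of T \<and> f facet_of T' \<longrightarrow>
           facet_functional T (w T) f = facet_functional T' (w T') f))}"

end

theory Submission
  imports Defs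
begin

text \<open>A function of the mesh space is, on every tetrahedron, of class \<open>C\<^sup>1\<close> up to the boundary with
bounded second derivatives, and the single-valued functionals force values and gradients of two
pieces to agree on the common face of their tetrahedra. The glued function and its gradient are
therefore Lipschitz along segments in \<open>\<Omega>\<close>, so that the piecewise derivatives up to order two are
bounded weak derivatives.

Regularity in one tetrahedron. All local functions are combinations of rational monomials, which are
quotients of a product of barycentric coordinates by a product of sums of two of them. A derivative of
such a monomial is a combination of monomials in which a numerator factor is lost or a denominator
factor is gained. Hence boundedness of all derivatives up to order \<open>k\<close> follows from a counting condition
(\<open>excess\<close>, \<open>ratmono_abs_le_one\<close>, \<open>bdd_derivs_ratmono\<close>): every set of vertices which contains a pair from
the denominator has at least \<open>k\<close> more numerator factors than such pairs.

Traces and normal derivatives. The normal lift of \<open>q\<close> vanishes on the whole boundary, its normal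
derivative on its own face is \<open>q\<close>, and its gradient vanishes on the other faces
(\<open>normal_lift_own_face\<close>, \<open>normal_lift_other_face\<close>). Subtracting the lifts thus leaves traces unchanged and
makes normal derivatives quadratic (\<open>normal_derivative_quadratic\<close>). The trace on a face is a combination of
thirteen functions: six quadratic monomials, three antisymmetric cubics, three edge bubbles and one
face bubble (\<open>bval_trace_form\<close>).

Matching. Along an edge the trace is a cubic, fixed by values and slopes at both ends, and the gradient
is quadratic, fixed by its values at the ends and at the midpoint (\<open>edge_match\<close>). On a face, once the
edges match, a difference of traces is a combination of the edge bubbles and the face bubble. Its
slopes at the midpoints of the edges make each edge coefficient the negative of the face coefficient, and then
the value at the barycentre shows that all four vanish (\<open>bval_match_face\<close>). The normal derivative is a
quadratic polynomial which is known at the vertices and at the midpoints of the edges (\<open>bgrad_match_face\<close>).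

Weak derivatives. If \<open>u\<close> is Lipschitz on each cell and single-valued, and \<open>\<phi>\<close> is a test function, then
the difference quotients of \<open>u \<phi>\<close> in a coordinate direction are bounded and have integral zero by
translation invariance. Dominated convergence turns this into integration by parts
(\<open>integration_by_parts\<close>), which is applied to the glued function and to the components of its gradient.\<close>


section \<open>Functions with bounded derivatives\<close>

text \<open>The set \<open>U\<close> carries the differentiability, the bounds are asked for on \<open>B\<close>. For a tetrahedron, \<open>B\<close> is
the interior and \<open>U\<close> contains in addition the relatively open faces, where normal derivatives are taken.\<close>

primrec bdd_derivs :: "'a::euclidean_space set \<Rightarrow> 'a set \<Rightarrow> nat \<Rightarrow> ('a \<Rightarrow> real) \<Rightarrow> bool" where
  "bdd_derivs U B 0 f \<longleftrightarrow> continuous_on U f \<and> bounded (f ` B)"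
| "bdd_derivs U B (Suc k) f \<longleftrightarrow> bounded (f ` B) \<and>
     (\<exists>g. (\<forall>x\<in>U. GDERIV f x :> g x) \<and> (\<forall>b\<in>Basis. bdd_derivs U B k (\<lambda>x. g x \<bullet> b)))"

lemma GDERIV_transform_open:
  assumes "GDERIV f x :> D" "open U" "x \<in> U" "\<And>y. y \<in> U \<Longrightarrow> f y = g y"
  shows "GDERIV g x :> D"
  using assms unfolding gderiv_def by (metis has_derivative_transform_within_open)

lemma bdd_derivs_cong:
  assumes "open U" "B \<subseteq> U" "\<And>x. x \<in> U \<Longrightarrow> f x = g x" "bdd_derivs U B k f"
  shows "bdd_derivs U B k g"
proof -
  have img: "f ` B = g ` B" using assms by (intro image_cong) auto
  show ?thesis
  proof (cases k)
    case 0
    then show ?thesis using assms(4) img continuous_on_eq[of U f g] assms(3) by simp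
  next
    case (Suc j)
    then obtain h where h: "\<forall>x\<in>U. GDERIV f x :> h x" "\<forall>b\<in>Basis. bdd_derivs U B j (\<lambda>x. h x \<bullet> b)"
      using assms(4) by auto
    have "\<forall>x\<in>U. GDERIV g x :> h x"
    proof
      fix x assume "x \<in> U"
      with h(1) show "GDERIV g x :> h x"
        by (intro GDERIV_transform_open[of f x "h x" U g] assms(1,3)) auto
    qed
    moreover have "bounded (g ` B)" using Suc assms(4) img by simp
    ultimately show ?thesis using Suc h(2) by auto
  qed
qed

lemma bdd_derivs_add:
  "bdd_derivs U B k f \<Longrightarrow> bdd_derivs U B k g \<Longrightarrow> bdd_derivs U B k (\<lambda>x. f x + g x)"
proof (induction k arbitrary: f g)
  case 0
  then show ?case by (auto intro: continuous_on_add bounded_plus_comp)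
next
  case (Suc k)
  obtain f' where f': "\<forall>x\<in>U. GDERIV f x :> f' x" "\<forall>b\<in>Basis. bdd_derivs U B k (\<lambda>x. f' x \<bullet> b)"
    using Suc.prems(1) by auto
  obtain g' where g': "\<forall>x\<in>U. GDERIV g x :> g' x" "\<forall>b\<in>Basis. bdd_derivs U B k (\<lambda>x. g' x \<bullet> b)"
    using Suc.prems(2) by auto
  have "\<forall>x\<in>U. GDERIV (\<lambda>x. f x + g x) x :> f' x + g' x"
    using f' g' by (auto intro: GDERIV_add)
  moreover have "\<forall>b\<in>Basis. bdd_derivs U B k (\<lambda>x. (f' x + g' x) \<bullet> b)"
    using Suc.IH f' g' by (simp add: inner_add_left)
  ultimately show ?case using Suc.prems by (auto intro: bounded_plus_comp intro!: exI[of _ "\<lambda>x. f' x + g' x"])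
qed

lemma bdd_derivs_cmult:
  "bdd_derivs U B k f \<Longrightarrow> bdd_derivs U B k (\<lambda>x. c * f x)"
proof (induction k arbitrary: f)
  case 0
  then show ?case
    using bounded_scaling[of "f ` B" c] by (auto intro: continuous_on_mult_left simp: image_image)
next
  case (Suc k)
  obtain f' where f': "\<forall>x\<in>U. GDERIV f x :> f' x" "\<forall>b\<in>Basis. bdd_derivs U B k (\<lambda>x. f' x \<bullet> b)"
    using Suc.prems(1) by auto
  have "GDERIV (\<lambda>x. c * f x) x :> c *\<^sub>R f' x" if "x \<in> U" for x
    using GDERIV_mult[OF GDERIV_const[of c] bspec[OF f'(1) that]] by simp
  moreover have "\<forall>b\<in>Basis. bdd_derivs U B k (\<lambda>x. (c *\<^sub>R f' x) \<bullet> b)"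
    using Suc.IH f' by simp
  moreover have "bounded ((\<lambda>x. c * f x) ` B)"
    using Suc.prems bounded_scaling[of "f ` B" c] by (auto simp: image_image)
  ultimately show ?case by (auto intro!: exI[of _ "\<lambda>x. c *\<^sub>R f' x"])
qed

lemma bdd_derivs_zero: "bdd_derivs U B k (\<lambda>x. 0)"
proof (induction k)
  case (Suc k)
  then show ?case using GDERIV_const[of 0]
    by (auto intro!: exI[of _ "\<lambda>x. 0"] finite_imp_bounded intro: finite_subset[of _ "{0}"])
qed (auto intro: finite_imp_bounded finite_subset[of _ "{0}"])

lemma bdd_derivs_diff:
  assumes "bdd_derivs U B k f" "bdd_derivs U B k g" shows "bdd_derivs U B k (\<lambda>x. f x - g x)"
  using bdd_derivs_add[OF assms(1) bdd_derivs_cmult[OF assms(2), of "-1"]] by simp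

lemma bdd_derivs_sum:
  assumes "\<And>i. i \<in> I \<Longrightarrow> bdd_derivs U B k (f i)"
  shows "bdd_derivs U B k (\<lambda>x. \<Sum>i\<in>I. f i x)"
  using assms by (induction I rule: infinite_finite_induct) (auto intro: bdd_derivs_zero bdd_derivs_add)

lemma bdd_derivs_sum_list:
  assumes "\<And>i. i \<in> set I \<Longrightarrow> bdd_derivs U B k (f i)"
  shows "bdd_derivs U B k (\<lambda>x. \<Sum>i\<leftarrow>I. f i x)"
  using assms by (induction I) (auto intro: bdd_derivs_zero bdd_derivs_add)


section \<open>Rational monomials\<close>

definition ratmono :: "('i \<Rightarrow> 'a \<Rightarrow> real) \<Rightarrow> 'i list \<Rightarrow> ('i \<times> 'i) list \<Rightarrow> 'a \<Rightarrow> real" where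
  "ratmono lam As Ds x = (\<Prod>a\<leftarrow>As. lam a x) / (\<Prod>p\<leftarrow>Ds. lam (fst p) x + lam (snd p) x)"

text \<open>When the coordinates indexed by \<open>S\<close> tend to zero together, a monomial is homogeneous of degree the number
of its numerator factors in \<open>S\<close> minus the number of its denominator pairs in \<open>S\<close>. The condition demands
degree at least \<open>k\<close> for each \<open>S\<close> along which the monomial can be singular.\<close>

definition excess :: "nat \<Rightarrow> 'i list \<Rightarrow> ('i \<times> 'i) list \<Rightarrow> bool" where
  "excess k As Ds \<longleftrightarrow> (\<forall>S. (\<exists>p\<in>set Ds. fst p \<in> S \<and> snd p \<in> S) \<longrightarrow>
     k + length (filter (\<lambda>p. fst p \<in> S \<and> snd p \<in> S) Ds) \<le> length (filter (\<lambda>a. a \<in> S) As))"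

lemma prod_list_remove1:
  fixes f :: "'i \<Rightarrow> 'b::comm_monoid_mult"
  assumes "a \<in> set As" shows "(\<Prod>a\<leftarrow>As. f a) = f a * (\<Prod>a\<leftarrow>remove1 a As. f a)"
  using assms by (induction As) (auto simp: ac_simps)

text \<open>The smallest entry \<open>y\<close> of \<open>ys\<close> has some \<open>x \<le> y\<close> in \<open>xs\<close>. Removing both preserves the counting hypothesis,
because no entry of \<open>ys\<close> lies below a threshold smaller than \<open>y\<close>.\<close>

lemma prod_list_le_of_counts:
  fixes xs ys :: "real list"
  assumes "\<And>x. x \<in> set xs \<Longrightarrow> 0 < x \<and> x \<le> 1" "\<And>y. y \<in> set ys \<Longrightarrow> 0 < y \<and> y \<le> 1"
    and "\<And>t. length (filter (\<lambda>y. y \<le> t) ys) \<le> length (filter (\<lambda>x. x \<le> t) xs)"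
  shows "prod_list xs \<le> prod_list ys"
  using assms
proof (induction "length ys" arbitrary: xs ys)
  case 0
  have "0 \<le> prod_list xs \<and> prod_list xs \<le> 1"
    using 0(2)
  proof (induction xs)
    case (Cons x xs)
    then have "0 \<le> prod_list xs \<and> prod_list xs \<le> 1" "0 < x \<and> x \<le> 1" by auto
    then show ?case by (simp add: mult_le_one)
  qed simp
  then show ?case using 0 by simp
next
  case (Suc n)
  define y where "y = Min (set ys)"
  have ne: "set ys \<noteq> {}" using Suc(2) by auto
  have y: "y \<in> set ys" "\<And>y'. y' \<in> set ys \<Longrightarrow> y \<le> y'" using ne by (auto simp: y_def)
  have "filter (\<lambda>x. x \<le> y) ys \<noteq> []" using y by (auto simp: filter_empty_conv)
  then have "filter (\<lambda>x. x \<le> y) xs \<noteq> []" using Suc.prems(3)[of y] by auto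
  then obtain x where x: "x \<in> set xs" "x \<le> y" by (auto simp: filter_empty_conv)
  have ys: "set (remove1 y ys) \<subseteq> set ys" and xs: "set (remove1 x xs) \<subseteq> set xs"
    by (rule set_remove1_subset)+
  have filt: "filter P (remove1 z zs) = remove1 z (filter P zs)" for P z and zs :: "real list"
    by (induction zs) auto
  have "prod_list (remove1 x xs) \<le> prod_list (remove1 y ys)"
  proof (rule Suc(1))
    show "n = length (remove1 y ys)" using y Suc(2) by (simp add: length_remove1)
    show "0 < u \<and> u \<le> 1" if "u \<in> set (remove1 x xs)" for u using that xs Suc.prems by auto
    show "0 < u \<and> u \<le> 1" if "u \<in> set (remove1 y ys)" for u using that ys Suc.prems by auto
    show "length (filter (\<lambda>y. y \<le> t) (remove1 y ys)) \<le> length (filter (\<lambda>x. x \<le> t) (remove1 x xs))" for t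
    proof (cases "y \<le> t")
      case True
      then show ?thesis using Suc.prems(3)[of t] x y by (auto simp: filt length_remove1 diff_le_mono)
    next
      case False
      then have "filter (\<lambda>y. y \<le> t) ys = []" using y by (force simp: filter_empty_conv)
      then show ?thesis by (simp add: filt)
    qed
  qed
  moreover have "0 \<le> prod_list (remove1 x xs)"
    using xs Suc.prems(1) by (intro prod_list_nonneg) force
  moreover have "0 < x" "0 < y" using Suc.prems x y by auto
  ultimately show ?case
    using prod_list_remove1[OF x(1), of id] prod_list_remove1[OF y(1), of id] x
    by (auto intro: mult_mono)
qed

text \<open>The counts needed for \<open>prod_list_le_of_counts\<close> are those of the sublevel sets \<open>S = {a. lam a x \<le> t}\<close>,
since a sum \<open>lam a x + lam b x\<close> is at least the larger summand, which is at most \<open>t\<close> precisely if both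
indices belong to \<open>S\<close>.\<close>

lemma ratmono_abs_le_one:
  assumes ex: "excess 0 As Ds"
    and I: "set As \<subseteq> I" "set Ds \<subseteq> I \<times> I"
    and lam: "\<And>a. a \<in> I \<Longrightarrow> 0 < lam a x \<and> lam a x \<le> 1"
  shows "\<bar>ratmono lam As Ds x\<bar> \<le> 1"
proof -
  define m where "m p = max (lam (fst p) x) (lam (snd p) x)" for p
  have m: "0 < m p \<and> m p \<le> 1 \<and> m p \<le> lam (fst p) x + lam (snd p) x" if "p \<in> set Ds" for p
  proof -
    have "fst p \<in> I" "snd p \<in> I" using that I by auto
    then show ?thesis using lam[of "fst p"] lam[of "snd p"] by (auto simp: m_def)
  qed
  have "prod_list (map (\<lambda>a. lam a x) As) \<le> prod_list (map m Ds)"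
  proof (rule prod_list_le_of_counts)
    show "0 < u \<and> u \<le> 1" if "u \<in> set (map (\<lambda>a. lam a x) As)" for u using that I lam by auto
    show "0 < u \<and> u \<le> 1" if "u \<in> set (map m Ds)" for u using that m by auto
    fix t
    let ?S = "{a. lam a x \<le> t}"
    have *: "length (filter (\<lambda>y. y \<le> t) (map m Ds)) = length (filter (\<lambda>p. fst p \<in> ?S \<and> snd p \<in> ?S) Ds)"
      by (simp add: filter_map o_def m_def)
    show "length (filter (\<lambda>y. y \<le> t) (map m Ds)) \<le> length (filter (\<lambda>y. y \<le> t) (map (\<lambda>a. lam a x) As))"
    proof (cases "\<exists>p\<in>set Ds. fst p \<in> ?S \<and> snd p \<in> ?S")
      case True
      then show ?thesis using ex[unfolded excess_def, rule_format, OF True] unfolding *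
        by (simp add: filter_map o_def)
    next
      case False
      then have "filter (\<lambda>p. fst p \<in> ?S \<and> snd p \<in> ?S) Ds = []" by (auto simp: filter_empty_conv)
      then show ?thesis unfolding * by simp
    qed
  qed
  also have "\<dots> \<le> (\<Prod>p\<leftarrow>Ds. lam (fst p) x + lam (snd p) x)"
    using m
  proof (induction Ds)
    case (Cons p Ds)
    have "0 \<le> prod_list (map m Ds)" using Cons.prems by (fastforce intro: prod_list_nonneg less_imp_le)
    moreover have "0 < m p" "m p \<le> lam (fst p) x + lam (snd p) x" using Cons.prems[of p] by auto
    moreover have "prod_list (map m Ds) \<le> (\<Prod>p\<leftarrow>Ds. lam (fst p) x + lam (snd p) x)"
      using Cons by auto
    ultimately show ?case by (simp add: mult_mono)
  qed simp
  finally have le: "(\<Prod>a\<leftarrow>As. lam a x) \<le> (\<Prod>p\<leftarrow>Ds. lam (fst p) x + lam (snd p) x)" .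
  have "0 \<le> (\<Prod>a\<leftarrow>As. lam a x)" using I lam by (fastforce intro: prod_list_nonneg less_imp_le)
  with le show ?thesis unfolding ratmono_def by (cases "(\<Prod>p\<leftarrow>Ds. lam (fst p) x + lam (snd p) x) = 0") (auto simp: divide_le_eq_1)
qed

lemma excess_remove1:
  assumes "excess (Suc k) As Ds" shows "excess k (remove1 a As) Ds"
proof -
  have filt: "filter P (remove1 a As) = (if P a then remove1 a (filter P As) else filter P As)" for P
    by (induction As) auto
  show ?thesis unfolding excess_def
  proof (intro allI impI)
    fix S assume "\<exists>p\<in>set Ds. fst p \<in> S \<and> snd p \<in> S"
    then have "Suc k + length (filter (\<lambda>p. fst p \<in> S \<and> snd p \<in> S) Ds) \<le> length (filter (\<lambda>a. a \<in> S) As)"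
      using assms unfolding excess_def by blast
    moreover have "length (filter (\<lambda>a. a \<in> S) As) \<le> Suc (length (filter (\<lambda>a. a \<in> S) (remove1 a As)))"
      unfolding filt by (auto simp: length_remove1)
    ultimately show "k + length (filter (\<lambda>p. fst p \<in> S \<and> snd p \<in> S) Ds)
        \<le> length (filter (\<lambda>a. a \<in> S) (remove1 a As))" by simp
  qed
qed

lemma excess_Cons:
  assumes "excess (Suc k) As Ds" "p \<in> set Ds" shows "excess k As (p # Ds)"
  using assms unfolding excess_def by (auto dest: spec)

lemma excess_le: "excess k As Ds \<Longrightarrow> j \<le> k \<Longrightarrow> excess j As Ds"
  unfolding excess_def by (meson add_le_mono1 le_trans)

lemma scaleR_sum_list:
  fixes g :: "'c \<Rightarrow> 'b::real_vector"
  shows "c *\<^sub>R (\<Sum>p\<leftarrow>L. g p) = (\<Sum>p\<leftarrow>L. c *\<^sub>R g p)"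
  by (induction L) (auto simp: scaleR_add_right)

lemma GDERIV_prod_list:
  assumes "\<And>a. a \<in> set As \<Longrightarrow> GDERIV (lam a) x :> G a"
  shows "GDERIV (\<lambda>x. \<Prod>a\<leftarrow>As. lam a x) x :> (\<Sum>a\<leftarrow>As. (\<Prod>b\<leftarrow>remove1 a As. lam b x) *\<^sub>R G a)"
  using assms
proof (induction As)
  case Nil
  then show ?case using GDERIV_const[of 1] by simp
next
  case (Cons c As)
  have "(\<Sum>a\<leftarrow>As. (\<Prod>b\<leftarrow>remove1 a (c # As). lam b x) *\<^sub>R G a) =
        (\<Sum>a\<leftarrow>As. lam c x *\<^sub>R ((\<Prod>b\<leftarrow>remove1 a As. lam b x) *\<^sub>R G a))"
    using prod_list_remove1[of _ As "\<lambda>a. lam a x"] by (intro arg_cong[where f=sum_list] map_cong) auto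
  also have "\<dots> = lam c x *\<^sub>R (\<Sum>a\<leftarrow>As. (\<Prod>b\<leftarrow>remove1 a As. lam b x) *\<^sub>R G a)"
    by (simp only: scaleR_sum_list)
  finally have eq: "(\<Sum>a\<leftarrow>c # As. (\<Prod>b\<leftarrow>remove1 a (c # As). lam b x) *\<^sub>R G a) =
      lam c x *\<^sub>R (\<Sum>a\<leftarrow>As. (\<Prod>b\<leftarrow>remove1 a As. lam b x) *\<^sub>R G a) + (\<Prod>b\<leftarrow>As. lam b x) *\<^sub>R G c"
    by (simp add: add.commute)
  have "GDERIV (lam c) x :> G c"
    "GDERIV (\<lambda>x. \<Prod>a\<leftarrow>As. lam a x) x :> (\<Sum>a\<leftarrow>As. (\<Prod>b\<leftarrow>remove1 a As. lam b x) *\<^sub>R G a)"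
    using Cons by auto
  from GDERIV_mult[OF this] show ?case unfolding eq by simp
qed

lemma GDERIV_inverse_prod_list:
  assumes "\<And>p. p \<in> set Ds \<Longrightarrow> GDERIV (d p) x :> G p" "\<And>p. p \<in> set Ds \<Longrightarrow> d p x \<noteq> 0"
  shows "GDERIV (\<lambda>x. 1 / (\<Prod>p\<leftarrow>Ds. d p x)) x :> - (\<Sum>p\<leftarrow>Ds. (1 / (\<Prod>q\<leftarrow>p # Ds. d q x)) *\<^sub>R G p)"
  using assms
proof (induction Ds)
  case Nil
  then show ?case using GDERIV_const[of 1] by simp
next
  case (Cons c Ds)
  define P where "P = (\<Prod>q\<leftarrow>Ds. d q x)"
  have c: "GDERIV (\<lambda>x. inverse (d c x)) x :> - (inverse (d c x))\<^sup>2 *\<^sub>R G c"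
    using Cons.prems by (intro GDERIV_inverse) auto
  have "(\<Sum>p\<leftarrow>Ds. (1 / (\<Prod>q\<leftarrow>p # c # Ds. d q x)) *\<^sub>R G p) =
        (\<Sum>p\<leftarrow>Ds. (1 / d c x) *\<^sub>R ((1 / (\<Prod>q\<leftarrow>p # Ds. d q x)) *\<^sub>R G p))"
    by (intro arg_cong[where f=sum_list] map_cong) (auto simp: ac_simps)
  also have "\<dots> = (1 / d c x) *\<^sub>R (\<Sum>p\<leftarrow>Ds. (1 / (\<Prod>q\<leftarrow>p # Ds. d q x)) *\<^sub>R G p)"
    by (simp only: scaleR_sum_list)
  finally show ?case
    using GDERIV_mult[OF c Cons.IH] Cons.prems
    by (simp add: divide_inverse ac_simps power2_eq_square)
qed

lemma GDERIV_ratmono: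
  assumes "\<And>a. a \<in> I \<Longrightarrow> GDERIV (lam a) x :> G a" "set As \<subseteq> I" "set Ds \<subseteq> I \<times> I"
    and "\<And>p. p \<in> set Ds \<Longrightarrow> lam (fst p) x + lam (snd p) x \<noteq> 0"
  shows "GDERIV (ratmono lam As Ds) x :>
     (\<Sum>a\<leftarrow>As. ratmono lam (remove1 a As) Ds x *\<^sub>R G a)
     - (\<Sum>p\<leftarrow>Ds. ratmono lam As (p # Ds) x *\<^sub>R (G (fst p) + G (snd p)))"
proof -
  have 1: "GDERIV (\<lambda>x. \<Prod>a\<leftarrow>As. lam a x) x :> (\<Sum>a\<leftarrow>As. (\<Prod>b\<leftarrow>remove1 a As. lam b x) *\<^sub>R G a)"
    using assms by (intro GDERIV_prod_list) auto
  have 2: "GDERIV (\<lambda>x. 1 / (\<Prod>p\<leftarrow>Ds. lam (fst p) x + lam (snd p) x)) x :>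
      - (\<Sum>p\<leftarrow>Ds. (1 / (\<Prod>q\<leftarrow>p # Ds. lam (fst q) x + lam (snd q) x)) *\<^sub>R (G (fst p) + G (snd p)))"
    using assms by (intro GDERIV_inverse_prod_list GDERIV_add) auto
  have eq: "ratmono lam As Ds = (\<lambda>x. (\<Prod>a\<leftarrow>As. lam a x) * (1 / (\<Prod>p\<leftarrow>Ds. lam (fst p) x + lam (snd p) x)))"
    by (auto simp: ratmono_def)
  show ?thesis unfolding eq
    by (rule GDERIV_subst[OF GDERIV_mult[OF 1 2]]) (simp add: scaleR_sum_list ratmono_def)
qed

text \<open>Losing a numerator factor or repeating a denominator factor lowers the excess by at most one, so each
differentiation costs one unit of it.\<close>

lemma bdd_derivs_ratmono:
  assumes lam: "\<And>a x. a \<in> I \<Longrightarrow> x \<in> U \<Longrightarrow> GDERIV (lam a) x :> G a"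
    and B: "\<And>a x. a \<in> I \<Longrightarrow> x \<in> B \<Longrightarrow> 0 < lam a x \<and> lam a x \<le> 1"
    and I: "set As \<subseteq> I" "set Ds \<subseteq> I \<times> I"
    and U: "\<And>p x. p \<in> set Ds \<Longrightarrow> x \<in> U \<Longrightarrow> lam (fst p) x + lam (snd p) x \<noteq> 0"
    and ex: "excess k As Ds"
  shows "bdd_derivs U B k (ratmono lam As Ds)"
  using I U ex
proof (induction k arbitrary: As Ds)
  case (0 As Ds)
  have "bounded (ratmono lam As Ds ` B)"
    using ratmono_abs_le_one[OF 0(4,1,2), of lam] B by (auto simp: bounded_iff)
  moreover have "continuous_on U (ratmono lam As Ds)"
  proof (rule continuous_at_imp_continuous_on, rule ballI)
    fix x assume "x \<in> U"
    then have "GDERIV (ratmono lam As Ds) x :>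
     (\<Sum>a\<leftarrow>As. ratmono lam (remove1 a As) Ds x *\<^sub>R G a)
     - (\<Sum>p\<leftarrow>Ds. ratmono lam As (p # Ds) x *\<^sub>R (G (fst p) + G (snd p)))"
      using 0 lam by (intro GDERIV_ratmono) auto
    then show "isCont (ratmono lam As Ds) x" unfolding gderiv_def by (rule has_derivative_continuous)
  qed
  ultimately show ?case by simp
next
  case (Suc k As Ds)
  let ?g = "\<lambda>x. (\<Sum>a\<leftarrow>As. ratmono lam (remove1 a As) Ds x *\<^sub>R G a)
     - (\<Sum>p\<leftarrow>Ds. ratmono lam As (p # Ds) x *\<^sub>R (G (fst p) + G (snd p)))"
  have b: "bounded (ratmono lam As Ds ` B)"
    using ratmono_abs_le_one[OF excess_le[OF Suc.prems(4)] Suc.prems(1,2), of lam] B by (auto simp: bounded_iff)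
  have d: "GDERIV (ratmono lam As Ds) x :> ?g x" if "x \<in> U" for x
    using Suc.prems lam that by (intro GDERIV_ratmono) auto
  have sc: "(\<Sum>p\<leftarrow>L. f p *\<^sub>R (g p :: 'b)) \<bullet> b = (\<Sum>p\<leftarrow>L. (g p \<bullet> b) * f p)" for b f g and L :: "'e list"
    by (induction L) (auto simp: inner_add_left)
  have "bdd_derivs U B k (\<lambda>x. ?g x \<bullet> b)" if b: "b \<in> Basis" for b
    unfolding inner_diff_left sc
  proof (intro bdd_derivs_diff bdd_derivs_sum_list bdd_derivs_cmult)
    fix a assume "a \<in> set As"
    show "bdd_derivs U B k (ratmono lam (remove1 a As) Ds)"
      using Suc.prems set_remove1_subset[of a As] by (intro Suc.IH) (auto intro: excess_remove1)
  next
    fix p assume "p \<in> set Ds"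
    then show "bdd_derivs U B k (ratmono lam As (p # Ds))"
      using Suc.prems by (intro Suc.IH) (auto intro: excess_Cons)
  qed
  then show ?case using b d by (auto intro!: exI[of _ ?g])
qed

section \<open>Continuous extension to the closure\<close>

lemma islimpt_interior_of_convex:
  fixes T :: "'a::euclidean_space set"
  assumes "convex T" "interior T \<noteq> {}" "x \<in> T"
  shows "x islimpt interior T"
proof (cases "x \<in> interior T")
  case True
  then show ?thesis using interior_limit_point[of x "interior T"] by simp
next
  case False
  have "x \<in> closure (interior T)"
    using assms convex_closure_interior closure_subset by blast
  then show ?thesis using False by (simp add: closure_def)
qed

text \<open>The Lipschitz extension to the closure is the limit from the interior. Where \<open>f\<close> is continuous, that limit
is \<open>f x\<close>, also if \<open>x\<close> lies on the boundary.\<close>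

lemma Lim_extension:
  fixes f :: "'a::euclidean_space \<Rightarrow> 'b::banach"
  assumes T: "convex T" "closed T" "interior T \<noteq> {}" and L: "L-lipschitz_on (interior T) f"
  shows "L-lipschitz_on T (\<lambda>x. Lim (at x within interior T) f)"
    and "x \<in> T \<Longrightarrow> isCont f x \<Longrightarrow> Lim (at x within interior T) f = f x"
    and "x \<in> interior T \<Longrightarrow> Lim (at x within interior T) f = f x"
proof -
  have cl: "closure (interior T) = T" using T convex_closure_interior closure_closed by metis
  obtain g where g: "L-lipschitz_on T g" "\<And>x. x \<in> interior T \<Longrightarrow> g x = f x"
    using lipschitz_extend_closure[OF L] unfolding cl by auto
  have nt: "\<not> trivial_limit (at x within interior T)" if "x \<in> T" for x
    using islimpt_interior_of_convex[OF T(1,3) that] by (simp add: trivial_limit_within)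
  have lim: "Lim (at x within interior T) f = g x" if x: "x \<in> T" for x
  proof (rule tendsto_Lim[OF nt[OF x]])
    have "(g \<longlongrightarrow> g x) (at x within interior T)"
      using lipschitz_on_continuous_on[OF g(1)] x interior_subset[of T]
      by (meson continuous_on_def tendsto_within_subset)
    then show "(f \<longlongrightarrow> g x) (at x within interior T)"
      by (rule Lim_transform_eventually) (auto simp: eventually_at_filter g(2))
  qed
  show "L-lipschitz_on T (\<lambda>x. Lim (at x within interior T) f)"
    by (rule lipschitz_on_transform[OF g(1)]) (simp add: lim)
  show "Lim (at x within interior T) f = f x" if "x \<in> T" "isCont f x"
    by (rule tendsto_Lim[OF nt[OF that(1)]]) (use that(2) in \<open>auto simp: isCont_def intro: tendsto_within_subset\<close>)
  show "Lim (at x within interior T) f = f x" if "x \<in> interior T"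
    using lim[of x] g(2)[OF that] that interior_subset[of T] by auto
qed

lemma GDERIV_unique: "GDERIV f x :> D \<Longrightarrow> GDERIV f x :> E \<Longrightarrow> D = E"
proof -
  assume "GDERIV f x :> D" "GDERIV f x :> E"
  then have "(\<lambda>h. h \<bullet> D) = (\<lambda>h. h \<bullet> E)" unfolding gderiv_def by (rule has_derivative_unique)
  then have "\<forall>h. h \<bullet> D = h \<bullet> E" by meson
  then show "D = E" by (simp add: vector_eq_ldot)
qed

lemma grad_eq: "GDERIV f x :> D \<Longrightarrow> grad f x = D"
  unfolding grad_def using GDERIV_unique by blast

lemma lipschitz_on_componentwise:
  fixes g :: "'a::metric_space \<Rightarrow> 'b::euclidean_space"
  assumes "\<And>b. b \<in> Basis \<Longrightarrow> \<exists>L. L-lipschitz_on B (\<lambda>x. g x \<bullet> b)"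
  shows "\<exists>L. L-lipschitz_on B g"
proof -
  obtain L where L: "\<And>b. b \<in> Basis \<Longrightarrow> (L b)-lipschitz_on B (\<lambda>x. g x \<bullet> b)"
    using assms by metis
  have "(\<Sum>b\<in>(Basis::'b set). L b)-lipschitz_on B g"
  proof (rule lipschitz_onI)
    show "0 \<le> (\<Sum>b\<in>(Basis::'b set). L b)" using L lipschitz_on_nonneg by (blast intro: sum_nonneg)
    fix x y assume xy: "x \<in> B" "y \<in> B"
    have "dist (g x) (g y) \<le> (\<Sum>b\<in>Basis. \<bar>(g x - g y) \<bullet> b\<bar>)" unfolding dist_norm by (rule norm_le_l1)
    also have "\<dots> \<le> (\<Sum>b\<in>Basis. L b * dist x y)"
      using L xy by (intro sum_mono) (auto simp: lipschitz_on_def dist_real_def inner_diff_left)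
    finally show "dist (g x) (g y) \<le> (\<Sum>b\<in>Basis. L b) * dist x y" by (simp add: sum_distrib_right)
  qed
  then show ?thesis by blast
qed

lemma bdd_derivs_SucD: "bdd_derivs U B (Suc k) f \<Longrightarrow> bdd_derivs U B k f"
proof (induction k arbitrary: f)
  case 0
  then obtain g where g: "bounded (f ` B)" "\<And>x. x \<in> U \<Longrightarrow> GDERIV f x :> g x" by auto
  have "isCont f x" if "x \<in> U" for x
    using g(2)[OF that] has_derivative_continuous unfolding gderiv_def by blast
  then show ?case using g(1) by (simp add: continuous_at_imp_continuous_on)
next
  case (Suc k)
  then obtain g where "bounded (f ` B)" "\<forall>x\<in>U. GDERIV f x :> g x"
    "\<forall>b\<in>Basis. bdd_derivs U B (Suc k) (\<lambda>x. g x \<bullet> b)" by auto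
  then show ?case using Suc.IH by auto
qed

lemma bdd_derivs_1_lipschitz:
  assumes "bdd_derivs U B 1 f" "convex B" "B \<subseteq> U"
  shows "\<exists>L. L-lipschitz_on B f"
proof -
  obtain g where g: "\<forall>x\<in>U. GDERIV f x :> g x" "\<forall>b\<in>Basis. bounded ((\<lambda>x. g x \<bullet> b) ` B)"
    using assms(1) by (auto simp: One_nat_def)
  obtain M where M: "\<And>b x. b \<in> Basis \<Longrightarrow> x \<in> B \<Longrightarrow> \<bar>g x \<bullet> b\<bar> \<le> M b"
    using g(2) unfolding bounded_iff by simp metis
  define C where "C = (\<Sum>b\<in>Basis. \<bar>M b\<bar>)"
  have gC: "norm (g x) \<le> C" if "x \<in> B" for x
  proof -
    have "norm (g x) \<le> (\<Sum>b\<in>Basis. \<bar>g x \<bullet> b\<bar>)" by (rule norm_le_l1)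
    also have "\<dots> \<le> C" unfolding C_def using M that by (intro sum_mono) fastforce
    finally show ?thesis .
  qed
  have "C-lipschitz_on B f"
  proof (rule bounded_derivative_imp_lipschitz[where f'="\<lambda>x h. h \<bullet> g x"])
    show "(f has_derivative (\<lambda>h. h \<bullet> g x)) (at x within B)" if "x \<in> B" for x
      using g(1) that assms(3) by (auto simp: gderiv_def intro: has_derivative_at_withinI)
    show "onorm (\<lambda>h. h \<bullet> g x) \<le> C" if "x \<in> B" for x
    proof (rule onorm_le)
      fix h
      have "norm (h \<bullet> g x) \<le> norm h * norm (g x)" by (simp add: Cauchy_Schwarz_ineq2)
      also have "\<dots> \<le> C * norm h" using mult_right_mono[OF gC[OF that], of "norm h"] by (simp add: mult.commute)
      finally show "norm (h \<bullet> g x) \<le> C * norm h" .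
    qed
    show "0 \<le> C" unfolding C_def by (simp add: sum_nonneg)
  qed (use assms in auto)
  then show ?thesis by blast
qed

text \<open>The function \<open>y \<mapsto> w y - y \<bullet> g x\<close> has gradient \<open>g y - g x\<close>, which is at most \<open>L * norm (y - x)\<close> on the segment.\<close>

lemma first_order_remainder:
  fixes w :: "'a::euclidean_space \<Rightarrow> real"
  assumes "convex B" "\<And>x. x \<in> B \<Longrightarrow> GDERIV w x :> g x" "L-lipschitz_on B g" "x \<in> B" "y \<in> B"
  shows "\<bar>w y - w x - (y - x) \<bullet> g x\<bar> \<le> L * (norm (y - x))\<^sup>2"
proof -
  let ?S = "closed_segment x y"
  have S: "?S \<subseteq> B" using assms by (simp add: closed_segment_subset)
  have "norm ((w y - y \<bullet> g x) - (w x - x \<bullet> g x)) \<le> (L * norm (y - x)) * norm (y - x)"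
  proof (rule differentiable_bound[where S="?S" and f'="\<lambda>z h. h \<bullet> g z - h \<bullet> g x"])
    fix z assume z: "z \<in> ?S"
    then have zB: "z \<in> B" using S by auto
    have "(w has_derivative (\<lambda>h. h \<bullet> g z)) (at z within ?S)"
      using assms(2)[OF zB] by (auto simp: gderiv_def intro: has_derivative_at_withinI)
    then show "((\<lambda>y. w y - y \<bullet> g x) has_derivative (\<lambda>h. h \<bullet> g z - h \<bullet> g x)) (at z within ?S)"
      by (auto intro!: derivative_eq_intros)
    have "norm (g z - g x) \<le> L * norm (z - x)"
      using lipschitz_onD[OF assms(3) zB assms(4)] by (simp add: dist_norm)
    also have "\<dots> \<le> L * norm (y - x)"
      using segment_bound(1)[OF z] lipschitz_on_nonneg[OF assms(3)] by (intro mult_left_mono) auto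
    finally have *: "norm (g z - g x) \<le> L * norm (y - x)" .
    show "onorm (\<lambda>h. h \<bullet> g z - h \<bullet> g x) \<le> L * norm (y - x)"
    proof (rule onorm_le)
      fix h
      have "norm (h \<bullet> g z - h \<bullet> g x) \<le> norm h * norm (g z - g x)"
        by (simp add: Cauchy_Schwarz_ineq2 flip: inner_diff_right)
      also have "\<dots> \<le> L * norm (y - x) * norm h" using mult_right_mono[OF *, of "norm h"] by (simp add: mult.commute)
      finally show "norm (h \<bullet> g z - h \<bullet> g x) \<le> L * norm (y - x) * norm h" .
    qed
  qed auto
  then show ?thesis by (simp add: inner_diff_left power2_eq_square algebra_simps)
qed

context
  fixes T U :: "(real^3) set" and w :: "real^3 \<Rightarrow> real"
  assumes T: "convex T" "closed T" "interior T \<noteq> {}" and U: "open U" "interior T \<subseteq> U"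
    and w: "bdd_derivs U (interior T) 2 w"
begin

lemma bdd_derivs_2D:
  "\<exists>g. (\<forall>x\<in>U. GDERIV w x :> g x) \<and> (\<forall>b\<in>Basis. bdd_derivs U (interior T) 1 (\<lambda>x. g x \<bullet> b))"
  using w unfolding numeral_2_eq_2 One_nat_def bdd_derivs.simps(2)[of _ _ "Suc 0"] by blast

lemma GDERIV_grad: "x \<in> U \<Longrightarrow> GDERIV w x :> grad w x"
  using bdd_derivs_2D grad_eq by metis

lemma bdd_derivs_grad:
  assumes b: "b \<in> Basis"
  shows "bdd_derivs U (interior T) 1 (\<lambda>x. grad w x \<bullet> b)"
proof -
  obtain g where g: "\<And>x. x \<in> U \<Longrightarrow> GDERIV w x :> g x" "\<And>b. b \<in> Basis \<Longrightarrow> bdd_derivs U (interior T) 1 (\<lambda>x. g x \<bullet> b)"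
    using bdd_derivs_2D by metis
  show ?thesis
  proof (rule bdd_derivs_cong[OF U])
    show "g x \<bullet> b = grad w x \<bullet> b" if "x \<in> U" for x using grad_eq[OF g(1)[OF that]] by simp
    show "bdd_derivs U (interior T) 1 (\<lambda>x. g x \<bullet> b)" using g(2) b by blast
  qed
qed

lemma isCont_grad: assumes "x \<in> U" shows "isCont (grad w) x"
proof -
  have "isCont (\<lambda>x. grad w x \<bullet> b) x" if "b \<in> Basis" for b
  proof -
    have "bdd_derivs U (interior T) 0 (\<lambda>x. grad w x \<bullet> b)"
      using bdd_derivs_grad[OF that] bdd_derivs_SucD unfolding One_nat_def by blast
    then show ?thesis using assms U by (simp add: continuous_on_eq_continuous_at)
  qed
  then show ?thesis by (auto intro: continuous_componentwise[THEN iffD2])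
qed

lemma w_lipschitz_interior: "\<exists>L. L-lipschitz_on (interior T) w"
proof (rule bdd_derivs_1_lipschitz)
  show "bdd_derivs U (interior T) 1 w"
    using w bdd_derivs_SucD unfolding numeral_2_eq_2 One_nat_def by blast
qed (use U T in auto)

lemma grad_lipschitz_interior: "\<exists>L. L-lipschitz_on (interior T) (grad w)"
proof (rule lipschitz_on_componentwise, rule bdd_derivs_1_lipschitz)
  show "convex (interior T)" using T(1) by (rule convex_interior)
qed (rule bdd_derivs_grad, assumption, rule U)

lemma bval_lipschitz: "\<exists>L. L-lipschitz_on T (bval T w)"
  using w_lipschitz_interior Lim_extension(1)[OF T, of _ w] unfolding bval_def by blast

lemma bgrad_lipschitz: "\<exists>L. L-lipschitz_on T (bgrad T w)"
  using grad_lipschitz_interior Lim_extension(1)[OF T, of _ "grad w"] unfolding bgrad_def by blast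

lemma bval_eq: assumes "x \<in> T" "x \<in> U" shows "bval T w x = w x"
proof -
  have "isCont w x" using GDERIV_grad[OF assms(2)] has_derivative_continuous unfolding gderiv_def by blast
  moreover obtain L where "L-lipschitz_on (interior T) w" using w_lipschitz_interior by blast
  ultimately show ?thesis using Lim_extension(2)[OF T, of L w] assms unfolding bval_def by simp
qed

lemma bgrad_eq: assumes "x \<in> T" "x \<in> U" shows "bgrad T w x = grad w x"
proof -
  obtain L where "L-lipschitz_on (interior T) (grad w)" using grad_lipschitz_interior by blast
  then show ?thesis using Lim_extension(2)[OF T, of L "grad w"] isCont_grad assms
    unfolding bgrad_def by simp
qed

lemma GDERIV_bgrad: "x \<in> T \<Longrightarrow> x \<in> U \<Longrightarrow> GDERIV w x :> bgrad T w x"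
  using bgrad_eq GDERIV_grad by simp

text \<open>The remainder estimate holds uniformly for pairs of interior points, and both sides are continuous on \<open>T\<close>;
so it extends to all pairs of points of \<open>T\<close>. In this way \<open>bgrad\<close> is a one-sided derivative also at vertices
and along edges, outside the region where \<open>w\<close> itself is differentiable.\<close>

lemma bval_remainder:
  "\<exists>L. \<forall>x\<in>T. \<forall>y\<in>T. \<bar>bval T w y - bval T w x - (y - x) \<bullet> bgrad T w x\<bar> \<le> L * (norm (y - x))\<^sup>2"
proof -
  obtain L where L: "L-lipschitz_on (interior T) (grad w)" using grad_lipschitz_interior by blast
  let ?u = "bval T w" and ?G = "bgrad T w"
  have cl: "closure (interior T) = T" using T convex_closure_interior closure_closed by metis
  have cu: "continuous_on T ?u" using bval_lipschitz lipschitz_on_continuous_on by blast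
  have cG: "continuous_on T ?G" using bgrad_lipschitz lipschitz_on_continuous_on by blast
  have int: "interior T \<subseteq> T" by (rule interior_subset)
  define R where "R x y = \<bar>?u y - ?u x - (y - x) \<bullet> ?G x\<bar> - L * (norm (y - x))\<^sup>2" for x y
  have 0: "R x y \<le> 0" if "x \<in> interior T" "y \<in> interior T" for x y
    using first_order_remainder[of "interior T" w "grad w", OF _ _ L that] that T U GDERIV_grad int
      bval_eq bgrad_eq by (auto simp: R_def subset_iff)
  have 1: "R x y \<le> 0" if "x \<in> interior T" "y \<in> T" for x y
  proof (rule continuous_le_on_closure[where S="interior T"])
    show "continuous_on (closure (interior T)) (R x)" unfolding cl R_def
      by (intro continuous_intros cu)
  qed (use that cl 0 in auto)
  have 2: "R x y \<le> 0" if "x \<in> T" "y \<in> T" for x y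
  proof (rule continuous_le_on_closure[where S="interior T" and f="\<lambda>x. R x y"])
    show "continuous_on (closure (interior T)) (\<lambda>x. R x y)" unfolding cl R_def
      by (intro continuous_intros cu cG)
  qed (use that cl 1 in auto)
  then show ?thesis unfolding R_def by force
qed

lemma bval_has_derivative:
  assumes x: "x \<in> T"
  shows "(bval T w has_derivative (\<lambda>h. h \<bullet> bgrad T w x)) (at x within T)"
proof -
  obtain L where L: "\<And>y. y \<in> T \<Longrightarrow> \<bar>bval T w y - bval T w x - (y - x) \<bullet> bgrad T w x\<bar> \<le> L * (norm (y - x))\<^sup>2"
    using bval_remainder x by blast
  show ?thesis unfolding has_derivative_within_alt
  proof (intro conjI allI impI)
    show "bounded_linear (\<lambda>h. h \<bullet> bgrad T w x)" by (rule bounded_linear_inner_left)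
    fix e :: real assume e: "0 < e"
    define d where "d = e / (\<bar>L\<bar> + 1)"
    have d: "0 < d" using e by (simp add: d_def)
    have "norm (bval T w y - bval T w x - (y - x) \<bullet> bgrad T w x) \<le> e * norm (y - x)"
      if "y \<in> T" "norm (y - x) < d" for y
    proof -
      have "\<bar>bval T w y - bval T w x - (y - x) \<bullet> bgrad T w x\<bar> \<le> L * (norm (y - x))\<^sup>2" using L that by blast
      also have "\<dots> \<le> (\<bar>L\<bar> + 1) * norm (y - x) * norm (y - x)"
        unfolding power2_eq_square mult.assoc[symmetric] by (intro mult_right_mono) auto
      also have "\<dots> \<le> ((\<bar>L\<bar> + 1) * d) * norm (y - x)" using that(2) by (intro mult_right_mono mult_left_mono) auto
      also have "\<dots> = e * norm (y - x)" unfolding d_def by simp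
      finally show ?thesis by simp
    qed
    then show "\<exists>d>0. \<forall>y\<in>T. norm (y - x) < d \<longrightarrow>
        norm (bval T w y - bval T w x - (y - x) \<bullet> bgrad T w x) \<le> e * norm (y - x)"
      using d by blast
  qed
qed

lemma bgrad_component_differentiable:
  assumes x: "x \<in> interior T" and b: "b \<in> Basis"
  shows "(\<lambda>y. bgrad T w y \<bullet> b) differentiable (at x)"
proof -
  have "(\<lambda>x. grad w x \<bullet> b) differentiable (at x)"
  proof -
    obtain h where "\<forall>x\<in>U. GDERIV (\<lambda>x. grad w x \<bullet> b) x :> h x"
      using bdd_derivs_grad[OF b] unfolding One_nat_def bdd_derivs.simps by blast
    then show ?thesis using x U unfolding gderiv_def differentiable_def by blast
  qed
  then obtain D where "((\<lambda>x. grad w x \<bullet> b) has_derivative D) (at x)" by (auto simp: differentiable_def)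
  then have "((\<lambda>y. bgrad T w y \<bullet> b) has_derivative D) (at x)"
    by (rule has_derivative_transform_within_open[OF _ open_interior x])
      (use U bgrad_eq interior_subset[of T] in \<open>auto simp: subset_iff\<close>)
  then show ?thesis by (auto simp: differentiable_def)
qed

end

section \<open>Geometry of a tetrahedron\<close>

lemma verts_convex_hull: "\<not> affine_dependent C \<Longrightarrow> verts (convex hull C) = C"
  by (auto simp: verts_def extreme_point_of_convex_hull_affine_independent)

locale tetrahedron =
  fixes T :: "(real^3) set"
  assumes simplex3: "3 simplex T"
begin

abbreviation "V \<equiv> verts T"

lemma V_indep: "\<not> affine_dependent V" and V_hull: "convex hull V = T" and card_V: "card V = 4"
proof -
  obtain C where C: "\<not> affine_dependent C" "int (card C) = 3 + 1" "T = convex hull C"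
    using simplex3 by (auto simp: simplex_def)
  have "V = C" using C verts_convex_hull by simp
  then show "\<not> affine_dependent V" "convex hull V = T" "card V = 4" using C by auto
qed

lemma finite_V [simp]: "finite V"
  using V_indep aff_independent_finite by blast

lemma bary_exists: "\<exists>u. sum u V = 1 \<and> (\<Sum>v\<in>V. u v *\<^sub>R v) = x"
proof -
  have "affine hull V = UNIV"
    using affine_independent_span_eq[OF V_indep] card_V by simp
  then show ?thesis using affine_hull_finite[OF finite_V] by auto
qed

lemma bary_unique:
  assumes "sum u V = 1" "(\<Sum>v\<in>V. u v *\<^sub>R v) = x" "i \<in> V"
  shows "bary T i x = u i"
proof -
  have "u' i = u i" if "sum u' V = 1" "(\<Sum>v\<in>V. u' v *\<^sub>R v) = x" for u'
  proof (rule ccontr)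
    assume "u' i \<noteq> u i"
    then have "sum (\<lambda>v. u' v - u v) V = 0 \<and> (\<exists>v\<in>V. u' v - u v \<noteq> 0) \<and> (\<Sum>v\<in>V. (u' v - u v) *\<^sub>R v) = 0"
      using that assms by (auto simp: sum_subtractf scaleR_left_diff_distrib)
    then have "affine_dependent V" unfolding affine_dependent_explicit_finite[OF finite_V] by blast
    then show False using V_indep by simp
  qed
  then show ?thesis unfolding bary_def using assms by (intro the_equality) blast+
qed

lemma bary_sum: "(\<Sum>i\<in>V. bary T i x) = 1" and bary_comb: "(\<Sum>i\<in>V. bary T i x *\<^sub>R i) = x"
proof -
  obtain u where u: "sum u V = 1" "(\<Sum>v\<in>V. u v *\<^sub>R v) = x" using bary_exists by blast
  have eq: "bary T i x = u i" if "i \<in> V" for i using bary_unique[OF u that] .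
  have "(\<Sum>i\<in>V. bary T i x) = sum u V" by (rule sum.cong[OF refl]) (rule eq)
  then show "(\<Sum>i\<in>V. bary T i x) = 1" using u by simp
  have "(\<Sum>i\<in>V. bary T i x *\<^sub>R i) = (\<Sum>i\<in>V. u i *\<^sub>R i)" by (rule sum.cong[OF refl]) (simp add: eq)
  then show "(\<Sum>i\<in>V. bary T i x *\<^sub>R i) = x" using u by simp
qed

lemma bary_affine_combination:
  assumes "i \<in> V" "a + b + c = 1"
  shows "bary T i (a *\<^sub>R x + b *\<^sub>R y + c *\<^sub>R z) = a * bary T i x + b * bary T i y + c * bary T i z"
proof (rule bary_unique[OF _ _ assms(1)])
  show "(\<Sum>i\<in>V. a * bary T i x + b * bary T i y + c * bary T i z) = 1"
    using assms(2) by (simp add: sum.distrib bary_sum flip: sum_distrib_left)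
  have "(\<Sum>v\<in>V. (a * bary T v x + b * bary T v y + c * bary T v z) *\<^sub>R v) =
    a *\<^sub>R (\<Sum>v\<in>V. bary T v x *\<^sub>R v) + b *\<^sub>R (\<Sum>v\<in>V. bary T v y *\<^sub>R v) + c *\<^sub>R (\<Sum>v\<in>V. bary T v z *\<^sub>R v)"
    by (simp add: scaleR_left_distrib sum.distrib scaleR_sum_right)
  then show "(\<Sum>v\<in>V. (a * bary T v x + b * bary T v y + c * bary T v z) *\<^sub>R v) = a *\<^sub>R x + b *\<^sub>R y + c *\<^sub>R z"
    by (simp add: bary_comb)
qed

text \<open>The constant gradient of the affine function \<open>bary T i\<close>.\<close>

definition lgrad :: "real^3 \<Rightarrow> real^3" where
  "lgrad i = (\<Sum>b\<in>Basis. (bary T i b - bary T i 0) *\<^sub>R b)"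

lemma bary_eq: assumes "i \<in> V" shows "bary T i x = bary T i 0 + x \<bullet> lgrad i"
proof -
  define f where "f x = bary T i x - bary T i 0" for x
  have "linear f"
  proof (rule linearI)
    show "f (x + y) = f x + f y" for x y
      using bary_affine_combination[OF assms, of 1 1 "-1" x y 0] by (simp add: f_def)
    show "f (c *\<^sub>R x) = c *\<^sub>R f x" for c x
      using bary_affine_combination[OF assms, of c "1-c" 0 x 0 0] by (simp add: f_def algebra_simps)
  qed
  have "f x = f (\<Sum>b\<in>Basis. (x \<bullet> b) *\<^sub>R b)" by (simp only: euclidean_representation)
  also have "\<dots> = (\<Sum>b\<in>Basis. (x \<bullet> b) *\<^sub>R f b)"
    by (simp only: linear_sum[OF \<open>linear f\<close>] linear_cmul[OF \<open>linear f\<close>])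
  also have "\<dots> = x \<bullet> lgrad i" by (simp add: lgrad_def f_def inner_sum_right mult.commute)
  finally show ?thesis by (simp add: f_def)
qed

lemma bary_diff: "i \<in> V \<Longrightarrow> bary T i x - bary T i y = (x - y) \<bullet> lgrad i"
  by (subst bary_eq[of i x], assumption, subst bary_eq[of i y], assumption) (simp add: inner_diff_left)

lemma GDERIV_bary: assumes "i \<in> V" shows "GDERIV (bary T i) x :> lgrad i"
proof -
  have "bary T i = (\<lambda>x. bary T i 0 + x \<bullet> lgrad i)" using bary_eq[OF assms] by blast
  moreover have "((\<lambda>x. bary T i 0 + x \<bullet> lgrad i) has_derivative (\<lambda>h. h \<bullet> lgrad i)) (at x)"
    by (auto intro!: derivative_eq_intros)
  ultimately show ?thesis unfolding gderiv_def by metis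
qed

lemma grad_bary: "i \<in> V \<Longrightarrow> grad (bary T i) x = lgrad i"
  by (rule grad_eq[OF GDERIV_bary])

lemma isCont_bary: "i \<in> V \<Longrightarrow> isCont (bary T i) x"
  using GDERIV_bary has_derivative_continuous unfolding gderiv_def by blast

lemma continuous_on_bary: "i \<in> V \<Longrightarrow> continuous_on S (bary T i)"
  using isCont_bary by (simp add: continuous_at_imp_continuous_on)

lemma bary_vertex: "i \<in> V \<Longrightarrow> j \<in> V \<Longrightarrow> bary T i j = (if i = j then 1 else 0)"
  by (rule bary_unique) (auto simp: if_distrib[of "\<lambda>c. c *\<^sub>R _"] cong: if_cong)

lemma lgrad_edge:
  "i \<in> V \<Longrightarrow> j \<in> V \<Longrightarrow> k \<in> V \<Longrightarrow> (j - k) \<bullet> lgrad i = (if i = j then 1 else 0) - (if i = k then 1 else 0)"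
  using bary_diff[of i j k] by (simp add: bary_vertex)

lemma T_eq: "T = {x. \<forall>i\<in>V. 0 \<le> bary T i x}"
proof (intro set_eqI iffI CollectI)
  fix x assume "x \<in> T"
  then have "x \<in> convex hull V" using V_hull by simp
  then obtain u where u: "\<forall>v\<in>V. 0 \<le> u v" "sum u V = 1" "(\<Sum>v\<in>V. u v *\<^sub>R v) = x"
    unfolding convex_hull_finite[OF finite_V] by blast
  then show "\<forall>i\<in>V. 0 \<le> bary T i x" using bary_unique[OF u(2,3)] by simp
next
  fix x assume "x \<in> {x. \<forall>i\<in>V. 0 \<le> bary T i x}"
  then have "x \<in> convex hull V"
    unfolding convex_hull_finite[OF finite_V]
    using bary_sum bary_comb by (intro CollectI exI[of _ "\<lambda>v. bary T v x"]) auto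
  then show "x \<in> T" using V_hull by simp
qed

lemma interior_T: "interior T = {x. \<forall>i\<in>V. 0 < bary T i x}"
proof -
  have "interior (convex hull V) = {y. \<exists>u. (\<forall>x\<in>V. 0 < u x) \<and> sum u V = 1 \<and> (\<Sum>x\<in>V. u x *\<^sub>R x) = y}"
    using interior_convex_hull_explicit_minimal[OF V_indep] card_V by simp
  also have "\<dots> = {x. \<forall>i\<in>V. 0 < bary T i x}"
    using bary_unique bary_sum bary_comb by fastforce
  finally show ?thesis using V_hull by simp
qed

lemma interior_subset_T: "x \<in> interior T \<Longrightarrow> x \<in> T" using interior_subset by blast

lemma compact_T: "compact T" and convex_T: "convex T" and closed_T: "closed T"
  using V_hull finite_V compact_convex_hull[OF finite_imp_compact] convex_convex_hull
  by (metis compact_imp_closed)+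

lemma interior_T_nonempty: "interior T \<noteq> {}"
proof -
  have "bary T i (\<Sum>j\<in>V. (1/4) *\<^sub>R j) = 1/4" if "i \<in> V" for i
    using that card_V by (intro bary_unique) auto
  then have "\<forall>i\<in>V. 0 < bary T i (\<Sum>j\<in>V. (1/4) *\<^sub>R j)" by (metis zero_less_divide_1_iff zero_less_numeral)
  then have "(\<Sum>j\<in>V. (1/4) *\<^sub>R j) \<in> interior T" unfolding interior_T by (simp del: sum_constant_scaleR)
  then show ?thesis by blast
qed

lemma bary_le_1: assumes "x \<in> T" "i \<in> V" shows "bary T i x \<le> 1"
proof -
  have "bary T i x \<le> (\<Sum>j\<in>V. bary T j x)" using assms T_eq by (intro member_le_sum) auto
  then show ?thesis by (simp add: bary_sum)
qed

text \<open>No denominator of a local function vanishes here. The region contains the interior and the relatively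
open faces of \<open>T\<close>, but no point of an edge.\<close>

definition region :: "(real^3) set" where
  "region = {x. \<forall>i\<in>V. \<forall>j\<in>V. i \<noteq> j \<longrightarrow> 0 < bary T i x + bary T j x}"

lemma open_region: "open region"
proof -
  have "region = (\<Inter>i\<in>V. \<Inter>j\<in>V-{i}. {x. 0 < bary T i x + bary T j x})" by (auto simp: region_def)
  moreover have "open {x. 0 < bary T i x + bary T j x}" if "i \<in> V" "j \<in> V" for i j
    using that by (intro open_Collect_less continuous_intros continuous_on_bary) auto
  ultimately show ?thesis by (auto intro!: open_INT)
qed

lemma interior_subset_region: "interior T \<subseteq> region"
  by (auto simp: interior_T region_def intro: add_pos_pos)

lemma rel_interior_opp_face:
  assumes "i \<in> V"
  shows "rel_interior (opp_face T i) = {x. bary T i x = 0 \<and> (\<forall>j\<in>V-{i}. 0 < bary T j x)}"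
proof -
  have "\<not> affine_dependent (V - {i})" using V_indep affine_independent_subset by blast
  then have *: "rel_interior (opp_face T i) =
     {y. \<exists>u. (\<forall>x\<in>V-{i}. 0 < u x) \<and> sum u (V-{i}) = 1 \<and> (\<Sum>x\<in>V-{i}. u x *\<^sub>R x) = y}"
    unfolding opp_face_def by (rule rel_interior_convex_hull_explicit)
  show ?thesis unfolding *
  proof (intro set_eqI iffI; clarsimp)
    fix u :: "real^3 \<Rightarrow> real" assume u: "\<forall>x\<in>V-{i}. 0 < u x" "sum u (V-{i}) = 1"
    let ?u = "\<lambda>j. if j = i then 0 else u j"
    have 1: "sum ?u V = 1" using u assms by (subst sum.remove[of V i]) auto
    have 2: "(\<Sum>v\<in>V. ?u v *\<^sub>R v) = (\<Sum>x\<in>V-{i}. u x *\<^sub>R x)" using assms by (subst sum.remove[of V i]) auto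
    show "bary T i (\<Sum>x\<in>V-{i}. u x *\<^sub>R x) = 0 \<and> (\<forall>j\<in>V-{i}. 0 < bary T j (\<Sum>x\<in>V-{i}. u x *\<^sub>R x))"
      using bary_unique[OF 1 2] assms u by auto
  next
    fix x assume x: "bary T i x = 0" "\<forall>j\<in>V-{i}. 0 < bary T j x"
    show "\<exists>u. (\<forall>x\<in>V-{i}. 0 < u x) \<and> sum u (V-{i}) = 1 \<and> (\<Sum>x\<in>V-{i}. u x *\<^sub>R x) = x"
      using x assms bary_sum[of x] bary_comb[of x]
      by (intro exI[of _ "\<lambda>j. bary T j x"]) (auto simp: sum.remove[of V i])
  qed
qed

lemma rel_interior_opp_face_subset:
  assumes "i \<in> V" "x \<in> rel_interior (opp_face T i)"
  shows "x \<in> T" "x \<in> region"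
proof -
  have z: "bary T i x = 0" and p: "\<And>j. j \<in> V \<Longrightarrow> j \<noteq> i \<Longrightarrow> 0 < bary T j x"
    using assms(2) unfolding rel_interior_opp_face[OF assms(1)] by auto
  have n: "0 \<le> bary T j x" if "j \<in> V" for j using z p[OF that] by (cases "j = i") auto
  then show "x \<in> T" by (subst T_eq) simp
  show "x \<in> region" unfolding region_def
  proof (intro CollectI ballI impI)
    fix j k assume jk: "j \<in> V" "k \<in> V" "j \<noteq> k"
    show "0 < bary T j x + bary T k x"
      using n[OF jk(1)] n[OF jk(2)] p[OF jk(1)] p[OF jk(2)] jk(3) by (cases "j = i") auto
  qed
qed

text \<open>The vectors \<open>a - k\<close> and the gradients \<open>lgrad a\<close>, where \<open>a\<close> runs through the vertices other than \<open>k\<close>, are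
dual bases, because \<open>y = (\<Sum>a\<in>V. (y \<bullet> lgrad a) *\<^sub>R a)\<close> and the coefficients add up to zero.\<close>

lemma dual_basis_expansion:
  assumes "k \<in> V" shows "N = (\<Sum>a\<in>V-{k}. (N \<bullet> (a - k)) *\<^sub>R lgrad a)"
proof -
  have "N \<bullet> y = (\<Sum>a\<in>V-{k}. (N \<bullet> (a - k)) *\<^sub>R lgrad a) \<bullet> y" for y
  proof -
    have d: "y \<bullet> lgrad a = bary T a y - bary T a 0" if "a \<in> V" for a
      using bary_diff[OF that, of y 0] by simp
    have "(\<Sum>a\<in>V. y \<bullet> lgrad a) = (\<Sum>a\<in>V. bary T a y - bary T a 0)"
      by (rule sum.cong[OF refl]) (rule d)
    then have s0: "(\<Sum>a\<in>V. y \<bullet> lgrad a) = 0" by (simp add: sum_subtractf bary_sum)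
    have "(\<Sum>a\<in>V. (y \<bullet> lgrad a) *\<^sub>R a) = (\<Sum>a\<in>V. bary T a y *\<^sub>R a - bary T a 0 *\<^sub>R a)"
      by (rule sum.cong[OF refl]) (simp add: d scaleR_left_diff_distrib)
    then have s1: "(\<Sum>a\<in>V. (y \<bullet> lgrad a) *\<^sub>R a) = y" by (simp add: sum_subtractf bary_comb)
    have "(\<Sum>a\<in>V-{k}. (N \<bullet> (a - k)) *\<^sub>R lgrad a) \<bullet> y = (\<Sum>a\<in>V-{k}. (N \<bullet> (a - k)) * (y \<bullet> lgrad a))"
      unfolding inner_sum_left inner_scaleR_left by (simp add: inner_commute)
    also have "\<dots> = (\<Sum>a\<in>V. (N \<bullet> (a - k)) * (y \<bullet> lgrad a))"
      using assms by (simp add: sum.remove[of V k])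
    also have "\<dots> = N \<bullet> ((\<Sum>a\<in>V. (y \<bullet> lgrad a) *\<^sub>R a) - (\<Sum>a\<in>V. y \<bullet> lgrad a) *\<^sub>R k)"
      by (simp add: inner_sum_right inner_diff_right scaleR_sum_left algebra_simps sum_subtractf)
    also have "\<dots> = N \<bullet> y" by (simp add: s0 s1)
    finally show ?thesis by simp
  qed
  then show ?thesis using vector_eq_rdot by blast
qed

lemma other_vertex: obtains k where "k \<in> V" "k \<noteq> i"
proof -
  have "\<not> V \<subseteq> {i}"
  proof
    assume "V \<subseteq> {i}"
    then have "card V \<le> card {i}" by (intro card_mono) auto
    then show False using card_V by simp
  qed
  then show ?thesis using that by blast
qed

lemma lgrad_nonzero: assumes "i \<in> V" shows "lgrad i \<noteq> 0"
proof
  assume 0: "lgrad i = 0"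
  obtain j where j: "j \<in> V" "j \<noteq> i" by (rule other_vertex)
  have "(i - j) \<bullet> lgrad i = 1" using lgrad_edge[OF assms assms j(1)] j by simp
  then show False using 0 by simp
qed

text \<open>Expanded at a vertex \<open>k\<close> of the face, a vector orthogonal to the face keeps only its \<open>lgrad i\<close> component;
length and sign determine the factor.\<close>

lemma outer_normal_eq: assumes i: "i \<in> V" shows "outer_normal T i = - (1 / norm (lgrad i)) *\<^sub>R lgrad i"
proof -
  have b: "bary T i x = 0" if x: "x \<in> opp_face T i" for x
  proof -
    have "x \<in> affine hull (V - {i})"
      using x convex_hull_subset_affine_hull unfolding opp_face_def by blast
    then obtain u where u: "sum u (V - {i}) = 1" "(\<Sum>v\<in>V-{i}. u v *\<^sub>R v) = x"
      unfolding affine_hull_finite[OF finite_Diff[OF finite_V]] by blast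
    then have "bary T i x = (if i = i then 0 else u i)"
      using i by (intro bary_unique[of "\<lambda>j. if j = i then 0 else u j"]) (auto simp: sum.remove[of V i])
    then show ?thesis by simp
  qed
  have vf: "j \<in> opp_face T i" if "j \<in> V" "j \<noteq> i" for j
    using that unfolding opp_face_def by (auto intro: hull_inc)
  obtain k where k: "k \<in> V" "k \<noteq> i" by (rule other_vertex)
  let ?n = "- (1 / norm (lgrad i)) *\<^sub>R lgrad i"
  have nz: "norm (lgrad i) > 0" using lgrad_nonzero[OF i] by simp
  show ?thesis unfolding outer_normal_def
  proof (rule the_equality, intro conjI ballI)
    show "norm ?n = 1" using nz by simp
    show "?n \<bullet> (x - y) = 0" if "x \<in> opp_face T i" "y \<in> opp_face T i" for x y
      using bary_diff[OF i, of x y] b that by (simp add: inner_commute)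
    show "?n \<bullet> (i - x) < 0" if "x \<in> opp_face T i" for x
      using bary_diff[OF i, of i x] b that nz i by (simp add: inner_commute bary_vertex)
  next
    fix n assume n: "norm n = 1 \<and> (\<forall>x\<in>opp_face T i. \<forall>y\<in>opp_face T i. n \<bullet> (x - y) = 0) \<and>
      (\<forall>x\<in>opp_face T i. n \<bullet> (i - x) < 0)"
    have "n = (\<Sum>a\<in>V-{k}. (n \<bullet> (a - k)) *\<^sub>R lgrad a)" by (rule dual_basis_expansion[OF k(1)])
    also have "\<dots> = (\<Sum>a\<in>V-{k}. if a = i then (n \<bullet> (i - k)) *\<^sub>R lgrad i else 0)"
      using n vf k by (intro sum.cong) auto
    also have "\<dots> = (n \<bullet> (i - k)) *\<^sub>R lgrad i" using i k by simp
    finally have eq: "n = (n \<bullet> (i - k)) *\<^sub>R lgrad i" .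
    define s where "s = n \<bullet> (i - k)"
    have s: "s < 0" using n vf[OF k] by (simp add: s_def)
    have ns: "n = s *\<^sub>R lgrad i" using eq by (simp only: s_def)
    have "norm n = \<bar>s\<bar> * norm (lgrad i)" unfolding ns by simp
    then have "- s * norm (lgrad i) = 1" using n s by simp
    then have "s = - (1 / norm (lgrad i))" using nz by (simp add: field_simps)
    then show "n = ?n" by (subst ns) simp
  qed
qed

lemma dcoef_nonzero: "i \<in> V \<Longrightarrow> dcoef T i i \<noteq> 0"
  by (simp add: dcoef_def grad_bary outer_normal_eq lgrad_nonzero)

lemma dcoef_eq: "i \<in> V \<Longrightarrow> j \<in> V \<Longrightarrow> dcoef T j i = lgrad j \<bullet> outer_normal T i"
  by (simp add: dcoef_def grad_bary)

end

section \<open>Weak derivatives of piecewise smooth Lipschitz functions\<close>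

lemma partials_append: "partials (as @ bs) f = partials as (partials bs f)"
  by (simp add: partials_def)

lemma partials_Nil: "partials [] f = f"
  by (simp add: partials_def)

lemma partials_single: "partials [b] f x = frechet_derivative f (at x) b"
  by (simp add: partials_def)

context
  fixes \<Omega> :: "(real^3) set" and \<phi> :: "real^3 \<Rightarrow> real"
  assumes \<phi>: "\<phi> \<in> test_functions \<Omega>"
begin

lemma test_has_derivative: "(\<phi> has_derivative frechet_derivative \<phi> (at x)) (at x)"
proof -
  have "smooth \<phi>" using \<phi> by (simp add: test_functions_def)
  then have "\<forall>x. partials [] \<phi> differentiable (at x)" unfolding smooth_def by blast
  then show ?thesis by (simp add: partials_Nil frechet_derivative_works)
qed

lemma test_zero: "x \<notin> closure {x. \<phi> x \<noteq> 0} \<Longrightarrow> \<phi> x = 0"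
  using closure_subset[of "{x. \<phi> x \<noteq> 0}"] by auto

lemma test_partial_zero: assumes "x \<notin> closure {x. \<phi> x \<noteq> 0}" shows "partials [b] \<phi> x = 0"
proof -
  have "((\<lambda>x. 0) has_derivative frechet_derivative \<phi> (at x)) (at x)"
  proof (rule has_derivative_transform_within_open[OF test_has_derivative])
    show "open (- closure {x. \<phi> x \<noteq> 0})" by (intro open_Compl closed_closure)
    show "x \<in> - closure {x. \<phi> x \<noteq> 0}" using assms by blast
    show "\<phi> y = 0" if "y \<in> - closure {x. \<phi> x \<noteq> 0}" for y using that test_zero by blast
  qed
  then have "frechet_derivative \<phi> (at x) = (\<lambda>h. 0)"
    using has_derivative_unique has_derivative_const by blast
  then show ?thesis by (simp add: partials_single)
qed

lemma test_partials: assumes b: "b \<in> Basis" shows "partials [b] \<phi> \<in> test_functions \<Omega>"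
proof -
  let ?K = "closure {x. \<phi> x \<noteq> 0}"
  have sm: "smooth \<phi>" and K: "compact ?K" "?K \<subseteq> \<Omega>" using \<phi> by (auto simp: test_functions_def)
  have "{x. partials [b] \<phi> x \<noteq> 0} \<subseteq> ?K" using test_partial_zero by blast
  then have sub: "closure {x. partials [b] \<phi> x \<noteq> 0} \<subseteq> ?K" by (simp add: closure_minimal)
  have "partials bs (partials [b] \<phi>) differentiable (at x)" if "bs \<in> lists Basis" for bs x
  proof -
    have "bs @ [b] \<in> lists Basis" using that b by simp
    then show ?thesis using sm unfolding smooth_def partials_append[symmetric] by blast
  qed
  then have "smooth (partials [b] \<phi>)" unfolding smooth_def by blast
  moreover have "compact (?K \<inter> closure {x. partials [b] \<phi> x \<noteq> 0})"
    by (intro compact_Int_closed K closed_closure)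
  moreover have "?K \<inter> closure {x. partials [b] \<phi> x \<noteq> 0} = closure {x. partials [b] \<phi> x \<noteq> 0}"
    using sub by blast
  ultimately show ?thesis using sub K by (auto simp: test_functions_def)
qed

lemma test_continuous: "continuous_on S \<phi>"
proof (rule continuous_at_imp_continuous_on, rule ballI)
  show "isCont \<phi> x" for x by (rule has_derivative_continuous[OF test_has_derivative])
qed

lemma test_bounded: "\<exists>C. \<forall>x. \<bar>\<phi> x\<bar> \<le> C"
proof -
  let ?K = "closure {x. \<phi> x \<noteq> 0}"
  have "compact ?K" using \<phi> unfolding test_functions_def by blast
  then have "compact (\<phi> ` ?K)" by (rule compact_continuous_image[OF test_continuous])
  then have "bounded (\<phi> ` ?K)" by (rule compact_imp_bounded)
  then obtain C where C: "\<And>x. x \<in> ?K \<Longrightarrow> norm (\<phi> x) \<le> C" unfolding bounded_iff by blast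
  have "\<bar>\<phi> x\<bar> \<le> \<bar>C\<bar>" for x
  proof (cases "x \<in> ?K")
    case True
    then show ?thesis using C[OF True] by simp
  next
    case False
    show ?thesis unfolding test_zero[OF False] by simp
  qed
  then show ?thesis by blast
qed

end

text \<open>The partial derivatives are continuous with compact support, hence bounded.\<close>

lemma test_lipschitz:
  assumes \<phi>: "\<phi> \<in> test_functions \<Omega>"
  shows "\<exists>C. C-lipschitz_on UNIV \<phi>"
proof -
  have "\<exists>C. \<forall>x. \<bar>partials [b] \<phi> x\<bar> \<le> C" if "b \<in> Basis" for b
    using test_bounded[OF test_partials[OF \<phi> that]] .
  then obtain C where C: "\<And>b x. b \<in> Basis \<Longrightarrow> \<bar>partials [b] \<phi> x\<bar> \<le> C b" by metis
  have C0: "0 \<le> C b" if "b \<in> Basis" for b using C[OF that, of 0] by linarith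
  have "(\<Sum>b\<in>Basis. C b)-lipschitz_on UNIV \<phi>"
  proof (rule bounded_derivative_imp_lipschitz)
    show "(\<phi> has_derivative frechet_derivative \<phi> (at x)) (at x within UNIV)" for x
      by (rule test_has_derivative[OF \<phi>])
    show "onorm (frechet_derivative \<phi> (at x)) \<le> (\<Sum>b\<in>Basis. C b)" for x
    proof (rule onorm_le)
      fix h
      have lin: "linear (frechet_derivative \<phi> (at x))"
        using test_has_derivative[OF \<phi>] has_derivative_linear by blast
      have "frechet_derivative \<phi> (at x) h = frechet_derivative \<phi> (at x) (\<Sum>b\<in>Basis. (h \<bullet> b) *\<^sub>R b)"
        by (simp only: euclidean_representation)
      also have "\<dots> = (\<Sum>b\<in>Basis. (h \<bullet> b) * partials [b] \<phi> x)"
        by (simp only: linear_sum[OF lin] linear_cmul[OF lin] partials_single real_scaleR_def)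
      finally have "norm (frechet_derivative \<phi> (at x) h) \<le> (\<Sum>b\<in>Basis. norm ((h \<bullet> b) * partials [b] \<phi> x))"
        by (simp only: norm_sum)
      also have "\<dots> \<le> (\<Sum>b\<in>Basis. norm h * C b)"
        using C Basis_le_norm[of _ h] by (intro sum_mono) (auto simp: abs_mult intro!: mult_mono)
      finally show "norm (frechet_derivative \<phi> (at x) h) \<le> (\<Sum>b\<in>Basis. C b) * norm h"
        by (simp add: sum_distrib_left mult.commute)
    qed
    show "0 \<le> (\<Sum>b\<in>Basis. C b)" using C0 by (rule sum_nonneg)
  qed auto
  then show ?thesis by blast
qed

lemma difference_quotients_tendsto:
  fixes f :: "'a::real_normed_vector \<Rightarrow> real"
  assumes "(f has_derivative f') (at x)"
  shows "(\<lambda>n. (f (x + inverse (real (Suc n)) *\<^sub>R b) - f x) * real (Suc n)) \<longlonglongrightarrow> f' b"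
proof -
  have lin: "linear f'" using assms has_derivative_linear by blast
  have d1: "((\<lambda>t::real. x + t *\<^sub>R b) has_derivative (\<lambda>t. t *\<^sub>R b)) (at 0)"
    by (auto intro!: derivative_eq_intros)
  have d2: "(f has_derivative f') (at (x + 0 *\<^sub>R b))" using assms by simp
  have "((\<lambda>t::real. f (x + t *\<^sub>R b)) has_derivative (\<lambda>t. f' (t *\<^sub>R b))) (at 0)"
    using has_derivative_compose[OF d1 d2] .
  then have "DERIV (\<lambda>t::real. f (x + t *\<^sub>R b)) 0 :> f' b"
    unfolding has_field_derivative_def by (simp add: linear_cmul[OF lin] mult.commute[of _ "f' b"])
  then have lim: "((\<lambda>t::real. (f (x + t *\<^sub>R b) - f x) / t) \<longlongrightarrow> f' b) (at 0)"
    by (simp add: DERIV_def)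
  have "filterlim (\<lambda>n. inverse (real (Suc n))) (at 0) sequentially"
    unfolding filterlim_at using LIMSEQ_inverse_real_of_nat by auto
  from filterlim_compose[OF lim this] show ?thesis by (simp add: divide_inverse)
qed

lemma lipschitz_on_mult_bounded:
  fixes u v :: "'a::metric_space \<Rightarrow> real"
  assumes "L-lipschitz_on S u" "M-lipschitz_on S v" "\<And>x. x \<in> S \<Longrightarrow> \<bar>u x\<bar> \<le> A" "\<And>x. x \<in> S \<Longrightarrow> \<bar>v x\<bar> \<le> B" "0 \<le> A" "0 \<le> B"
  shows "(A * M + B * L)-lipschitz_on S (\<lambda>x. u x * v x)"
proof (rule lipschitz_onI)
  show "0 \<le> A * M + B * L" using assms lipschitz_on_nonneg[OF assms(1)] lipschitz_on_nonneg[OF assms(2)] by simp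
  fix x y assume xy: "x \<in> S" "y \<in> S"
  have 1: "\<bar>v x - v y\<bar> \<le> M * dist x y" "\<bar>u x - u y\<bar> \<le> L * dist x y"
    using lipschitz_onD[OF assms(2) xy] lipschitz_onD[OF assms(1) xy] by (auto simp: dist_real_def)
  have "u x * v x - u y * v y = u x * (v x - v y) + v y * (u x - u y)" by (simp add: algebra_simps)
  then have "\<bar>u x * v x - u y * v y\<bar> \<le> \<bar>u x\<bar> * \<bar>v x - v y\<bar> + \<bar>v y\<bar> * \<bar>u x - u y\<bar>"
    using abs_triangle_ineq by (simp flip: abs_mult)
  also have "\<dots> \<le> A * (M * dist x y) + B * (L * dist x y)"
    using 1 assms xy by (intro add_mono mult_mono) auto
  finally show "dist (u x * v x) (u y * v y) \<le> (A * M + B * L) * dist x y"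
    by (simp add: dist_real_def algebra_simps)
qed

locale piecewise_lipschitz =
  fixes \<T> :: "(real^3) set set" and \<Omega> :: "(real^3) set" and u :: "real^3 \<Rightarrow> real"
  assumes fin: "finite \<T>" and cpt: "\<And>T. T \<in> \<T> \<Longrightarrow> compact T" and cvx: "\<And>T. T \<in> \<T> \<Longrightarrow> convex T"
    and op: "open \<Omega>" and bdd: "bounded \<Omega>" and cover: "\<Omega> \<subseteq> \<Union>\<T>"
    and lip: "\<And>T. T \<in> \<T> \<Longrightarrow> \<exists>L. L-lipschitz_on T u"
begin

abbreviation "inner_part \<equiv> (\<Union>T\<in>\<T>. interior T)"

lemma closed_union: "closed (\<Union>\<T>)" using fin cpt compact_imp_closed by blast

lemma continuous_u: "continuous_on (\<Union>\<T>) u"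
proof -
  have "continuous_on (\<Union>T\<in>\<T>. T) u"
    using fin cpt lip lipschitz_on_continuous_on compact_imp_closed
    by (intro continuous_on_closed_Union) blast+
  then show ?thesis by simp
qed

lemma u_bounded: "\<exists>C\<ge>0. \<forall>x\<in>\<Union>\<T>. \<bar>u x\<bar> \<le> C"
proof -
  have "compact (u ` \<Union>\<T>)" using fin cpt continuous_u by (intro compact_continuous_image) auto
  then obtain C where "\<forall>x\<in>\<Union>\<T>. norm (u x) \<le> C" using compact_imp_bounded bounded_iff by (metis imageI)
  then show ?thesis by (intro exI[of _ "\<bar>C\<bar>"]) force
qed

text \<open>Extension by zero of the restriction to the closed union of the cells, which is Borel measurable on the whole
space.\<close>

definition u0 :: "real^3 \<Rightarrow> real" where "u0 x = indicator (\<Union>\<T>) x *\<^sub>R u x"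

lemma u0_measurable [measurable]: "u0 \<in> borel_measurable borel"
  unfolding u0_def using closed_union continuous_u
  by (intro borel_measurable_continuous_on_indicator) auto

lemma bounded_borel_L2:
  assumes [measurable]: "f \<in> borel_measurable borel" and f: "\<And>x. \<bar>f x\<bar> \<le> C"
    and eq: "\<And>x. x \<in> \<Omega> \<Longrightarrow> g x = f x"
  shows "g \<in> L2 \<Omega>"
proof -
  have m: "f \<in> borel_measurable (lebesgue_on \<Omega>)"
    by (intro measurable_restrict_space1 measurable_completion) simp
  have gm: "g \<in> borel_measurable (lebesgue_on \<Omega>)"
    using m eq by (subst measurable_cong[of _ g f]) (auto simp: space_restrict_space)
  have "integrable (lebesgue_on \<Omega>) (\<lambda>x. (g x)\<^sup>2)"
  proof (rule finite_measure.integrable_const_bound[where B="C\<^sup>2"])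
    show "finite_measure (lebesgue_on \<Omega>)"
      by (rule finite_measure_lebesgue_on[OF lmeasurable_open[OF bdd op]])
    show "AE x in lebesgue_on \<Omega>. norm ((g x)\<^sup>2) \<le> C\<^sup>2"
      using f eq by (intro AE_I2) (auto simp: space_restrict_space abs_le_square_iff[symmetric] intro: order_trans[OF f])
    show "(\<lambda>x. (g x)\<^sup>2) \<in> borel_measurable (lebesgue_on \<Omega>)" using gm by measurable
  qed
  then show ?thesis using gm by (simp add: L2_def)
qed

lemma u_L2: "u \<in> L2 \<Omega>"
proof -
  obtain C where C: "0 \<le> C" "\<forall>x\<in>\<Union>\<T>. \<bar>u x\<bar> \<le> C" using u_bounded by blast
  show ?thesis
    by (rule bounded_borel_L2[OF u0_measurable, of C]) (use C cover in \<open>auto simp: u0_def indicator_def\<close>)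
qed


lemma common_lipschitz: "\<exists>L. \<forall>T\<in>\<T>. L-lipschitz_on T u"
proof -
  obtain L where L: "\<And>T. T \<in> \<T> \<Longrightarrow> (L T)-lipschitz_on T u" using lip by metis
  have "(\<Sum>T\<in>\<T>. L T)-lipschitz_on T u" if T: "T \<in> \<T>" for T
  proof (rule lipschitz_on_mono[OF L[OF T] order_refl])
    show "L T \<le> (\<Sum>T\<in>\<T>. L T)"
      using fin T L lipschitz_on_nonneg by (intro member_le_sum) blast+
  qed
  then show ?thesis by blast
qed

lemma lborel_integral_on_domain:
  assumes g: "g \<in> borel_measurable borel" and "\<And>x. x \<in> \<Omega> \<Longrightarrow> h x = g x" "\<And>x. x \<notin> \<Omega> \<Longrightarrow> g x = 0"
  shows "(LINT x|lebesgue_on \<Omega>. h x) = (LINT x|lborel. g x :: real)"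
proof -
  have "(LINT x|lebesgue_on \<Omega>. h x) = (LINT x|lebesgue. indicator \<Omega> x *\<^sub>R h x)"
    using op by (intro integral_restrict_space) auto
  also have "(\<lambda>x. indicator \<Omega> x *\<^sub>R h x) = g" using assms by (auto simp: indicator_def)
  also have "(LINT x|lebesgue. g x) = (LINT x|lborel. g x)" using g by (intro integral_completion) simp
  finally show ?thesis .
qed

lemma integrable_bounded_support:
  fixes f :: "real^3 \<Rightarrow> real"
  assumes f: "f \<in> borel_measurable borel" "\<And>x. \<bar>f x\<bar> \<le> C" "\<And>x. x \<notin> cball 0 R \<Longrightarrow> f x = 0"
  shows "integrable lborel f"
proof -
  have "integrable lborel (\<lambda>x. indicator (cball 0 R) x *\<^sub>R f x)"
  proof (rule integrableI_bounded_set_indicator[where B=C])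
    show "emeasure lborel (cball 0 R :: (real^3) set) < \<infinity>" by (rule emeasure_bounded_finite) simp
  qed (use f in auto)
  also have "(\<lambda>x. indicator (cball 0 R) x *\<^sub>R f x) = f" using f(3) by (auto simp: indicator_def fun_eq_iff)
  finally show ?thesis .
qed

lemma lborel_translation:
  fixes f :: "real^3 \<Rightarrow> real"
  assumes "integrable lborel f"
  shows "integrable lborel (\<lambda>x. f (x + c))" "(LINT x|lborel. f (x + c)) = (LINT x|lborel. f x)"
proof -
  have f: "f \<in> borel_measurable borel" using assms by auto
  have eq: "(\<lambda>x. f (x + c)) = (\<lambda>x. f (c + x))" by (simp add: add.commute)
  have "integrable (distr lborel borel ((+) c)) f" using assms by (simp only: lborel_distr_plus)
  then show "integrable lborel (\<lambda>x. f (x + c))"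
    unfolding eq using f by (subst (asm) integrable_distr_eq) auto
  have "(LINT x|lborel. f x) = (LINT x|distr lborel borel ((+) c). f x)" by (simp only: lborel_distr_plus)
  also have "\<dots> = (LINT x|lborel. f (c + x))" using f by (intro integral_distr) auto
  finally show "(LINT x|lborel. f (x + c)) = (LINT x|lborel. f x)" unfolding eq ..
qed

lemma null_frontiers: "(\<Union>T\<in>\<T>. frontier T) \<in> null_sets lborel"
proof (rule null_sets.finite_UN[OF fin])
  fix T assume T: "T \<in> \<T>"
  have "frontier T \<in> null_sets lebesgue"
    using negligible_convex_frontier[OF cvx[OF T]] by (simp add: negligible_iff_null_sets)
  moreover have "frontier T \<in> sets lborel" by (simp add: borel_closed)
  ultimately show "frontier T \<in> null_sets lborel" by (simp add: null_sets_completion_iff)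
qed

context
  fixes b :: "real^3" and D :: "real^3 \<Rightarrow> real"
  assumes b: "b \<in> Basis"
    and der: "\<And>T x. T \<in> \<T> \<Longrightarrow> x \<in> interior T \<Longrightarrow> \<exists>d. (u has_derivative d) (at x) \<and> d b = D x"
    and D0: "\<And>x. x \<notin> inner_part \<Longrightarrow> D x = 0"
begin

lemma u0_has_derivative:
  assumes "T \<in> \<T>" "x \<in> interior T"
  shows "\<exists>d. (u0 has_derivative d) (at x) \<and> d b = D x"
proof -
  obtain d where d: "(u has_derivative d) (at x)" "d b = D x" using der[OF assms] by blast
  have "(u0 has_derivative d) (at x)"
  proof (rule has_derivative_transform_within_open[OF d(1) open_interior assms(2)])
    show "u y = u0 y" if "y \<in> interior T" for y
    proof -
      have "y \<in> \<Union>\<T>" using that interior_subset[of T] assms(1) by blast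
      then show ?thesis by (simp add: u0_def)
    qed
  qed
  then show ?thesis using d(2) by blast
qed

lemma u0_quotients:
  assumes "x \<in> inner_part"
  shows "(\<lambda>n. (u0 (x + inverse (real (Suc n)) *\<^sub>R b) - u0 x) * real (Suc n)) \<longlonglongrightarrow> D x"
proof -
  obtain T where T: "T \<in> \<T>" "x \<in> interior T" using assms by blast
  obtain d where d: "(u0 has_derivative d) (at x)" "d b = D x" using u0_has_derivative[OF T] by blast
  show ?thesis using difference_quotients_tendsto[OF d(1), of b] unfolding d(2) .
qed

text \<open>On the open cells \<open>D\<close> is a limit of difference quotients of \<open>u0\<close>; elsewhere it is zero.\<close>

lemma D_measurable [measurable]: "D \<in> borel_measurable borel"
proof (rule borel_measurable_LIMSEQ_real)
  let ?q = "\<lambda>n x. indicator inner_part x * ((u0 (x + inverse (real (Suc n)) *\<^sub>R b) - u0 x) * real (Suc n))"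
  have [measurable]: "inner_part \<in> sets borel" by (intro borel_open open_UN) simp
  show "?q n \<in> borel_measurable borel" for n by measurable
  show "(\<lambda>n. ?q n x) \<longlonglongrightarrow> D x" for x
  proof (cases "x \<in> inner_part")
    case True
    then show ?thesis using u0_quotients[OF True] by simp
  next
    case False
    then show ?thesis using D0[OF False] by simp
  qed
qed

lemma D_bounded: "\<exists>C. \<forall>x. \<bar>D x\<bar> \<le> C"
proof -
  obtain L where L: "\<And>T. T \<in> \<T> \<Longrightarrow> L-lipschitz_on T u" using common_lipschitz by blast
  have "\<bar>D x\<bar> \<le> \<bar>L\<bar>" for x
  proof (cases "x \<in> inner_part")
    case True
    then obtain T where T: "T \<in> \<T>" "x \<in> interior T" by blast
    have "(\<lambda>n. x + inverse (real (Suc n)) *\<^sub>R b) \<longlonglongrightarrow> x + 0 *\<^sub>R b"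
      by (intro tendsto_intros LIMSEQ_inverse_real_of_nat)
    then have ev: "\<forall>\<^sub>F n in sequentially. x + inverse (real (Suc n)) *\<^sub>R b \<in> interior T"
      using T(2) topological_tendstoD[OF _ open_interior] by simp
    have sub: "interior T \<subseteq> T" by (rule interior_subset)
    have un: "T \<subseteq> \<Union>\<T>" using T(1) by blast
    have "\<forall>\<^sub>F n in sequentially. \<bar>(u0 (x + inverse (real (Suc n)) *\<^sub>R b) - u0 x) * real (Suc n)\<bar> \<le> \<bar>L\<bar>"
      using ev
    proof eventually_elim
      case (elim n)
      let ?t = "inverse (real (Suc n))"
      have xT: "x \<in> T" "x + ?t *\<^sub>R b \<in> T" using elim T(2) sub by blast+
      have "\<bar>u (x + ?t *\<^sub>R b) - u x\<bar> \<le> L * ?t"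
        using lipschitz_onD[OF L[OF T(1)] xT(2,1)] b by (simp add: dist_real_def dist_norm)
      also have "\<dots> \<le> \<bar>L\<bar> * ?t" by (intro mult_right_mono) auto
      finally have "\<bar>u (x + ?t *\<^sub>R b) - u x\<bar> * real (Suc n) \<le> (\<bar>L\<bar> * ?t) * real (Suc n)"
        by (intro mult_right_mono) auto
      also have "\<dots> = \<bar>L\<bar>" by simp
      finally have "\<bar>u (x + ?t *\<^sub>R b) - u x\<bar> * real (Suc n) \<le> \<bar>L\<bar>" .
      moreover have "u0 (x + ?t *\<^sub>R b) = u (x + ?t *\<^sub>R b)" "u0 x = u x"
        using xT un by (auto simp: u0_def indicator_def)
      ultimately show ?case by (simp only: abs_mult abs_of_nat)
    qed
    then show ?thesis using tendsto_rabs[OF u0_quotients[OF True]]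
      by (intro tendsto_upperbound[of _ "\<bar>D x\<bar>" sequentially]) auto
  next
    case False
    then show ?thesis using D0[OF False] by simp
  qed
  then show ?thesis by blast
qed

lemma D_L2: "D \<in> L2 \<Omega>"
proof -
  obtain C where "\<forall>x. \<bar>D x\<bar> \<le> C" using D_bounded by blast
  then show ?thesis by (intro bounded_borel_L2[OF D_measurable, of C]) auto
qed

text \<open>The product \<open>F = u0 * \<phi>\<close> is Lipschitz along short steps: a short segment meeting the support of \<open>\<phi>\<close>
stays in \<open>\<Omega>\<close>, where finitely many closed cells cover it and \<open>F\<close> is Lipschitz on each of them. The difference
quotients of \<open>F\<close> have integral zero and converge to \<open>D * \<phi> + u0 * partials [b] \<phi>\<close> off the boundaries of
the cells.\<close>

lemma integration_by_parts:
  assumes \<phi>: "\<phi> \<in> test_functions \<Omega>"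
  shows "(LINT x|lebesgue_on \<Omega>. u x * partials [b] \<phi> x) = - (LINT x|lebesgue_on \<Omega>. D x * \<phi> x)"
proof -
  define K where "K = closure {x. \<phi> x \<noteq> 0}"
  have K: "compact K" "K \<subseteq> \<Omega>" using \<phi> unfolding test_functions_def K_def by blast+
  have z: "\<phi> x = 0" "partials [b] \<phi> x = 0" if "x \<notin> K" for x
    using that test_zero[OF \<phi>] test_partial_zero[OF \<phi>] unfolding K_def by blast+
  have zO: "\<phi> x = 0" "partials [b] \<phi> x = 0" if "x \<notin> \<Omega>" for x using that K(2) z by blast+
  \<comment> \<open>The distance from the support to the complement of \<open>\<Omega>\<close> bounds the admissible steps.\<close>
  obtain \<delta> where \<delta>: "0 < \<delta>" "\<And>x y. x \<in> K \<Longrightarrow> y \<notin> \<Omega> \<Longrightarrow> \<delta> \<le> dist x y"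
  proof -
    have "closed (- \<Omega>)" "K \<inter> - \<Omega> = {}" using op K(2) by auto
    from separate_compact_closed[OF K(1) this] show ?thesis using that by blast
  qed
  obtain C where C: "0 \<le> C" "\<forall>x\<in>\<Union>\<T>. \<bar>u x\<bar> \<le> C" using u_bounded by blast
  have u0C: "\<bar>u0 x\<bar> \<le> C" for x using C by (auto simp: u0_def indicator_def)
  obtain CD where CD: "\<And>x. \<bar>D x\<bar> \<le> CD" using D_bounded by blast
  obtain A where A: "\<And>x. \<bar>\<phi> x\<bar> \<le> A" using test_bounded[OF \<phi>] by blast
  have A0: "0 \<le> A" using A[of 0] by linarith
  have CD0: "0 \<le> CD" using CD[of 0] by linarith
  obtain A' where A': "\<And>x. \<bar>partials [b] \<phi> x\<bar> \<le> A'" using test_bounded[OF test_partials[OF \<phi> b]] by metis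
  obtain R where R: "K \<subseteq> cball 0 R" 
  proof -
    obtain R where "\<forall>x\<in>K. norm x \<le> R" using compact_imp_bounded[OF K(1)] unfolding bounded_iff by blast
    then have "K \<subseteq> cball 0 R" by auto
    then show ?thesis by (rule that)
  qed
  have zR: "\<phi> x = 0" "partials [b] \<phi> x = 0" if "\<not> norm x \<le> R" for x
    using that R z[of x] by (auto simp: subset_iff)
  have [measurable]: "\<phi> \<in> borel_measurable borel" "partials [b] \<phi> \<in> borel_measurable borel"
    by (intro borel_measurable_continuous_onI test_continuous[OF \<phi>] test_continuous[OF test_partials[OF \<phi> b]])+
  obtain L where L: "\<And>T. T \<in> \<T> \<Longrightarrow> L-lipschitz_on T u" using common_lipschitz by blast
  obtain L' where L': "L'-lipschitz_on UNIV \<phi>" using test_lipschitz[OF \<phi>] by blast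
  define F where "F x = u0 x * \<phi> x" for x
  have Fm [measurable]: "F \<in> borel_measurable borel" unfolding F_def by measurable
  define M where "M = \<bar>C * L' + A * L\<bar>"
  have FM: "M-lipschitz_on T F" if T: "T \<in> \<T>" for T
  proof -
    have "L-lipschitz_on T u0"
      by (rule lipschitz_on_transform[OF L[OF T]]) (use T in \<open>auto simp: u0_def indicator_def\<close>)
    then have "(C * L' + A * L)-lipschitz_on T F" unfolding F_def
      by (rule lipschitz_on_mult_bounded[OF _ lipschitz_on_subset[OF L' subset_UNIV]]) (use u0C A A0 C in auto)
    then show ?thesis unfolding M_def by (rule lipschitz_on_mono) auto
  qed
  have Fz: "F x = 0" if "x \<notin> K" for x using z(1)[OF that] by (simp add: F_def)
  have short: "\<bar>F (x + t *\<^sub>R b) - F x\<bar> \<le> M * t" if t: "0 \<le> t" "t < \<delta>" for x t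
  proof (cases "x \<in> K \<or> x + t *\<^sub>R b \<in> K")
    case False
    then show ?thesis using Fz t by (simp add: M_def)
  next
    case True
    have seg: "x + s *\<^sub>R b \<in> \<Omega>" if s: "s \<in> {0..t}" for s
    proof (rule ccontr)
      assume n: "x + s *\<^sub>R b \<notin> \<Omega>"
      have "dist x (x + s *\<^sub>R b) = s" "dist (x + t *\<^sub>R b) (x + s *\<^sub>R b) = t - s"
        using s b by (auto simp: dist_norm simp flip: scaleR_left_diff_distrib)
      then show False using True \<delta>(2)[OF _ n] s t by fastforce
    qed
    have "M-lipschitz_on {0..t} (\<lambda>s. F (x + s *\<^sub>R b))"
    proof (rule lipschitz_on_closed_Union[where I=\<T> and U="\<lambda>T. {0..t} \<inter> (\<lambda>s. x + s *\<^sub>R b) -` T"])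
      fix T assume T: "T \<in> \<T>"
      show "M-lipschitz_on ({0..t} \<inter> (\<lambda>s. x + s *\<^sub>R b) -` T) (\<lambda>s. F (x + s *\<^sub>R b))"
      proof (rule lipschitz_onI)
        fix r s assume "r \<in> {0..t} \<inter> (\<lambda>s. x + s *\<^sub>R b) -` T" "s \<in> {0..t} \<inter> (\<lambda>s. x + s *\<^sub>R b) -` T"
        then have "dist (F (x + r *\<^sub>R b)) (F (x + s *\<^sub>R b)) \<le> M * dist (x + r *\<^sub>R b) (x + s *\<^sub>R b)"
          using lipschitz_onD[OF FM[OF T]] by blast
        also have "dist (x + r *\<^sub>R b) (x + s *\<^sub>R b) = dist r s"
          using b by (simp add: dist_norm flip: scaleR_left_diff_distrib)
        finally show "dist (F (x + r *\<^sub>R b)) (F (x + s *\<^sub>R b)) \<le> M * dist r s" .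
      qed (simp add: M_def)
      show "closed ({0..t} \<inter> (\<lambda>s. x + s *\<^sub>R b) -` T)"
        using compact_imp_closed[OF cpt[OF T]]
        by (intro continuous_closed_preimage) (auto intro!: continuous_intros)
    next
      show "{0..t} \<subseteq> (\<Union>T\<in>\<T>. {0..t} \<inter> (\<lambda>s. x + s *\<^sub>R b) -` T)"
        using seg cover by blast
    qed (use fin in \<open>auto simp: M_def\<close>)
    from lipschitz_onD[OF this, of t 0] t show ?thesis by (simp add: dist_real_def)
  qed
  have Fint: "integrable lborel F"
    by (rule integrable_bounded_support[of _ "C * A" R])
      (use zR u0C A A0 C in \<open>auto simp: F_def abs_mult intro!: mult_mono\<close>)
  \<comment> \<open>Steps shorter than 1 keep the difference quotients supported in the ball of radius \<open>R + 1\<close>.\<close>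
  obtain N :: nat where N: "inverse (real (Suc N)) < min \<delta> 1"
    using reals_Archimedean[of "min \<delta> 1"] \<delta>(1) by auto
  define t where "t n = inverse (real (Suc (n + N)))" for n
  have t: "0 < t n" "t n < \<delta>" "t n < 1" for n
  proof -
    have "t n \<le> inverse (real (Suc N))" unfolding t_def by (intro le_imp_inverse_le) auto
    then show "t n < \<delta>" "t n < 1" using N by auto
  qed (simp add: t_def)
  define s where "s n x = (F (x + t n *\<^sub>R b) - F x) * real (Suc (n + N))" for n x
  define DF where "DF x = D x * \<phi> x + u0 x * partials [b] \<phi> x" for x
  have s0: "(LINT x|lborel. s n x) = 0" for n
    using lborel_translation[OF Fint] Fint unfolding s_def by simp
  have DFm: "DF \<in> borel_measurable lborel" unfolding DF_def by measurable
  have sm: "s n \<in> borel_measurable lborel" for n unfolding s_def by measurable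
  have "(\<lambda>n. LINT x|lborel. s n x) \<longlonglongrightarrow> (LINT x|lborel. DF x)"
  proof (rule integral_dominated_convergence[where w="\<lambda>x. M * indicator (cball 0 (R + 1)) x"])
    show "integrable lborel (\<lambda>x. M * indicator (cball 0 (R + 1)) x :: real)"
      by (intro integrable_mult_right integrable_real_indicator emeasure_bounded_finite) auto
    show "AE x in lborel. norm (s n x) \<le> M * indicator (cball 0 (R + 1)) x" for n
    proof (rule AE_I2)
      fix x
      show "norm (s n x) \<le> M * indicator (cball 0 (R + 1)) x"
      proof (cases "x \<in> cball 0 (R + 1)")
        case True
        have "norm (s n x) = \<bar>F (x + t n *\<^sub>R b) - F x\<bar> * real (Suc (n + N))" by (simp add: s_def abs_mult)
        also have "\<dots> \<le> (M * t n) * real (Suc (n + N))"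
          using short[of "t n" x] t[of n] by (intro mult_right_mono) auto
        also have "\<dots> = M" by (simp add: t_def)
        finally show ?thesis using True by simp
      next
        case False
        then have 1: "norm x > R + 1" by simp
        have "norm x \<le> norm (x + t n *\<^sub>R b) + norm (t n *\<^sub>R b)" by (metis add_diff_cancel norm_triangle_sub norm_minus_commute norm_triangle_ineq4)
        then have "norm (x + t n *\<^sub>R b) > R" using 1 t[of n] b by simp
        then have "x + t n *\<^sub>R b \<notin> K" "x \<notin> K" using R 1 by auto
        then show ?thesis using False Fz by (simp add: s_def)
      qed
    qed
    show "AE x in lborel. (\<lambda>n. s n x) \<longlonglongrightarrow> DF x"
    proof (rule AE_I'[OF null_frontiers], rule subsetI)
      fix x assume x: "x \<in> {x \<in> space lborel. \<not> (\<lambda>n. s n x) \<longlonglongrightarrow> DF x}"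
      have n1: "x \<notin> inner_part"
      proof
        assume "x \<in> inner_part"
        then obtain T where T: "T \<in> \<T>" "x \<in> interior T" by blast
        obtain d where d: "(u0 has_derivative d) (at x)" "d b = D x" using u0_has_derivative[OF T] by blast
        have "(F has_derivative (\<lambda>h. u0 x * frechet_derivative \<phi> (at x) h + d h * \<phi> x)) (at x)"
          unfolding F_def by (intro has_derivative_mult d(1) test_has_derivative[OF \<phi>])
        from difference_quotients_tendsto[OF this, of b]
        have "(\<lambda>n. (F (x + inverse (real (Suc n)) *\<^sub>R b) - F x) * real (Suc n)) \<longlonglongrightarrow> DF x"
          by (simp add: DF_def d(2) partials_single add.commute)
        from LIMSEQ_ignore_initial_segment[OF this, of N] have "(\<lambda>n. s n x) \<longlonglongrightarrow> DF x"
          by (simp add: s_def t_def)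
        then show False using x by simp
      qed
      have "x \<in> \<Union>\<T>"
      proof (rule ccontr)
        assume "x \<notin> \<Union>\<T>"
        then have nO: "x \<notin> \<Omega>" using cover by blast
        have "s n x = 0" for n
        proof -
          have "x + t n *\<^sub>R b \<notin> K"
          proof
            assume "x + t n *\<^sub>R b \<in> K"
            then have "\<delta> \<le> dist (x + t n *\<^sub>R b) x" using \<delta>(2) nO by blast
            then show False using t[of n] b by (simp add: dist_norm)
          qed
          then show ?thesis using Fz nO K(2) by (auto simp: s_def)
        qed
        moreover have "DF x = 0" using zO[OF nO] by (simp add: DF_def)
        ultimately show False using x by simp
      qed
      then obtain T where T: "T \<in> \<T>" "x \<in> T" by blast
      then have "x \<in> frontier T" using n1 closure_subset[of T] by (auto simp: frontier_def)
      then show "x \<in> (\<Union>T\<in>\<T>. frontier T)" using T by blast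
    qed
  qed (rule DFm sm)+
  then have DF0: "(LINT x|lborel. DF x) = 0" using s0 by (simp add: LIMSEQ_const_iff)
  have i1: "integrable lborel (\<lambda>x. D x * \<phi> x)"
    by (rule integrable_bounded_support[of _ "CD * A" R])
      (use zR CD CD0 A A0 in \<open>auto simp: abs_mult intro!: mult_mono\<close>)
  have i2: "integrable lborel (\<lambda>x. u0 x * partials [b] \<phi> x)"
    by (rule integrable_bounded_support[of _ "C * A'" R])
      (use zR u0C A' C in \<open>auto simp: abs_mult intro!: mult_mono\<close>)
  have e1: "(LINT x|lebesgue_on \<Omega>. u x * partials [b] \<phi> x) = (LINT x|lborel. u0 x * partials [b] \<phi> x)"
  proof (rule lborel_integral_on_domain)
    show "(\<lambda>x. u0 x * partials [b] \<phi> x) \<in> borel_measurable borel" by measurable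
  qed (use cover zO in \<open>auto simp: u0_def indicator_def\<close>)
  have e2: "(LINT x|lebesgue_on \<Omega>. D x * \<phi> x) = (LINT x|lborel. D x * \<phi> x)"
  proof (rule lborel_integral_on_domain)
    show "(\<lambda>x. D x * \<phi> x) \<in> borel_measurable borel" by measurable
  qed (use zO in auto)
  have "(LINT x|lborel. D x * \<phi> x) + (LINT x|lborel. u0 x * partials [b] \<phi> x) = 0"
    using DF0 Bochner_Integration.integral_add[OF i1 i2] by (simp add: DF_def)
  then show ?thesis unfolding e1 e2 by linarith
qed

end

end

section \<open>Quadratic polynomials\<close>

lemma sum_fun_apply: "(\<Sum>i\<in>I. f i) x = (\<Sum>i\<in>I. f i x)"
  for f :: "'i \<Rightarrow> 'a \<Rightarrow> real"
  by (induction I rule: infinite_finite_induct) auto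

lemma prod_power_reduce:
  fixes f :: "'b \<Rightarrow> real"
  assumes "finite A" "c \<in> A" "0 < \<alpha> c"
  shows "(\<Prod>b\<in>A. f b ^ \<alpha> b) = f c * (\<Prod>b\<in>A. f b ^ (\<alpha>(c := \<alpha> c - 1)) b)"
    and "Suc (sum (\<alpha>(c := \<alpha> c - 1)) A) = sum \<alpha> A"
proof -
  have 1: "(\<Prod>b\<in>A-{c}. f b ^ (\<alpha>(c := \<alpha> c - 1)) b) = (\<Prod>b\<in>A-{c}. f b ^ \<alpha> b)"
    by (rule prod.cong) auto
  have 2: "sum (\<alpha>(c := \<alpha> c - 1)) (A-{c}) = sum \<alpha> (A-{c})" by (rule sum.cong) auto
  show "(\<Prod>b\<in>A. f b ^ \<alpha> b) = f c * (\<Prod>b\<in>A. f b ^ (\<alpha>(c := \<alpha> c - 1)) b)"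
    unfolding prod.remove[OF assms(1,2)] 1 using assms(3) by (cases "\<alpha> c") auto
  show "Suc (sum (\<alpha>(c := \<alpha> c - 1)) A) = sum \<alpha> A"
    unfolding sum.remove[OF assms(1,2)] 2 using assms(3) by auto
qed

lemma prod_power_deg_0: "finite A \<Longrightarrow> sum \<alpha> A = (0::nat) \<Longrightarrow> (\<Prod>b\<in>A. f b ^ \<alpha> b) = (1::real)"
  by (intro prod.neutral) auto

lemma prod_power_deg_1:
  assumes "finite A" "sum \<alpha> A \<le> (1::nat)"
  shows "(\<forall>f::'b\<Rightarrow>real. (\<Prod>b\<in>A. f b ^ \<alpha> b) = 1) \<or> (\<exists>c\<in>A. \<forall>f::'b\<Rightarrow>real. (\<Prod>b\<in>A. f b ^ \<alpha> b) = f c)"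
proof (cases "sum \<alpha> A = 0")
  case True
  then show ?thesis using prod_power_deg_0[OF assms(1)] by blast
next
  case False
  then obtain c where c: "c \<in> A" "0 < \<alpha> c" using assms(1) by auto
  have "sum (\<alpha>(c := \<alpha> c - 1)) A = 0" using prod_power_reduce(2)[where \<alpha>=\<alpha> and c=c, OF assms(1) c] assms(2) by linarith
  then have "(\<Prod>b\<in>A. f b ^ \<alpha> b) = f c" for f :: "'b \<Rightarrow> real"
    using prod_power_reduce(1)[where \<alpha>=\<alpha> and c=c and f=f, OF assms(1) c] prod_power_deg_0[OF assms(1)] by simp
  then show ?thesis using c by blast
qed

text \<open>The number of factors is decided by the exponents alone, so the shape is uniform in \<open>f\<close>.\<close>

lemma prod_power_deg_2:
  assumes "finite A" "sum \<alpha> A \<le> (2::nat)"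
  shows "(\<forall>f::'b\<Rightarrow>real. (\<Prod>b\<in>A. f b ^ \<alpha> b) = 1) \<or> (\<exists>c\<in>A. \<forall>f::'b\<Rightarrow>real. (\<Prod>b\<in>A. f b ^ \<alpha> b) = f c)
     \<or> (\<exists>c\<in>A. \<exists>d\<in>A. \<forall>f::'b\<Rightarrow>real. (\<Prod>b\<in>A. f b ^ \<alpha> b) = f c * f d)"
proof (cases "sum \<alpha> A = 0")
  case True
  then show ?thesis using prod_power_deg_0[OF assms(1)] by blast
next
  case False
  then obtain c where c: "c \<in> A" "0 < \<alpha> c" using assms(1) by auto
  have le: "sum (\<alpha>(c := \<alpha> c - 1)) A \<le> 1" using prod_power_reduce(2)[where \<alpha>=\<alpha> and c=c, OF assms(1) c] assms(2) by linarith
  note red = prod_power_reduce(1)[where \<alpha>=\<alpha> and c=c, OF assms(1) c]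
  show ?thesis using prod_power_deg_1[OF assms(1) le]
  proof
    assume "\<forall>f::'b\<Rightarrow>real. (\<Prod>b\<in>A. f b ^ (\<alpha>(c := \<alpha> c - 1)) b) = 1"
    then have "(\<Prod>b\<in>A. f b ^ \<alpha> b) = f c" for f :: "'b \<Rightarrow> real" using red[of f] by simp
    then show ?thesis using c by blast
  next
    assume "\<exists>d\<in>A. \<forall>f::'b\<Rightarrow>real. (\<Prod>b\<in>A. f b ^ (\<alpha>(c := \<alpha> c - 1)) b) = f d"
    then obtain d where d: "d \<in> A" "\<And>f::'b\<Rightarrow>real. (\<Prod>b\<in>A. f b ^ (\<alpha>(c := \<alpha> c - 1)) b) = f d" by blast
    have "(\<Prod>b\<in>A. f b ^ \<alpha> b) = f c * f d" for f :: "'b \<Rightarrow> real" unfolding red[of f] d(2) ..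
    then show ?thesis using c d by blast
  qed
qed

text \<open>These products span the quadratic polynomials and are convenient for computing gradients and
restrictions to faces, where affine functions are combinations of barycentric coordinates.\<close>

definition affine_products :: "(real^3 \<Rightarrow> real) set" where
  "affine_products = {\<lambda>x. (x \<bullet> a + \<alpha>) * (x \<bullet> b + \<beta>) | a \<alpha> b \<beta>. True}"

lemma affine_productsI: "f = (\<lambda>x. (x \<bullet> a + \<alpha>) * (x \<bullet> b + \<beta>)) \<Longrightarrow> f \<in> affine_products"
  unfolding affine_products_def by blast

lemma polys2_subset: "polys 2 \<subseteq> span affine_products"
  unfolding polys_def
proof (rule span_minimal, rule subsetI)
  fix p assume "p \<in> {\<lambda>x::real^3. \<Prod>b\<in>Basis. (x \<bullet> b) ^ \<alpha> b |\<alpha>. sum \<alpha> Basis \<le> 2}"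
  then obtain \<alpha> :: "real^3 \<Rightarrow> nat" where p: "p = (\<lambda>x. \<Prod>b\<in>Basis. (x \<bullet> b) ^ \<alpha> b)" and s: "sum \<alpha> Basis \<le> 2" by blast
  from prod_power_deg_2[OF finite_Basis s]
  consider (a) "\<forall>f::real^3\<Rightarrow>real. (\<Prod>b\<in>Basis. f b ^ \<alpha> b) = 1"
    | (b) c where "\<forall>f::real^3\<Rightarrow>real. (\<Prod>b\<in>Basis. f b ^ \<alpha> b) = f c"
    | (c) c d where "\<forall>f::real^3\<Rightarrow>real. (\<Prod>b\<in>Basis. f b ^ \<alpha> b) = f c * f d" by blast
  then have "p \<in> affine_products"
  proof cases
    case a
    then have "p = (\<lambda>x. 1)" unfolding p by (intro ext) (erule allE)
    then show ?thesis by (intro affine_productsI[of _ 0 1 0 1]) simp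
  next
    case b
    have "p = (\<lambda>x. x \<bullet> c)" unfolding p
    proof
      fix x :: "real^3"
      show "(\<Prod>b\<in>Basis. (x \<bullet> b) ^ \<alpha> b) = x \<bullet> c" using b[rule_format, of "\<lambda>b. x \<bullet> b"] .
    qed
    then show ?thesis by (intro affine_productsI[of _ c 0 0 1]) simp
  next
    case c
    have "p = (\<lambda>x. (x \<bullet> c) * (x \<bullet> d))" unfolding p
    proof
      fix x :: "real^3"
      show "(\<Prod>b\<in>Basis. (x \<bullet> b) ^ \<alpha> b) = (x \<bullet> c) * (x \<bullet> d)" using c[rule_format, of "\<lambda>b. x \<bullet> b"] .
    qed
    then show ?thesis by (intro affine_productsI[of _ c 0 d 0]) simp
  qed
  then show "p \<in> span affine_products" by (rule span_base)
qed simp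

lemma polys2_add: "(\<lambda>x. f x) \<in> polys 2 \<Longrightarrow> (\<lambda>x. g x) \<in> polys 2 \<Longrightarrow> (\<lambda>x. f x + g x) \<in> polys 2"
  unfolding polys_def using span_add[of f _ g] by (simp add: plus_fun_def)

lemma polys2_cmult: "f \<in> polys 2 \<Longrightarrow> (\<lambda>x. c * f x) \<in> polys 2"
  unfolding polys_def using span_scale[of f _ c] by (simp add: scaleR_fun_def)

lemma polys2_zero: "(\<lambda>x. 0) \<in> polys 2"
  unfolding polys_def zero_fun_def[symmetric] by (rule span_zero)

lemma polys2_sum: "(\<And>i. i \<in> I \<Longrightarrow> f i \<in> polys 2) \<Longrightarrow> (\<lambda>x. \<Sum>i\<in>I. f i x) \<in> polys 2"
  by (induction I rule: infinite_finite_induct) (auto intro: polys2_zero polys2_add)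

lemma monomials_polys2:
  assumes "c \<in> Basis" "d \<in> Basis"
  shows "(\<lambda>x. 1) \<in> polys 2" "(\<lambda>x. x \<bullet> c) \<in> polys 2" "(\<lambda>x. (x \<bullet> c) * (x \<bullet> d)) \<in> polys 2"
proof -
  have gen: "(\<lambda>x. \<Prod>b\<in>Basis. (x \<bullet> b) ^ \<alpha> b) \<in> polys 2" if "sum \<alpha> Basis \<le> 2" for \<alpha> :: "real^3 \<Rightarrow> nat"
    unfolding polys_def using that by (intro span_base) blast
  have pd: "(\<Prod>b\<in>Basis. (x \<bullet> b) ^ (if b = c then 1 else 0)) = x \<bullet> c" if "c \<in> Basis" for x c :: "real^3"
    using that by (simp add: if_distrib[of "\<lambda>n. _ ^ n"] cong: if_cong)
  show "(\<lambda>x. 1) \<in> polys 2" using gen[of "\<lambda>b. 0"] by simp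
  show "(\<lambda>x. x \<bullet> c) \<in> polys 2" using gen[of "\<lambda>b. if b = c then 1 else 0"] assms(1) pd by simp
  have "(\<Prod>b\<in>Basis. (x \<bullet> b) ^ ((if b = c then 1 else 0) + (if b = d then 1 else 0))) = (x \<bullet> c) * (x \<bullet> d)" for x
    unfolding power_add prod.distrib pd[OF assms(1)] pd[OF assms(2)] ..
  then show "(\<lambda>x. (x \<bullet> c) * (x \<bullet> d)) \<in> polys 2"
    using gen[of "\<lambda>b. (if b = c then 1 else 0) + (if b = d then 1 else 0)"] assms
    by (simp add: sum.distrib)
qed

lemma affine_product_polys2: "(\<lambda>x. (x \<bullet> a + \<alpha>) * (x \<bullet> b + \<beta>)) \<in> polys 2"
proof -
  have ex: "x \<bullet> a = (\<Sum>c\<in>Basis. (a \<bullet> c) * (x \<bullet> c))" for x a :: "real^3"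
    by (subst euclidean_inner) (simp add: mult.commute)
  have "(\<lambda>x. (\<Sum>c\<in>Basis. \<Sum>d\<in>Basis. ((a \<bullet> c) * (b \<bullet> d)) * ((x \<bullet> c) * (x \<bullet> d)))
      + ((\<Sum>c\<in>Basis. (\<beta> * (a \<bullet> c)) * (x \<bullet> c)) + ((\<Sum>c\<in>Basis. (\<alpha> * (b \<bullet> c)) * (x \<bullet> c)) + (\<alpha> * \<beta>) * 1))) \<in> polys 2"
    by (intro polys2_add polys2_sum polys2_cmult monomials_polys2) (auto intro: SOME_Basis)
  also have "(\<lambda>x. (\<Sum>c\<in>Basis. \<Sum>d\<in>Basis. ((a \<bullet> c) * (b \<bullet> d)) * ((x \<bullet> c) * (x \<bullet> d)))
      + ((\<Sum>c\<in>Basis. (\<beta> * (a \<bullet> c)) * (x \<bullet> c)) + ((\<Sum>c\<in>Basis. (\<alpha> * (b \<bullet> c)) * (x \<bullet> c)) + (\<alpha> * \<beta>) * 1)))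
      = (\<lambda>x. (x \<bullet> a + \<alpha>) * (x \<bullet> b + \<beta>))"
  proof
    fix x :: "real^3"
    have 1: "(\<Sum>c\<in>Basis. \<Sum>d\<in>Basis. ((a \<bullet> c) * (b \<bullet> d)) * ((x \<bullet> c) * (x \<bullet> d))) = (x \<bullet> a) * (x \<bullet> b)"
      unfolding ex[of x a] ex[of x b] sum_product by (intro sum.cong refl) (simp add: ac_simps)
    have 2: "(\<Sum>c\<in>Basis. (\<beta> * (a \<bullet> c)) * (x \<bullet> c)) = \<beta> * (x \<bullet> a)" for \<beta> and a :: "real^3"
      unfolding ex[of x a] sum_distrib_left by (simp add: ac_simps)
    show "(\<Sum>c\<in>Basis. \<Sum>d\<in>Basis. ((a \<bullet> c) * (b \<bullet> d)) * ((x \<bullet> c) * (x \<bullet> d)))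
      + ((\<Sum>c\<in>Basis. (\<beta> * (a \<bullet> c)) * (x \<bullet> c)) + ((\<Sum>c\<in>Basis. (\<alpha> * (b \<bullet> c)) * (x \<bullet> c)) + (\<alpha> * \<beta>) * 1))
      = (x \<bullet> a + \<alpha>) * (x \<bullet> b + \<beta>)"
      unfolding 1 2 by (simp add: algebra_simps)
  qed
  finally show ?thesis .
qed


section \<open>Regularity of the local functions\<close>

context tetrahedron
begin

abbreviation "bdd2 \<equiv> bdd_derivs region (interior T) 2"

lemma bdd2_cong: "(\<And>x. x \<in> region \<Longrightarrow> f x = g x) \<Longrightarrow> bdd2 f \<Longrightarrow> bdd2 g"
  by (rule bdd_derivs_cong[OF open_region interior_subset_region])

lemma bdd2_ratmono:
  assumes "set As \<subseteq> V" "\<And>p. p \<in> set Ds \<Longrightarrow> fst p \<in> V \<and> snd p \<in> V \<and> fst p \<noteq> snd p" "excess 2 As Ds"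
  shows "bdd2 (ratmono (bary T) As Ds)"
proof (rule bdd_derivs_ratmono[where I=V])
  show "GDERIV (bary T a) x :> lgrad a" if "a \<in> V" for a x by (rule GDERIV_bary[OF that])
  show "0 < bary T a x \<and> bary T a x \<le> 1" if "a \<in> V" "x \<in> interior T" for a x
    using that bary_le_1[OF interior_subset_T] by (simp add: interior_T)
  show "bary T (fst p) x + bary T (snd p) x \<noteq> 0" if "p \<in> set Ds" "x \<in> region" for p x
    using assms(2)[OF that(1)] that(2) unfolding region_def by fastforce
  show "set Ds \<subseteq> V \<times> V" using assms(2) by fastforce
qed (use assms in auto)

lemma excess_Nil: "excess k As []"
  by (simp add: excess_def)

lemma bary_affine: "x \<bullet> a + \<alpha> = (\<Sum>i\<in>V. (i \<bullet> a + \<alpha>) * bary T i x)"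
proof -
  have "(\<Sum>i\<in>V. (i \<bullet> a + \<alpha>) * bary T i x) = (\<Sum>i\<in>V. bary T i x *\<^sub>R i) \<bullet> a + \<alpha> * (\<Sum>i\<in>V. bary T i x)"
    by (simp add: inner_sum_left sum_distrib_left sum.distrib algebra_simps)
  then show ?thesis by (simp add: bary_sum bary_comb)
qed

lemma bdd2_affine_product: "f \<in> affine_products \<Longrightarrow> bdd2 f"
proof -
  assume "f \<in> affine_products"
  then obtain a \<alpha> b \<beta> where f: "f = (\<lambda>x. (x \<bullet> a + \<alpha>) * (x \<bullet> b + \<beta>))" unfolding affine_products_def by blast
  have "bdd2 (\<lambda>x. \<Sum>i\<in>V. \<Sum>j\<in>V. ((i \<bullet> a + \<alpha>) * (j \<bullet> b + \<beta>)) * ratmono (bary T) [i, j] [] x)"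
    by (intro bdd_derivs_sum bdd_derivs_cmult bdd2_ratmono) (auto simp: excess_Nil)
  moreover have "(\<lambda>x. \<Sum>i\<in>V. \<Sum>j\<in>V. ((i \<bullet> a + \<alpha>) * (j \<bullet> b + \<beta>)) * ratmono (bary T) [i, j] [] x) = f"
    unfolding f
  proof
    fix x
    show "(\<Sum>i\<in>V. \<Sum>j\<in>V. ((i \<bullet> a + \<alpha>) * (j \<bullet> b + \<beta>)) * ratmono (bary T) [i, j] [] x)
      = (x \<bullet> a + \<alpha>) * (x \<bullet> b + \<beta>)"
      unfolding bary_affine[of x] sum_product
      by (intro sum.cong refl) (simp add: ratmono_def ac_simps)
  qed
  ultimately show ?thesis by (simp only:)
qed

definition antisym :: "real^3 \<Rightarrow> real^3 \<Rightarrow> real^3 \<Rightarrow> real" where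
  "antisym i j x = (bary T i x)\<^sup>2 * bary T j x - (bary T j x)\<^sup>2 * bary T i x"

lemma bdd2_antisym:
  assumes "i \<in> V" "j \<in> V" shows "bdd2 (antisym i j)"
proof -
  have "bdd2 (\<lambda>x. ratmono (bary T) [i, i, j] [] x - ratmono (bary T) [j, j, i] [] x)"
    using assms by (intro bdd_derivs_diff bdd2_ratmono) (auto simp: excess_Nil)
  then show ?thesis
    by (rule bdd2_cong[rotated]) (simp add: ratmono_def antisym_def power2_eq_square)
qed

lemma bdd2_face_bubble: assumes "i \<in> V" shows "bdd2 (face_bubble T i)"
proof -
  obtain As where As: "set As = V - {i}" "distinct As" using finite_distinct_list[of "V - {i}"] by auto
  have "bdd2 (ratmono (bary T) As [])" using As by (intro bdd2_ratmono) (auto simp: excess_Nil)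
  then show ?thesis
    by (rule bdd2_cong[rotated]) (simp add: ratmono_def face_bubble_def prod.distinct_set_conv_list As flip: As(1))
qed

lemma bdd2_edge_bubble:
  assumes "l \<in> V" "m \<in> V" "n \<in> V" "l \<noteq> m" "n \<noteq> l" "n \<noteq> m"
  shows "bdd2 (edge_bubble T l m n)"
proof -
  have "bdd2 (ratmono (bary T) [n, l, l, m, m] [(n, l), (n, m)])"
  proof (rule bdd2_ratmono)
    show "excess 2 [n, l, l, m, m] [(n, l), (n, m)]"
      unfolding excess_def by (auto split: if_splits)
  qed (use assms in auto)
  then show ?thesis
    by (rule bdd2_cong[rotated]) (simp add: ratmono_def edge_bubble_def power2_eq_square mult.assoc)
qed

context
  fixes i l m n
  assumes i: "i \<in> V" and lmn: "distinct [l, m, n]" "V - {i} = {l, m, n}"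
begin

lemma face_vertices: "i \<in> V" "l \<in> V" "m \<in> V" "n \<in> V" "l \<noteq> m" "l \<noteq> n" "m \<noteq> n" "i \<noteq> l" "i \<noteq> m" "i \<noteq> n"
  using i lmn by auto

lemma normal_lift_eq:
  "normal_lift T i q x = (1 / dcoef T i i) * (bary T i x * bary T l x * bary T m x * bary T n x * q x /
     ((bary T i x + bary T l x) * (bary T i x + bary T m x) * (bary T i x + bary T n x)))"
  using lmn(1) by (simp add: normal_lift_def Theta_def lmn(2) mult.assoc)

abbreviation "lift_den \<equiv> [(i, l), (i, m), (i, n)]"

text \<open>The lift is the sum of two rational monomials, one for each term of the factor \<open>2 * N + L\<close>.\<close>

lemma bdd2_lift_Phi_l: "bdd2 (normal_lift T i (Phi_l T l m n))"
proof -
  have "bdd2 (\<lambda>x. (1 / dcoef T i i) *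
     (2 * ratmono (bary T) [i, l, m, n, n, l, m, m, n] ([(n, l), (n, l), (n, m)] @ lift_den) x +
      ratmono (bary T) [i, l, m, n, n, l, m, m, l] ([(n, l), (n, l), (n, m)] @ lift_den) x))"
  proof (intro bdd_derivs_cmult bdd_derivs_add bdd2_ratmono)
    show "excess 2 [i, l, m, n, n, l, m, m, n] ([(n, l), (n, l), (n, m)] @ lift_den)"
      unfolding excess_def by (auto split: if_splits)
    show "excess 2 [i, l, m, n, n, l, m, m, l] ([(n, l), (n, l), (n, m)] @ lift_den)"
      unfolding excess_def by (auto split: if_splits)
  qed (use face_vertices in auto)
  then show ?thesis
    by (rule bdd2_cong[rotated])
      (simp add: normal_lift_eq ratmono_def Phi_l_def Let_def power2_eq_square add_divide_distrib[symmetric] algebra_simps)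
qed

text \<open>At \<open>N = 0\<close> the two summands of \<open>Phi_n\<close> cancel. In \<open>p = N / (N + L)\<close> and \<open>q = N / (N + M)\<close> the remaining
factor is a polynomial without constant term; each of its monomials contributes the power of \<open>N\<close> which the
lift needs against the denominator \<open>bary T i + bary T n\<close>.\<close>

lemma Phi_n_expand:
  assumes "N + L \<noteq> (0::real)" "N + M \<noteq> 0"
  shows "L\<^sup>2 * M\<^sup>2 * (L * M - N\<^sup>2) / ((N + L)\<^sup>2 * (N + M)\<^sup>2) - L * M =
    L * M * (- 2 * (N / (N + L)) - 2 * (N / (N + M)) + (N / (N + L))\<^sup>2 + (N / (N + M))\<^sup>2
      + 3 * (N / (N + L)) * (N / (N + M)) - (N / (N + L))\<^sup>2 * (N / (N + M)) - (N / (N + L)) * (N / (N + M))\<^sup>2)"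
proof -
  \<comment> \<open>Here \<open>L / (N + L) = 1 - p\<close> and \<open>M / (N + M) = 1 - q\<close>.\<close>
  define p q where "p = N / (N + L)" and "q = N / (N + M)"
  have L: "L / (N + L) = 1 - p" and M: "M / (N + M) = 1 - q"
    using assms by (auto simp: p_def q_def field_simps)
  have "L\<^sup>2 * M\<^sup>2 * (L * M - N\<^sup>2) / ((N + L)\<^sup>2 * (N + M)\<^sup>2) =
    L * M * ((L / (N + L)) * (M / (N + M)) * ((L / (N + L)) * (M / (N + M)) - p * q))"
    unfolding p_def q_def by (simp add: power2_eq_square diff_divide_distrib algebra_simps)
  then show ?thesis unfolding L M p_def[symmetric] q_def[symmetric]
    by (simp add: power2_eq_square algebra_simps)
qed

lemma bdd2_lift_Phi_n: "bdd2 (normal_lift T i (Phi_n T l m n))"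
proof -
  let ?r = "\<lambda>As Ds. ratmono (bary T) ([i, l, m, n, l, m] @ As) (Ds @ lift_den)"
  have ex: "excess 2 ([i, l, m, n, l, m] @ [n]) ([(n, l)] @ lift_den)"
    "excess 2 ([i, l, m, n, l, m] @ [n]) ([(n, m)] @ lift_den)"
    "excess 2 ([i, l, m, n, l, m] @ [n, n]) ([(n, l), (n, l)] @ lift_den)"
    "excess 2 ([i, l, m, n, l, m] @ [n, n]) ([(n, m), (n, m)] @ lift_den)"
    "excess 2 ([i, l, m, n, l, m] @ [n, n]) ([(n, l), (n, m)] @ lift_den)"
    "excess 2 ([i, l, m, n, l, m] @ [n, n, n]) ([(n, l), (n, l), (n, m)] @ lift_den)"
    "excess 2 ([i, l, m, n, l, m] @ [n, n, n]) ([(n, l), (n, m), (n, m)] @ lift_den)"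
    unfolding excess_def by (auto split: if_splits)
  have "bdd2 (\<lambda>x. (1 / dcoef T i i) *
     ((- 2) * ?r [n] [(n, l)] x + ((- 2) * ?r [n] [(n, m)] x + (?r [n, n] [(n, l), (n, l)] x +
      (?r [n, n] [(n, m), (n, m)] x + (3 * ?r [n, n] [(n, l), (n, m)] x +
      ((- 1) * ?r [n, n, n] [(n, l), (n, l), (n, m)] x + (- 1) * ?r [n, n, n] [(n, l), (n, m), (n, m)] x)))))))"
    using face_vertices by (intro bdd_derivs_cmult bdd_derivs_add bdd2_ratmono ex) auto
  then show ?thesis
  proof (rule bdd2_cong[rotated])
    fix x assume "x \<in> region"
    then have nz: "bary T n x + bary T l x \<noteq> 0" "bary T n x + bary T m x \<noteq> 0"
      using face_vertices unfolding region_def by fastforce+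
    show "(1 / dcoef T i i) *
     ((- 2) * ?r [n] [(n, l)] x + ((- 2) * ?r [n] [(n, m)] x + (?r [n, n] [(n, l), (n, l)] x +
      (?r [n, n] [(n, m), (n, m)] x + (3 * ?r [n, n] [(n, l), (n, m)] x +
      ((- 1) * ?r [n, n, n] [(n, l), (n, l), (n, m)] x + (- 1) * ?r [n, n, n] [(n, l), (n, m), (n, m)] x))))))
     = normal_lift T i (Phi_n T l m n) x"
      unfolding normal_lift_eq Phi_n_def Let_def Phi_n_expand[OF nz] ratmono_def
      by (simp add: power2_eq_square add_divide_distrib diff_divide_distrib algebra_simps)
  qed
qed

end

lemma Phi_m_swap: "Phi_m T l m n = Phi_l T m l n"
  by (auto simp: Phi_l_def Phi_m_def Let_def ac_simps)

lemma bdd2_normal_lift: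
  assumes i: "i \<in> V" and q: "q \<in> Q_edge T i"
  shows "bdd2 (normal_lift T i q)"
  using q unfolding Q_edge_def
proof (induction rule: span_induct_alt)
  case base
  have "bdd2 (\<lambda>x. 0)" by (rule bdd_derivs_zero)
  then show ?case by (rule bdd2_cong[rotated]) (simp add: normal_lift_def)
next
  case (step c p q)
  then obtain l m n where lmn: "distinct [l, m, n]" "V - {i} = {l, m, n}"
    and p: "p \<in> {Phi_l T l m n, Phi_m T l m n, Phi_n T l m n}" by blast
  have mln: "distinct [m, l, n]" "V - {i} = {m, l, n}" using lmn by auto
  have "bdd2 (normal_lift T i p)"
    using p bdd2_lift_Phi_l[OF i lmn] bdd2_lift_Phi_l[OF i mln] bdd2_lift_Phi_n[OF i lmn]
    unfolding Phi_m_swap by blast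
  then have "bdd2 (\<lambda>x. c * normal_lift T i p x + normal_lift T i q x)"
    by (intro bdd_derivs_add bdd_derivs_cmult step.IH)
  then show ?case
    by (rule bdd2_cong[rotated]) (simp add: normal_lift_def add_divide_distrib algebra_simps)
qed

end

section \<open>Normal derivatives on the faces\<close>

lemma GDERIV_sum:
  assumes "\<And>i. i \<in> I \<Longrightarrow> GDERIV (f i) x :> D i"
  shows "GDERIV (\<lambda>x. \<Sum>i\<in>I. f i x) x :> (\<Sum>i\<in>I. D i)"
  using assms unfolding gderiv_def inner_sum_right by (intro has_derivative_sum)

lemma GDERIV_cmult: "GDERIV f x :> D \<Longrightarrow> GDERIV (\<lambda>x. c * f x) x :> c *\<^sub>R D"
  using GDERIV_mult[OF GDERIV_const[of c]] by fastforce

lemma GDERIV_differentiable: "GDERIV f x :> D \<Longrightarrow> f differentiable (at x)"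
  by (auto simp: gderiv_def differentiable_def)

lemma differentiable_imp_GDERIV:
  fixes f :: "'a::euclidean_space \<Rightarrow> real"
  assumes "f differentiable (at x)" shows "\<exists>D. GDERIV f x :> D"
proof -
  obtain f' where f': "(f has_derivative f') (at x)" using assms by (auto simp: differentiable_def)
  then have lin: "linear f'" by (rule has_derivative_linear)
  have "f' = (\<lambda>h. h \<bullet> (\<Sum>b\<in>Basis. f' b *\<^sub>R b))"
  proof
    fix h
    have "f' h = f' (\<Sum>b\<in>Basis. (h \<bullet> b) *\<^sub>R b)" by (simp only: euclidean_representation)
    also have "\<dots> = (\<Sum>b\<in>Basis. (h \<bullet> b) * f' b)"
      by (simp only: linear_sum[OF lin] linear_cmul[OF lin] real_scaleR_def)
    finally show "f' h = h \<bullet> (\<Sum>b\<in>Basis. f' b *\<^sub>R b)" by (simp add: inner_sum_right mult.commute)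
  qed
  then show ?thesis using f' unfolding gderiv_def by metis
qed

lemma eq_at_left_end:
  fixes f g :: "real \<Rightarrow> real"
  assumes "continuous_on {0..1} f" "continuous_on {0..1} g" "\<And>s. 0 < s \<Longrightarrow> s \<le> 1 \<Longrightarrow> f s = g s"
  shows "f 0 = g 0"
proof -
  have "f 0 - g 0 = 0"
  proof (rule continuous_constant_on_closure[where S="{0<..1::real}" and f="\<lambda>s. f s - g s"])
    show "continuous_on (closure {0<..1}) (\<lambda>s. f s - g s)"
      using assms by (auto intro: continuous_on_diff)
  qed (use assms in auto)
  then show ?thesis by simp
qed

context tetrahedron
begin

lemmas region_facts = convex_T closed_T interior_T_nonempty open_region interior_subset_region

lemma relint_T_region: "i \<in> V \<Longrightarrow> x \<in> rel_interior (opp_face T i) \<Longrightarrow> x \<in> T \<and> x \<in> region"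
  using rel_interior_opp_face_subset by blast

lemma bgrad_eqI: "bdd2 f \<Longrightarrow> x \<in> T \<Longrightarrow> x \<in> region \<Longrightarrow> GDERIV f x :> D \<Longrightarrow> bgrad T f x = D"
  using GDERIV_bgrad[OF region_facts] GDERIV_unique by metis

lemma bary_affine_form: "a \<in> V \<Longrightarrow> bary T a = (\<lambda>x. x \<bullet> lgrad a + bary T a 0)"
proof
  fix x assume "a \<in> V"
  from bary_eq[OF this, of x] show "bary T a x = x \<bullet> lgrad a + bary T a 0" by simp
qed

lemma bary_prod_polys2: "a \<in> V \<Longrightarrow> b \<in> V \<Longrightarrow> (\<lambda>x. bary T a x * bary T b x) \<in> polys 2"
  by (subst (1) bary_affine_form, assumption, subst (1) bary_affine_form[of b], assumption)
    (rule affine_product_polys2)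

text \<open>The decomposition demanded in \<open>q_part\<close>. The functions with this property form a subspace; that it contains
the edge-enriched space makes the choice in \<open>q_part\<close> meaningful.\<close>

definition normal_splits :: "real^3 \<Rightarrow> (real^3 \<Rightarrow> real) \<Rightarrow> bool" where
  "normal_splits i f \<longleftrightarrow> bdd2 f \<and> (\<exists>p\<in>polys 2. \<exists>q\<in>Q_edge T i. \<forall>x\<in>rel_interior (opp_face T i).
     bgrad T f x \<bullet> outer_normal T i = p x + q x)"

lemma normal_splitsI:
  assumes "i \<in> V" "bdd2 f" "p \<in> polys 2" "q \<in> Q_edge T i"
    and "\<And>x. x \<in> rel_interior (opp_face T i) \<Longrightarrow> \<exists>D. GDERIV f x :> D \<and> D \<bullet> outer_normal T i = p x + q x"
  shows "normal_splits i f"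
proof -
  have "bgrad T f x \<bullet> outer_normal T i = p x + q x" if x: "x \<in> rel_interior (opp_face T i)" for x
  proof -
    obtain D where D: "GDERIV f x :> D" "D \<bullet> outer_normal T i = p x + q x" using assms(5)[OF x] by blast
    have "bgrad T f x = D" using bgrad_eqI[OF assms(2) _ _ D(1)] relint_T_region[OF assms(1) x] by blast
    then show ?thesis using D(2) by simp
  qed
  then show ?thesis using assms unfolding normal_splits_def by blast
qed

lemma ex_GDERIV_normal: "GDERIV f x :> D \<Longrightarrow> D \<bullet> \<nu> = r \<Longrightarrow> \<exists>D. GDERIV f x :> D \<and> D \<bullet> \<nu> = r"
  by blast

lemma Q_edge_zero: "(\<lambda>x. 0) \<in> Q_edge T i"
  unfolding Q_edge_def zero_fun_def[symmetric] by (rule span_zero)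

lemma Q_edge_add: "p \<in> Q_edge T i \<Longrightarrow> q \<in> Q_edge T i \<Longrightarrow> (\<lambda>x. p x + q x) \<in> Q_edge T i"
  unfolding Q_edge_def using span_add[of p _ q] by (simp add: plus_fun_def)

lemma Q_edge_cmult: "q \<in> Q_edge T i \<Longrightarrow> (\<lambda>x. c * q x) \<in> Q_edge T i"
  unfolding Q_edge_def using span_scale[of q _ c] by (simp add: scaleR_fun_def)

lemma normal_splits_lincomb:
  assumes i: "i \<in> V" and f: "normal_splits i f" and g: "normal_splits i g"
  shows "normal_splits i (\<lambda>x. c * f x + g x)"
proof -
  obtain p q where pq: "bdd2 f" "p \<in> polys 2" "q \<in> Q_edge T i"
    "\<And>x. x \<in> rel_interior (opp_face T i) \<Longrightarrow> bgrad T f x \<bullet> outer_normal T i = p x + q x"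
    using f unfolding normal_splits_def by blast
  obtain p' q' where pq': "bdd2 g" "p' \<in> polys 2" "q' \<in> Q_edge T i"
    "\<And>x. x \<in> rel_interior (opp_face T i) \<Longrightarrow> bgrad T g x \<bullet> outer_normal T i = p' x + q' x"
    using g unfolding normal_splits_def by blast
  show ?thesis
  proof (rule normal_splitsI[OF i])
    show "bdd2 (\<lambda>x. c * f x + g x)" using pq(1) pq'(1) by (intro bdd_derivs_add bdd_derivs_cmult)
    show "(\<lambda>x. c * p x + p' x) \<in> polys 2" using pq(2) pq'(2) by (intro polys2_add polys2_cmult)
    show "(\<lambda>x. c * q x + q' x) \<in> Q_edge T i" using pq(3) pq'(3) by (intro Q_edge_add Q_edge_cmult)
    fix x assume x: "x \<in> rel_interior (opp_face T i)"
    have "GDERIV (\<lambda>x. c * f x + g x) x :> c *\<^sub>R bgrad T f x + bgrad T g x"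
      using relint_T_region[OF i x] GDERIV_bgrad[OF region_facts] pq(1) pq'(1)
      by (intro GDERIV_add GDERIV_cmult) auto
    moreover have "(c *\<^sub>R bgrad T f x + bgrad T g x) \<bullet> outer_normal T i = c * p x + p' x + (c * q x + q' x)"
      using pq(4)[OF x] pq'(4)[OF x] by (simp add: inner_add_left algebra_simps)
    ultimately show "\<exists>D. GDERIV (\<lambda>x. c * f x + g x) x :> D \<and>
        D \<bullet> outer_normal T i = c * p x + p' x + (c * q x + q' x)" by blast
  qed
qed

lemma normal_splits_zero: "i \<in> V \<Longrightarrow> normal_splits i (\<lambda>x. 0)"
  by (rule normal_splitsI[of i _ "\<lambda>x. 0" "\<lambda>x. 0"])
    (auto intro: bdd_derivs_zero polys2_zero Q_edge_zero intro!: exI[of _ 0] GDERIV_const)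

lemma normal_splits_span:
  assumes i: "i \<in> V" and "f \<in> span S" "\<And>g. g \<in> S \<Longrightarrow> normal_splits i g"
  shows "normal_splits i f"
  using assms(2)
proof (induction rule: span_induct_alt)
  case base
  then show ?case using normal_splits_zero[OF i] by (simp add: zero_fun_def)
next
  case (step c x y)
  then show ?case using normal_splits_lincomb[OF i assms(3)[OF step.hyps] step.IH, of c]
    by (simp add: plus_fun_def scaleR_fun_def)
qed

lemma normal_splits_affine_product:
  assumes i: "i \<in> V" and f: "f \<in> affine_products" shows "normal_splits i f"
proof -
  obtain a \<alpha> b \<beta> where f': "f = (\<lambda>x. (x \<bullet> a + \<alpha>) * (x \<bullet> b + \<beta>))" using f unfolding affine_products_def by blast
  let ?\<nu> = "outer_normal T i"
  show ?thesis
  proof (rule normal_splitsI[OF i bdd2_affine_product[OF f] _ Q_edge_zero])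
    show "(\<lambda>x. (b \<bullet> ?\<nu>) * ((x \<bullet> a + \<alpha>) * (x \<bullet> 0 + 1)) + (a \<bullet> ?\<nu>) * ((x \<bullet> b + \<beta>) * (x \<bullet> 0 + 1))) \<in> polys 2"
      by (intro polys2_add polys2_cmult affine_product_polys2)
    fix x :: "real^3"
    have "GDERIV (\<lambda>x. x \<bullet> a + \<alpha>) x :> a" for a :: "real^3" and \<alpha>
      unfolding gderiv_def by (auto intro!: derivative_eq_intros)
    from GDERIV_mult[OF this this] have "GDERIV f x :> (x \<bullet> a + \<alpha>) *\<^sub>R b + (x \<bullet> b + \<beta>) *\<^sub>R a"
      unfolding f' .
    then show "\<exists>D. GDERIV f x :> D \<and> D \<bullet> ?\<nu> =
       (b \<bullet> ?\<nu>) * ((x \<bullet> a + \<alpha>) * (x \<bullet> 0 + 1)) + (a \<bullet> ?\<nu>) * ((x \<bullet> b + \<beta>) * (x \<bullet> 0 + 1)) + 0"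
      by (intro exI conjI, assumption) (simp add: inner_add_left mult.commute)
  qed
qed

lemma normal_splits_antisym:
  assumes i: "i \<in> V" and ab: "a \<in> V" "b \<in> V"
  shows "normal_splits i (antisym a b)"
proof (rule normal_splitsI[OF i bdd2_antisym[OF ab] _ Q_edge_zero])
  let ?c = "lgrad a \<bullet> outer_normal T i" and ?d = "lgrad b \<bullet> outer_normal T i"
  show "(\<lambda>x. (2 * ?c - 2 * ?d) * (bary T a x * bary T b x) +
     ((- ?c) * (bary T b x * bary T b x) + ?d * (bary T a x * bary T a x))) \<in> polys 2"
    by (intro polys2_add polys2_cmult bary_prod_polys2 ab)
  fix x :: "real^3"
  have "GDERIV (antisym a b) x :> (2 * bary T a x * bary T b x - (bary T b x)\<^sup>2) *\<^sub>R lgrad a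
     + ((bary T a x)\<^sup>2 - 2 * bary T a x * bary T b x) *\<^sub>R lgrad b"
    unfolding gderiv_def antisym_def
    by (rule derivative_eq_intros ext GDERIV_bary[OF ab(1), unfolded gderiv_def] GDERIV_bary[OF ab(2), unfolded gderiv_def] | simp)+
      (simp add: inner_add_right algebra_simps power2_eq_square)
  then show "\<exists>D. GDERIV (antisym a b) x :> D \<and> D \<bullet> outer_normal T i =
     (2 * ?c - 2 * ?d) * (bary T a x * bary T b x) +
     ((- ?c) * (bary T b x * bary T b x) + ?d * (bary T a x * bary T a x)) + 0"
    by (intro exI conjI, assumption) (simp add: inner_add_left power2_eq_square algebra_simps)
qed

text \<open>The face functions are the partial derivatives of the edge bubble with respect to the barycentric
coordinates, up to the quadratic term in the last one.\<close>

lemma GDERIV_edge_bubble: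
  assumes lmn: "l \<in> V" "m \<in> V" "n \<in> V" "n \<noteq> l" "n \<noteq> m" and x: "x \<in> region"
  shows "GDERIV (edge_bubble T l m n) x :> Phi_l T l m n x *\<^sub>R lgrad l + Phi_m T l m n x *\<^sub>R lgrad m
    + (Phi_n T l m n x + bary T l x * bary T m x) *\<^sub>R lgrad n"
proof -
  have nz: "bary T n x + bary T l x \<noteq> 0" "bary T n x + bary T m x \<noteq> 0"
    using lmn x unfolding region_def by fastforce+
  define L M N P Q where "L = bary T l x" and "M = bary T m x" and "N = bary T n x" and "P = N + L" and "Q = N + M"
  have PQ: "P \<noteq> 0" "Q \<noteq> 0" using nz by (simp_all add: P_def Q_def L_def M_def N_def)
  define A where "A a h = h \<bullet> lgrad a" for a h
  have d: "(bary T a has_derivative A a) (at x)" if "a \<in> V" for a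
    using GDERIV_bary[OF that] unfolding gderiv_def A_def .
  note ds = d[OF lmn(1)] d[OF lmn(2)] d[OF lmn(3)]
  have num: "((\<lambda>x. bary T n x * (bary T l x)\<^sup>2 * (bary T m x)\<^sup>2) has_derivative
     (\<lambda>h. A n h * L\<^sup>2 * M\<^sup>2 + 2 * N * L * M\<^sup>2 * A l h + 2 * N * L\<^sup>2 * M * A m h)) (at x)"
    by (rule derivative_eq_intros ds refl)+ (simp add: L_def M_def N_def algebra_simps)
  have den: "((\<lambda>x. (bary T n x + bary T l x) * (bary T n x + bary T m x)) has_derivative
     (\<lambda>h. P * (A n h + A m h) + (A n h + A l h) * Q)) (at x)"
    by (rule derivative_eq_intros ds refl)+ (simp add: L_def M_def N_def P_def Q_def)
  have eq: "((a * L\<^sup>2 * M\<^sup>2 + 2 * N * L * M\<^sup>2 * b + 2 * N * L\<^sup>2 * M * c) * (P * Q) -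
      (N * L\<^sup>2 * M\<^sup>2) * (P * (a + c) + (a + b) * Q)) / ((P * Q) * (P * Q)) =
      b * (N * L * M\<^sup>2 * (2 * N + L) / (P\<^sup>2 * Q)) + c * (N * L\<^sup>2 * M * (2 * N + M) / (P * Q\<^sup>2))
      + a * (L\<^sup>2 * M\<^sup>2 * (L * M - N\<^sup>2) / (P\<^sup>2 * Q\<^sup>2))" for a b c
  proof -
    have t1: "N * L * M\<^sup>2 * (2 * N + L) / (P\<^sup>2 * Q) = N * L * M\<^sup>2 * (2 * N + L) * Q / (P\<^sup>2 * Q\<^sup>2)"
      using PQ by (simp add: power2_eq_square)
    have t2: "N * L\<^sup>2 * M * (2 * N + M) / (P * Q\<^sup>2) = N * L\<^sup>2 * M * (2 * N + M) * P / (P\<^sup>2 * Q\<^sup>2)"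
      using PQ by (simp add: power2_eq_square)
    have "(a * L\<^sup>2 * M\<^sup>2 + 2 * N * L * M\<^sup>2 * b + 2 * N * L\<^sup>2 * M * c) * (P * Q) -
      (N * L\<^sup>2 * M\<^sup>2) * (P * (a + c) + (a + b) * Q) =
      b * (N * L * M\<^sup>2 * (2 * N + L) * Q) + c * (N * L\<^sup>2 * M * (2 * N + M) * P)
      + a * (L\<^sup>2 * M\<^sup>2 * (L * M - N\<^sup>2))"
      unfolding P_def Q_def by algebra
    then show ?thesis unfolding t1 t2 times_divide_eq_right add_divide_distrib[symmetric]
      by (simp add: power2_eq_square ac_simps)
  qed
  have PQ': "(bary T n x + bary T l x) * (bary T n x + bary T m x) \<noteq> 0" using nz by simp
  have "(edge_bubble T l m n has_derivative (\<lambda>h. A l h * (N * L * M\<^sup>2 * (2 * N + L) / (P\<^sup>2 * Q))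
      + A m h * (N * L\<^sup>2 * M * (2 * N + M) / (P * Q\<^sup>2)) + A n h * (L\<^sup>2 * M\<^sup>2 * (L * M - N\<^sup>2) / (P\<^sup>2 * Q\<^sup>2)))) (at x)"
    using has_derivative_divide'[OF num den PQ'] unfolding edge_bubble_def eq[symmetric]
    by (simp add: L_def M_def N_def P_def Q_def)
  moreover have "Phi_n T l m n x + bary T l x * bary T m x = L\<^sup>2 * M\<^sup>2 * (L * M - N\<^sup>2) / (P\<^sup>2 * Q\<^sup>2)"
    "Phi_l T l m n x = N * L * M\<^sup>2 * (2 * N + L) / (P\<^sup>2 * Q)"
    "Phi_m T l m n x = N * L\<^sup>2 * M * (2 * N + M) / (P * Q\<^sup>2)"
    unfolding Phi_l_def Phi_m_def Phi_n_def Let_def L_def M_def N_def P_def Q_def by simp_all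
  ultimately show ?thesis unfolding gderiv_def A_def by (simp add: inner_add_right mult.commute)
qed

lemma Phi_in_Q_edge:
  assumes "distinct [l, m, n]" "V - {i} = {l, m, n}"
  shows "Phi_l T l m n \<in> Q_edge T i" "Phi_m T l m n \<in> Q_edge T i" "Phi_n T l m n \<in> Q_edge T i"
  unfolding Q_edge_def using assms by (intro span_base; blast)+

lemma V_four: "distinct [i, l, m, n] \<Longrightarrow> i \<in> V \<Longrightarrow> l \<in> V \<Longrightarrow> m \<in> V \<Longrightarrow> n \<in> V \<Longrightarrow> V = {i, l, m, n}"
  using card_seteq[OF finite_V, of "{i, l, m, n}"] card_V by auto

text \<open>On the face through \<open>l\<close>, \<open>m\<close> and \<open>n\<close> the gradient is a combination of the three functions of \<open>Q_edge\<close> and a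
quadratic term. On the face opposite to \<open>n\<close> only the quadratic term survives, and on the faces opposite to
\<open>l\<close> or \<open>m\<close> the bubble vanishes to second order.\<close>

lemma normal_splits_edge_bubble:
  assumes i: "i \<in> V" and lmn: "l \<in> V" "m \<in> V" "n \<in> V" "l \<noteq> m" "n \<noteq> l" "n \<noteq> m"
  shows "normal_splits i (edge_bubble T l m n)"
proof -
  let ?d = "\<lambda>a. lgrad a \<bullet> outer_normal T i"
  note bdd2 = bdd2_edge_bubble[OF lmn]
  note D = GDERIV_edge_bubble[OF lmn(1,2,3,5,6)]
  have reg: "x \<in> region" if "x \<in> rel_interior (opp_face T i)" for x using relint_T_region[OF i that] by blast
  have zi: "bary T i x = 0" and pos: "\<And>j. j \<in> V \<Longrightarrow> j \<noteq> i \<Longrightarrow> 0 < bary T j x"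
    if "x \<in> rel_interior (opp_face T i)" for x
    using that unfolding rel_interior_opp_face[OF i] by auto
  consider (n) "i = n" | (lm) "i = l \<or> i = m" | (other) "i \<noteq> l" "i \<noteq> m" "i \<noteq> n" by blast
  then show ?thesis
  proof cases
    case n
    show ?thesis
    proof (rule normal_splitsI[OF i bdd2 _ Q_edge_zero])
      show "(\<lambda>x. ?d n * (bary T l x * bary T m x)) \<in> polys 2"
        by (intro polys2_cmult bary_prod_polys2 lmn)
      fix x assume x: "x \<in> rel_interior (opp_face T i)"
      have 0: "bary T n x = 0" "bary T l x \<noteq> 0" "bary T m x \<noteq> 0"
        using zi[OF x] pos[OF x, of l] pos[OF x, of m] n lmn by auto
      have "Phi_l T l m n x = 0" "Phi_m T l m n x = 0" "Phi_n T l m n x = 0"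
        using 0 by (simp_all add: Phi_l_def Phi_m_def Phi_n_def Let_def)
      then show "\<exists>D. GDERIV (edge_bubble T l m n) x :> D \<and>
          D \<bullet> outer_normal T i = ?d n * (bary T l x * bary T m x) + 0"
        by (intro ex_GDERIV_normal[OF D[OF reg[OF x]]]) simp
    qed
  next
    case lm
    show ?thesis
    proof (rule normal_splitsI[OF i bdd2 polys2_zero Q_edge_zero])
      fix x assume x: "x \<in> rel_interior (opp_face T i)"
      have "bary T l x = 0 \<or> bary T m x = 0" using zi[OF x] lm by auto
      then have "Phi_l T l m n x = 0" "Phi_m T l m n x = 0" "Phi_n T l m n x + bary T l x * bary T m x = 0"
        by (auto simp: Phi_l_def Phi_m_def Phi_n_def Let_def)
      then show "\<exists>D. GDERIV (edge_bubble T l m n) x :> D \<and> D \<bullet> outer_normal T i = 0 + 0"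
        by (intro ex_GDERIV_normal[OF D[OF reg[OF x]]]) simp
    qed
  next
    case other
    have V: "V - {i} = {l, m, n}" using V_four[of i l m n] other lmn i by auto
    have dis: "distinct [l, m, n]" using lmn by auto
    show ?thesis
    proof (rule normal_splitsI[OF i bdd2])
      show "(\<lambda>x. ?d n * (bary T l x * bary T m x)) \<in> polys 2"
        by (intro polys2_cmult bary_prod_polys2 lmn)
      show "(\<lambda>x. ?d l * Phi_l T l m n x + (?d m * Phi_m T l m n x + ?d n * Phi_n T l m n x)) \<in> Q_edge T i"
        by (intro Q_edge_add Q_edge_cmult Phi_in_Q_edge[OF dis V])
      fix x assume x: "x \<in> rel_interior (opp_face T i)"
      show "\<exists>D. GDERIV (edge_bubble T l m n) x :> D \<and> D \<bullet> outer_normal T i = ?d n * (bary T l x * bary T m x) +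
          (?d l * Phi_l T l m n x + (?d m * Phi_m T l m n x + ?d n * Phi_n T l m n x))"
        by (intro ex_GDERIV_normal[OF D[OF reg[OF x]]]) (simp add: inner_add_left algebra_simps)
    qed
  qed
qed

lemma Z3_e_E:
  assumes "z \<in> Z3_e T"
  obtains p s e where "p \<in> polys 2" "s \<in> span {antisym i j | i j. i \<in> V \<and> j \<in> V \<and> i \<noteq> j}"
    "e \<in> span {edge_bubble T l m n | l m n. l \<in> V \<and> m \<in> V \<and> l \<noteq> m \<and> n \<in> V - {l, m}}"
    "z = (\<lambda>x. p x + s x + e x)"
proof -
  have *: "{(\<lambda>x. (bary T i x)\<^sup>2 * bary T j x - (bary T j x)\<^sup>2 * bary T i x) | i j. i \<in> V \<and> j \<in> V \<and> i \<noteq> j}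
     = {antisym i j | i j. i \<in> V \<and> j \<in> V \<and> i \<noteq> j}" unfolding antisym_def ..
  obtain z0 e where z: "z = z0 + e" "z0 \<in> Z3_0 T"
    "e \<in> span {edge_bubble T l m n | l m n. l \<in> V \<and> m \<in> V \<and> l \<noteq> m \<and> n \<in> V - {l, m}}"
    using assms unfolding Z3_e_def by blast
  then obtain p s where "z0 = p + s" "p \<in> polys 2" "s \<in> span {antisym i j | i j. i \<in> V \<and> j \<in> V \<and> i \<noteq> j}"
    unfolding Z3_0_def * by blast
  then show ?thesis using that[of p s e] z by (simp add: plus_fun_def)
qed

lemma normal_splits_Z3_e: assumes i: "i \<in> V" and z: "z \<in> Z3_e T" shows "normal_splits i z"
proof -
  obtain p s e where d: "p \<in> polys 2" "s \<in> span {antisym i j | i j. i \<in> V \<and> j \<in> V \<and> i \<noteq> j}"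
    "e \<in> span {edge_bubble T l m n | l m n. l \<in> V \<and> m \<in> V \<and> l \<noteq> m \<and> n \<in> V - {l, m}}"
    "z = (\<lambda>x. p x + s x + e x)" using Z3_e_E[OF z] .
  have p: "normal_splits i p" using normal_splits_span[OF i] normal_splits_affine_product[OF i] polys2_subset d(1) by blast
  have s: "normal_splits i s" by (rule normal_splits_span[OF i d(2)]) (auto intro: normal_splits_antisym[OF i])
  have e: "normal_splits i e" by (rule normal_splits_span[OF i d(3)]) (auto intro!: normal_splits_edge_bubble[OF i])
  show ?thesis using normal_splits_lincomb[OF i normal_splits_lincomb[OF i p s, of 1] e, of 1] unfolding d(4) by simp
qed

lemma bdd2_Z3_e: "z \<in> Z3_e T \<Longrightarrow> bdd2 z"
  using normal_splits_Z3_e other_vertex unfolding normal_splits_def by metis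

lemma q_part:
  assumes i: "i \<in> V" and z: "z \<in> Z3_e T"
  shows "q_part T i z \<in> Q_edge T i"
    and "\<exists>p\<in>polys 2. \<forall>x\<in>rel_interior (opp_face T i). bgrad T z x \<bullet> outer_normal T i = p x + q_part T i z x"
proof -
  have "\<exists>q. q \<in> Q_edge T i \<and> (\<exists>p\<in>polys 2. \<forall>x\<in>rel_interior (opp_face T i). bgrad T z x \<bullet> outer_normal T i = p x + q x)"
    using normal_splits_Z3_e[OF i z] unfolding normal_splits_def by blast
  from someI_ex[OF this] show "q_part T i z \<in> Q_edge T i"
    "\<exists>p\<in>polys 2. \<forall>x\<in>rel_interior (opp_face T i). bgrad T z x \<bullet> outer_normal T i = p x + q_part T i z x"
    unfolding q_part_def by blast+
qed

lemma face_vertices_exist: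
  assumes "i \<in> V" obtains l m n where "distinct [l, m, n]" "V - {i} = {l, m, n}"
proof -
  have "card (V - {i}) = 3" using assms card_V by simp
  then obtain l m n where "V - {i} = {l, m, n}" "l \<noteq> m" "m \<noteq> n" "l \<noteq> n" unfolding card_3_iff by blast
  then show ?thesis by (intro that[of l m n]) auto
qed

text \<open>The extensions of the elements of \<open>Q_edge\<close> vanish on the other faces. For \<open>Phi_n\<close> at \<open>bary T n x = 0\<close> this is due to
the subtracted quadratic term.\<close>

lemma Q_edge_vanishes:
  assumes q: "q \<in> Q_edge T i" and x: "x \<in> region" and j: "j \<in> V - {i}" "bary T j x = 0"
  shows "q x = 0"
  using q unfolding Q_edge_def
proof (induction rule: span_induct_alt)
  case base
  then show ?case by simp
next
  case (step c p q)
  then obtain l m n where lmn: "distinct [l, m, n]" "V - {i} = {l, m, n}"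
    and p: "p \<in> {Phi_l T l m n, Phi_m T l m n, Phi_n T l m n}" by blast
  have "l \<in> V" "m \<in> V" "n \<in> V" using lmn(2) by auto
  then have nz: "bary T n x + bary T l x \<noteq> 0" "bary T n x + bary T m x \<noteq> 0"
    using x lmn(1) unfolding region_def by fastforce+
  have "bary T l x = 0 \<or> bary T m x = 0 \<or> bary T n x = 0" using j lmn(2) by auto
  then have "p x = 0" using p nz by (auto simp: Phi_l_def Phi_m_def Phi_n_def Let_def)
  then show ?case using step.IH by simp
qed

lemma bary_differentiable: "a \<in> V \<Longrightarrow> bary T a differentiable (at x)"
  by (rule GDERIV_differentiable[OF GDERIV_bary])

lemma Q_edge_differentiable:
  assumes q: "q \<in> Q_edge T i" and x: "x \<in> region"
  shows "q differentiable (at x)"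
  using q unfolding Q_edge_def
proof (induction rule: span_induct_alt)
  case base
  then show ?case by (simp add: zero_fun_def)
next
  case (step c p q)
  then obtain l m n where lmn: "distinct [l, m, n]" "V - {i} = {l, m, n}"
    and p: "p \<in> {Phi_l T l m n, Phi_m T l m n, Phi_n T l m n}" by blast
  have V: "l \<in> V" "m \<in> V" "n \<in> V" using lmn(2) by auto
  then have nz: "bary T n x + bary T l x \<noteq> 0" "bary T n x + bary T m x \<noteq> 0"
    using x lmn(1) unfolding region_def by fastforce+
  note d = bary_differentiable[OF V(1)] bary_differentiable[OF V(2)] bary_differentiable[OF V(3)]
  have "Phi_l T l m n differentiable (at x)" "Phi_m T l m n differentiable (at x)" "Phi_n T l m n differentiable (at x)"
    unfolding Phi_l_def Phi_m_def Phi_n_def Let_def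
    using nz by (auto intro!: derivative_intros d)
  then have "p differentiable (at x)" using p by blast
  then have "(\<lambda>x. c * p x + q x) differentiable (at x)" using step.IH by (intro derivative_intros)
  then show ?case by (simp add: plus_fun_def scaleR_fun_def)
qed

lemma Theta_differentiable:
  assumes i: "i \<in> V" and x: "x \<in> region"
  shows "Theta T i differentiable (at x)"
proof -
  obtain l m n where lmn: "distinct [l, m, n]" "V - {i} = {l, m, n}" using face_vertices_exist[OF i] .
  have V: "l \<in> V" "m \<in> V" "n \<in> V" "l \<noteq> i" "m \<noteq> i" "n \<noteq> i" using lmn(2) by auto
  then have nz: "bary T i x + bary T l x \<noteq> 0" "bary T i x + bary T m x \<noteq> 0" "bary T i x + bary T n x \<noteq> 0"
    using x i unfolding region_def by fastforce+
  note d = bary_differentiable[OF V(1)] bary_differentiable[OF V(2)] bary_differentiable[OF V(3)] bary_differentiable[OF i]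
  have "Theta T i = (\<lambda>x. bary T l x / (bary T i x + bary T l x) * (bary T m x / (bary T i x + bary T m x) * (bary T n x / (bary T i x + bary T n x))))"
    unfolding Theta_def lmn(2) using lmn(1) by auto
  then show ?thesis using nz by (auto intro!: derivative_intros d)
qed

text \<open>The lift is \<open>bary T i\<close> times a differentiable function, whose value on the face is \<open>q x / dcoef T i i\<close>
because there all factors of \<open>Theta\<close> are 1.\<close>

lemma normal_lift_own_face:
  assumes i: "i \<in> V" and q: "q \<in> Q_edge T i" and x: "x \<in> rel_interior (opp_face T i)"
  shows "GDERIV (normal_lift T i q) x :> (q x / dcoef T i i) *\<^sub>R lgrad i"
proof -
  have reg: "x \<in> region" using relint_T_region[OF i x] by blast
  have z: "bary T i x = 0" and p: "\<And>j. j \<in> V - {i} \<Longrightarrow> 0 < bary T j x"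
    using x unfolding rel_interior_opp_face[OF i] by auto
  define H where "H x = Theta T i x * q x / dcoef T i i" for x
  have "H differentiable (at x)"
    unfolding H_def using Theta_differentiable[OF i reg] Q_edge_differentiable[OF q reg] dcoef_nonzero[OF i]
    by (intro derivative_intros) auto
  then obtain D where D: "GDERIV H x :> D" using differentiable_imp_GDERIV by blast
  have "Theta T i x = 1" unfolding Theta_def using z p by (intro prod.neutral) fastforce
  then have "H x = q x / dcoef T i i" by (simp add: H_def)
  moreover have "normal_lift T i q = (\<lambda>x. bary T i x * H x)" by (auto simp: normal_lift_def H_def)
  ultimately show ?thesis using GDERIV_mult[OF GDERIV_bary[OF i] D] z by simp
qed

lemma Theta_zero: "i \<in> V \<Longrightarrow> j \<in> V - {i} \<Longrightarrow> bary T j x = 0 \<Longrightarrow> Theta T i x = 0"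
  unfolding Theta_def by (intro prod_zero) auto

text \<open>Both \<open>Theta\<close> and \<open>q\<close> vanish on the face opposite to \<open>j\<close>, so the lift is a product of two differentiable
functions with a common zero.\<close>

lemma normal_lift_other_face:
  assumes i: "i \<in> V" and j: "j \<in> V" "j \<noteq> i" and q: "q \<in> Q_edge T i" and x: "x \<in> rel_interior (opp_face T j)"
  shows "GDERIV (normal_lift T i q) x :> 0"
proof -
  have reg: "x \<in> region" using relint_T_region[OF j(1) x] by blast
  have z: "bary T j x = 0" using x unfolding rel_interior_opp_face[OF j(1)] by auto
  define H where "H x = bary T i x / dcoef T i i * Theta T i x" for x
  have "H differentiable (at x)"
    unfolding H_def using Theta_differentiable[OF i reg] bary_differentiable[OF i] dcoef_nonzero[OF i]
    by (intro derivative_intros) auto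
  then obtain D where D: "GDERIV H x :> D" using differentiable_imp_GDERIV by blast
  obtain E where E: "GDERIV q x :> E" using differentiable_imp_GDERIV[OF Q_edge_differentiable[OF q reg]] by blast
  have "H x = 0" using Theta_zero[OF i _ z] j by (simp add: H_def)
  moreover have "q x = 0" using Q_edge_vanishes[OF q reg _ z] j by simp
  moreover have "normal_lift T i q = (\<lambda>x. H x * q x)" by (auto simp: normal_lift_def H_def)
  ultimately show ?thesis using GDERIV_mult[OF D E] by simp
qed

lemma normal_lift_zero_on_faces:
  assumes i: "i \<in> V" and j: "j \<in> V" and x: "x \<in> rel_interior (opp_face T j)"
  shows "normal_lift T i q x = 0"
proof -
  have z: "bary T j x = 0" using x unfolding rel_interior_opp_face[OF j] by auto
  show ?thesis using Theta_zero[OF i _ z] z j by (cases "j = i") (auto simp: normal_lift_def)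
qed

lemma Z3_cub_E:
  assumes "w \<in> Z3_cub T"
  obtains z b where "z \<in> Z3_e T" "b \<in> B_cub T"
    "w = (\<lambda>x. z x - (\<Sum>j\<in>V. normal_lift T j (q_part T j z) x) + b x)"
proof -
  obtain z b where "z \<in> Z3_e T" "b \<in> B_cub T" "w = R_op T z + b"
    using assms unfolding Z3_cub_def Z3_sing_def by blast
  then show ?thesis by (intro that[of z b]) (auto simp: R_op_def fun_eq_iff sum_fun_apply)
qed

lemma face_bubble_normal:
  assumes i: "i \<in> V" and j: "j \<in> V"
  shows "\<exists>p\<in>polys 2. \<forall>x. \<exists>D. GDERIV (face_bubble T j) x :> D \<and> D \<bullet> outer_normal T i = p x"
proof -
  obtain l m n where lmn: "distinct [l, m, n]" "V - {j} = {l, m, n}" using face_vertices_exist[OF j] .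
  have V: "l \<in> V" "m \<in> V" "n \<in> V" using lmn(2) by auto
  have fb: "face_bubble T j = (\<lambda>x. bary T l x * (bary T m x * bary T n x))"
    unfolding face_bubble_def lmn(2) using lmn(1) by auto
  let ?d = "\<lambda>a. lgrad a \<bullet> outer_normal T i"
  let ?p = "\<lambda>x. ?d n * (bary T l x * bary T m x) + (?d m * (bary T l x * bary T n x) + ?d l * (bary T m x * bary T n x))"
  have "?p \<in> polys 2" by (intro polys2_add polys2_cmult bary_prod_polys2 V)
  moreover have "\<exists>D. GDERIV (face_bubble T j) x :> D \<and> D \<bullet> outer_normal T i = ?p x" for x
    unfolding fb
    by (intro exI conjI, rule GDERIV_mult[OF GDERIV_bary[OF V(1)] GDERIV_mult[OF GDERIV_bary[OF V(2)] GDERIV_bary[OF V(3)]]])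
      (simp add: inner_add_left algebra_simps)
  ultimately show ?thesis by (intro bexI[of _ ?p] allI)
qed

lemma B_cub_normal:
  assumes i: "i \<in> V" and b: "b \<in> B_cub T"
  shows "bdd2 b \<and> (\<exists>p\<in>polys 2. \<forall>x. \<exists>D. GDERIV b x :> D \<and> D \<bullet> outer_normal T i = p x)"
  using b unfolding B_cub_def
proof (induction rule: span_induct_alt)
  case base
  have "GDERIV (\<lambda>x. 0) x :> 0" for x :: "real^3" by (rule GDERIV_const)
  then show ?case unfolding zero_fun_def using bdd_derivs_zero polys2_zero
    by (intro conjI bexI[of _ "\<lambda>x. 0"] allI exI[of _ 0]) auto
next
  case (step c f g)
  then obtain j where j: "j \<in> V" "f = face_bubble T j" by blast
  obtain p where p: "p \<in> polys 2" "\<And>x. \<exists>D. GDERIV f x :> D \<and> D \<bullet> outer_normal T i = p x"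
    using face_bubble_normal[OF i j(1)] unfolding j(2) by blast
  obtain p' where p': "p' \<in> polys 2" "\<And>x. \<exists>D. GDERIV g x :> D \<and> D \<bullet> outer_normal T i = p' x"
    using step.IH by blast
  have eq: "c *\<^sub>R f + g = (\<lambda>x. c * f x + g x)" by auto
  have "bdd2 (\<lambda>x. c * f x + g x)"
    using bdd2_face_bubble[OF j(1)] step.IH unfolding j(2) by (intro bdd_derivs_add bdd_derivs_cmult) auto
  moreover have "(\<lambda>x. c * p x + p' x) \<in> polys 2" using p p' by (intro polys2_add polys2_cmult)
  moreover have "\<exists>D. GDERIV (\<lambda>x. c * f x + g x) x :> D \<and> D \<bullet> outer_normal T i = c * p x + p' x" for x
  proof -
    obtain D D' where D: "GDERIV f x :> D" "D \<bullet> outer_normal T i = p x" "GDERIV g x :> D'" "D' \<bullet> outer_normal T i = p' x"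
      using p(2)[of x] p'(2)[of x] by blast
    show ?thesis
      by (rule exI[of _ "c *\<^sub>R D + D'"]) (use D in \<open>auto intro: GDERIV_add GDERIV_cmult simp: inner_add_left\<close>)
  qed
  ultimately show ?case unfolding eq by (intro conjI bexI[of _ "\<lambda>x. c * p x + p' x"] allI)
qed

lemma bdd2_Z3_cub: assumes "w \<in> Z3_cub T" shows "bdd2 w"
proof -
  obtain z b where zb: "z \<in> Z3_e T" "b \<in> B_cub T"
    "w = (\<lambda>x. z x - (\<Sum>j\<in>V. normal_lift T j (q_part T j z) x) + b x)" using Z3_cub_E[OF assms] .
  obtain k where k: "k \<in> V" using other_vertex by metis
  have "bdd2 b" using B_cub_normal[OF k zb(2)] by blast
  then show ?thesis unfolding zb(3)
    using bdd2_Z3_e[OF zb(1)] bdd2_normal_lift q_part(1)[OF _ zb(1)]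
    by (intro bdd_derivs_add bdd_derivs_diff bdd_derivs_sum) auto
qed

text \<open>The lift from the face opposite to \<open>i\<close> removes exactly the part of the normal derivative in \<open>Q_edge\<close>, and the
other lifts do not contribute on that face.\<close>

lemma normal_derivative_quadratic:
  assumes w: "w \<in> Z3_cub T" and i: "i \<in> V"
  shows "\<exists>p\<in>polys 2. \<forall>x\<in>rel_interior (opp_face T i). bgrad T w x \<bullet> outer_normal T i = p x"
proof -
  obtain z b where zb: "z \<in> Z3_e T" "b \<in> B_cub T"
    "w = (\<lambda>x. z x - (\<Sum>j\<in>V. normal_lift T j (q_part T j z) x) + b x)" using Z3_cub_E[OF w] .
  let ?q = "\<lambda>j. q_part T j z"
  obtain p where p: "p \<in> polys 2" "\<And>x. x \<in> rel_interior (opp_face T i) \<Longrightarrow> bgrad T z x \<bullet> outer_normal T i = p x + ?q i x"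
    using q_part(2)[OF i zb(1)] by blast
  obtain p' where p': "p' \<in> polys 2" "\<And>x. \<exists>D. GDERIV b x :> D \<and> D \<bullet> outer_normal T i = p' x"
    using B_cub_normal[OF i zb(2)] by blast
  have "bgrad T w x \<bullet> outer_normal T i = p x + p' x" if x: "x \<in> rel_interior (opp_face T i)" for x
  proof -
    obtain D where D: "GDERIV b x :> D" "D \<bullet> outer_normal T i = p' x" using p'(2) by blast
    have lift: "GDERIV (normal_lift T j (?q j)) x :> (if j = i then (?q i x / dcoef T i i) *\<^sub>R lgrad i else 0)" if "j \<in> V" for j
      using normal_lift_own_face[OF i q_part(1)[OF i zb(1)] x]
        normal_lift_other_face[OF that i _ q_part(1)[OF that zb(1)] x] by auto
    have "GDERIV w x :> bgrad T z x - (\<Sum>j\<in>V. if j = i then (?q i x / dcoef T i i) *\<^sub>R lgrad i else 0) + D"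
      unfolding zb(3) using relint_T_region[OF i x] bdd2_Z3_e[OF zb(1)]
      by (intro GDERIV_add GDERIV_diff GDERIV_sum lift D(1) GDERIV_bgrad[OF region_facts]) auto
    then have "bgrad T w x = bgrad T z x - (?q i x / dcoef T i i) *\<^sub>R lgrad i + D"
      using bgrad_eqI[OF bdd2_Z3_cub[OF w]] relint_T_region[OF i x] i by simp
    then show ?thesis using p(2)[OF x] D(2) dcoef_nonzero[OF i] dcoef_eq[OF i i]
      by (simp add: inner_add_left inner_diff_left)
  qed
  moreover have "(\<lambda>x. p x + p' x) \<in> polys 2" using p p' by (intro polys2_add)
  ultimately show ?thesis by (intro bexI[of _ "\<lambda>x. p x + p' x"] ballI)
qed

end

section \<open>Traces on the faces\<close>

text \<open>The restriction of an edge bubble to a face, where \<open>a\<close> and \<open>b\<close> are the coordinates of the ends of the edge.\<close>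

definition face_edge_bubble :: "real \<Rightarrow> real \<Rightarrow> real \<Rightarrow> real" where
  "face_edge_bubble a b g = g * a\<^sup>2 * b\<^sup>2 / ((g + a) * (g + b))"

definition quad_form :: "(nat \<Rightarrow> real) \<Rightarrow> real \<Rightarrow> real \<Rightarrow> real \<Rightarrow> real" where
  "quad_form c \<alpha> \<beta> \<gamma> = c 0 * \<alpha>\<^sup>2 + c 1 * \<beta>\<^sup>2 + c 2 * \<gamma>\<^sup>2 + c 3 * (\<alpha> * \<beta>) + c 4 * (\<alpha> * \<gamma>) + c 5 * (\<beta> * \<gamma>)"

text \<open>The functions on a face, in its barycentric coordinates, among which the traces of the local space are found.\<close>

definition trace_form :: "(nat \<Rightarrow> real) \<Rightarrow> real \<Rightarrow> real \<Rightarrow> real \<Rightarrow> real" where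
  "trace_form c \<alpha> \<beta> \<gamma> = quad_form c \<alpha> \<beta> \<gamma>
     + c 6 * (\<alpha>\<^sup>2 * \<beta> - \<beta>\<^sup>2 * \<alpha>) + c 7 * (\<alpha>\<^sup>2 * \<gamma> - \<gamma>\<^sup>2 * \<alpha>) + c 8 * (\<beta>\<^sup>2 * \<gamma> - \<gamma>\<^sup>2 * \<beta>)
     + c 9 * face_edge_bubble \<alpha> \<beta> \<gamma> + c 10 * face_edge_bubble \<alpha> \<gamma> \<beta> + c 11 * face_edge_bubble \<beta> \<gamma> \<alpha>
     + c 12 * (\<alpha> * \<beta> * \<gamma>)"

lemma quad_form_lincomb:
  "r * quad_form c \<alpha> \<beta> \<gamma> + quad_form d \<alpha> \<beta> \<gamma> = quad_form (\<lambda>k. r * c k + d k) \<alpha> \<beta> \<gamma>"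
  unfolding quad_form_def by (simp add: algebra_simps)

lemma trace_form_lincomb:
  "r * trace_form c \<alpha> \<beta> \<gamma> + trace_form d \<alpha> \<beta> \<gamma> = trace_form (\<lambda>k. r * c k + d k) \<alpha> \<beta> \<gamma>"
proof -
  have *: "(r * a + b) * X = r * (a * X) + b * X" for a b X :: real by (simp add: algebra_simps)
  show ?thesis unfolding trace_form_def quad_form_lincomb[symmetric] * by (simp add: algebra_simps)
qed

definition barycentric :: "real \<Rightarrow> real \<Rightarrow> real \<Rightarrow> bool" where
  "barycentric \<alpha> \<beta> \<gamma> \<longleftrightarrow> 0 \<le> \<alpha> \<and> 0 \<le> \<beta> \<and> 0 \<le> \<gamma> \<and> \<alpha> + \<beta> + \<gamma> = 1"

definition coeff_unit :: "nat \<Rightarrow> nat \<Rightarrow> real" where "coeff_unit k j = (if j = k then 1 else 0)"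

lemma cubic_left_end:
  fixes f :: "real \<Rightarrow> real"
  assumes "continuous_on {0..1} f" and "\<And>s. 0 < s \<Longrightarrow> s \<le> 1 \<Longrightarrow> f s = A * (1 - s/2)\<^sup>2 + B * (s/2)\<^sup>2
     + C * ((1 - s/2) * (s/2)) + E * ((1 - s/2)\<^sup>2 * (s/2) - (s/2)\<^sup>2 * (1 - s/2))"
  shows "f 0 = A"
proof -
  define g where "g s = A * (1 - s/2)\<^sup>2 + B * (s/2)\<^sup>2
     + C * ((1 - s/2) * (s/2)) + E * ((1 - s/2)\<^sup>2 * (s/2) - (s/2)\<^sup>2 * (1 - s/2))" for s
  have "f 0 = g 0"
  proof (rule eq_at_left_end[OF assms(1)])
    show "continuous_on {0..1} g" unfolding g_def by (intro continuous_intros; simp)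
  qed (use assms(2) g_def in auto)
  then show ?thesis by (simp add: g_def)
qed

context tetrahedron
begin

context
  fixes i l m n
  assumes i: "i \<in> V" and lmn: "distinct [l, m, n]" "V - {i} = {l, m, n}"
begin

abbreviation (input) "pt \<alpha> \<beta> \<gamma> \<equiv> \<alpha> *\<^sub>R l + \<beta> *\<^sub>R m + \<gamma> *\<^sub>R n"

lemma face_verts: "i \<in> V" "l \<in> V" "m \<in> V" "n \<in> V" "l \<noteq> m" "l \<noteq> n" "m \<noteq> n" "i \<noteq> l" "i \<noteq> m" "i \<noteq> n"
  using face_vertices[OF i lmn] by auto

lemma V_eq: "V = {i, l, m, n}"
  using lmn i by auto

lemma bary_pt:
  assumes "\<alpha> + \<beta> + \<gamma> = 1"
  shows "bary T i (pt \<alpha> \<beta> \<gamma>) = 0" "bary T l (pt \<alpha> \<beta> \<gamma>) = \<alpha>" "bary T m (pt \<alpha> \<beta> \<gamma>) = \<beta>" "bary T n (pt \<alpha> \<beta> \<gamma>) = \<gamma>"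
  using bary_affine_combination[OF _ assms, of _ l m n] face_verts by (simp_all add: bary_vertex)

lemma pt_in_T: "barycentric \<alpha> \<beta> \<gamma> \<Longrightarrow> pt \<alpha> \<beta> \<gamma> \<in> T"
  by (subst T_eq) (auto simp: V_eq bary_pt barycentric_def)

lemma pt_relint:
  assumes "0 < \<alpha>" "0 < \<beta>" "0 < \<gamma>" "\<alpha> + \<beta> + \<gamma> = 1"
  shows "pt \<alpha> \<beta> \<gamma> \<in> rel_interior (opp_face T i)"
  unfolding rel_interior_opp_face[OF i] lmn(2) using bary_pt[OF assms(4)] assms by simp

definition has_form :: "(real^3 \<Rightarrow> real) \<Rightarrow> bool" where
  "has_form f \<longleftrightarrow> (\<exists>c. \<forall>\<alpha> \<beta> \<gamma>. 0 < \<alpha> \<longrightarrow> 0 < \<beta> \<longrightarrow> 0 < \<gamma> \<longrightarrow> \<alpha> + \<beta> + \<gamma> = 1 \<longrightarrow>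
     f (pt \<alpha> \<beta> \<gamma>) = trace_form c \<alpha> \<beta> \<gamma>)"

lemma has_formI:
  "(\<And>\<alpha> \<beta> \<gamma>. 0 < \<alpha> \<Longrightarrow> 0 < \<beta> \<Longrightarrow> 0 < \<gamma> \<Longrightarrow> \<alpha> + \<beta> + \<gamma> = 1 \<Longrightarrow> f (pt \<alpha> \<beta> \<gamma>) = trace_form c \<alpha> \<beta> \<gamma>) \<Longrightarrow> has_form f"
  unfolding has_form_def by blast

lemma has_form_lincomb: assumes "has_form f" "has_form g" shows "has_form (\<lambda>x. r * f x + g x)"
proof -
  obtain c d where "\<And>\<alpha> \<beta> \<gamma>. 0 < \<alpha> \<Longrightarrow> 0 < \<beta> \<Longrightarrow> 0 < \<gamma> \<Longrightarrow> \<alpha> + \<beta> + \<gamma> = 1 \<Longrightarrow> f (pt \<alpha> \<beta> \<gamma>) = trace_form c \<alpha> \<beta> \<gamma>"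
    "\<And>\<alpha> \<beta> \<gamma>. 0 < \<alpha> \<Longrightarrow> 0 < \<beta> \<Longrightarrow> 0 < \<gamma> \<Longrightarrow> \<alpha> + \<beta> + \<gamma> = 1 \<Longrightarrow> g (pt \<alpha> \<beta> \<gamma>) = trace_form d \<alpha> \<beta> \<gamma>"
    using assms unfolding has_form_def by metis
  then show ?thesis by (intro has_formI[where c="\<lambda>k. r * c k + d k"]) (simp add: trace_form_lincomb)
qed

lemma trace_form_zero: "trace_form (\<lambda>k. 0) \<alpha> \<beta> \<gamma> = 0"
  by (simp add: trace_form_def quad_form_def)

lemma has_form_zero: "has_form (\<lambda>x. 0)"
  by (rule has_formI[where c="\<lambda>k. 0"]) (simp add: trace_form_zero)

lemma has_form_zeroI:
  "(\<And>\<alpha> \<beta> \<gamma>. 0 < \<alpha> \<Longrightarrow> 0 < \<beta> \<Longrightarrow> 0 < \<gamma> \<Longrightarrow> \<alpha> + \<beta> + \<gamma> = 1 \<Longrightarrow> f (pt \<alpha> \<beta> \<gamma>) = 0) \<Longrightarrow> has_form f"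
  by (rule has_formI[where c="\<lambda>k. 0"]) (simp add: trace_form_zero)

lemma has_form_span:
  assumes "f \<in> span S" "\<And>g. g \<in> S \<Longrightarrow> has_form g" shows "has_form f"
  using assms(1)
proof (induction rule: span_induct_alt)
  case base
  then show ?case using has_form_zero by (simp add: zero_fun_def)
next
  case (step c x y)
  then show ?case using has_form_lincomb[OF assms(2)[OF step.hyps] step.IH, of c]
    by (simp add: plus_fun_def scaleR_fun_def)
qed

lemma affine_product_quad_form:
  assumes "f \<in> affine_products"
  shows "\<exists>c. (\<forall>k\<ge>6. c k = 0) \<and> (\<forall>\<alpha> \<beta> \<gamma>. \<alpha> + \<beta> + \<gamma> = 1 \<longrightarrow> f (pt \<alpha> \<beta> \<gamma>) = quad_form c \<alpha> \<beta> \<gamma>)"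
proof -
  obtain a A b B where f: "f = (\<lambda>x. (x \<bullet> a + A) * (x \<bullet> b + B))" using assms unfolding affine_products_def by blast
  define a1 a2 a3 where "a1 = l \<bullet> a + A" and "a2 = m \<bullet> a + A" and "a3 = n \<bullet> a + A"
  define b1 b2 b3 where "b1 = l \<bullet> b + B" and "b2 = m \<bullet> b + B" and "b3 = n \<bullet> b + B"
  define c where "c k = (if k = 0 then a1 * b1 else if k = 1 then a2 * b2 else if k = 2 then a3 * b3
    else if k = 3 then a1 * b2 + a2 * b1 else if k = 4 then a1 * b3 + a3 * b1
    else if k = 5 then a2 * b3 + a3 * b2 else 0)" for k :: nat
  have "f (pt \<alpha> \<beta> \<gamma>) = quad_form c \<alpha> \<beta> \<gamma>" if s: "\<alpha> + \<beta> + \<gamma> = 1" for \<alpha> \<beta> \<gamma>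
  proof -
    have aff: "pt \<alpha> \<beta> \<gamma> \<bullet> a + A = \<alpha> * (l \<bullet> a + A) + \<beta> * (m \<bullet> a + A) + \<gamma> * (n \<bullet> a + A)" for a A
    proof -
      have "A = (\<alpha> + \<beta> + \<gamma>) * A" using s by simp
      then show ?thesis by (simp add: inner_add_left algebra_simps)
    qed
    show ?thesis unfolding f aff a1_def[symmetric] a2_def[symmetric] a3_def[symmetric] b1_def[symmetric] b2_def[symmetric] b3_def[symmetric]
      by (simp add: quad_form_def c_def power2_eq_square algebra_simps)
  qed
  moreover have "\<forall>k\<ge>6. c k = 0" by (simp add: c_def)
  ultimately show ?thesis by blast
qed

lemma polys2_quad_form:
  assumes "p \<in> polys 2"
  shows "\<exists>c. (\<forall>k\<ge>6. c k = 0) \<and> (\<forall>\<alpha> \<beta> \<gamma>. \<alpha> + \<beta> + \<gamma> = 1 \<longrightarrow> p (pt \<alpha> \<beta> \<gamma>) = quad_form c \<alpha> \<beta> \<gamma>)"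
proof -
  have "p \<in> span affine_products" using assms polys2_subset by blast
  then show ?thesis
  proof (induction rule: span_induct_alt)
    case base
    then show ?case by (intro exI[of _ "\<lambda>k. 0"]) (simp add: quad_form_def)
  next
    case (step r f g)
    obtain c where c: "\<forall>k\<ge>6. c k = 0" "\<And>\<alpha> \<beta> \<gamma>. \<alpha> + \<beta> + \<gamma> = 1 \<Longrightarrow> f (pt \<alpha> \<beta> \<gamma>) = quad_form c \<alpha> \<beta> \<gamma>"
      using affine_product_quad_form[OF step.hyps] by blast
    obtain d where d: "\<forall>k\<ge>6. d k = 0" "\<And>\<alpha> \<beta> \<gamma>. \<alpha> + \<beta> + \<gamma> = 1 \<Longrightarrow> g (pt \<alpha> \<beta> \<gamma>) = quad_form d \<alpha> \<beta> \<gamma>"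
      using step.IH by blast
    show ?case
      by (intro exI[of _ "\<lambda>k. r * c k + d k"]) (use c d in \<open>simp add: quad_form_lincomb[symmetric]\<close>)
  qed
qed

lemma has_form_polys2: assumes "p \<in> polys 2" shows "has_form p"
proof -
  obtain c where c: "\<forall>k\<ge>6. c k = 0" "\<And>\<alpha> \<beta> \<gamma>. \<alpha> + \<beta> + \<gamma> = 1 \<Longrightarrow> p (pt \<alpha> \<beta> \<gamma>) = quad_form c \<alpha> \<beta> \<gamma>"
    using polys2_quad_form[OF assms] by blast
  show ?thesis by (rule has_formI[where c=c]) (use c in \<open>simp add: trace_form_def\<close>)
qed

lemma has_form_antisym:
  assumes "a \<in> V" "b \<in> V" "a \<noteq> b" shows "has_form (antisym a b)"
proof -
  have neg: "has_form (antisym b a)" if "has_form (antisym a b)" for a b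
  proof -
    have "antisym b a = (\<lambda>x. (- 1) * antisym a b x + 0)" by (auto simp: antisym_def)
    then show ?thesis using has_form_lincomb[OF that has_form_zero, of "- 1"] by simp
  qed
  have lm: "has_form (antisym l m)"
    by (rule has_formI[where c="coeff_unit 6"]) (simp add: antisym_def bary_pt trace_form_def quad_form_def coeff_unit_def)
  have ln: "has_form (antisym l n)"
    by (rule has_formI[where c="coeff_unit 7"]) (simp add: antisym_def bary_pt trace_form_def quad_form_def coeff_unit_def)
  have mn: "has_form (antisym m n)"
    by (rule has_formI[where c="coeff_unit 8"]) (simp add: antisym_def bary_pt trace_form_def quad_form_def coeff_unit_def)
  have z: "has_form (antisym i b)" for b
    by (rule has_form_zeroI) (simp add: antisym_def bary_pt)
  show ?thesis using assms lm ln mn z[of b] neg[OF z[of a]] neg[OF lm] neg[OF ln] neg[OF mn] unfolding V_eq by auto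
qed

lemma edge_bubble_sym: "edge_bubble T a b c = edge_bubble T b a c"
  by (auto simp: edge_bubble_def ac_simps)

lemma has_form_edge_bubble:
  assumes "a \<in> V" "b \<in> V" "c \<in> V" "a \<noteq> b" "c \<noteq> a" "c \<noteq> b" shows "has_form (edge_bubble T a b c)"
proof -
  have lm: "has_form (edge_bubble T l m n)"
    by (rule has_formI[where c="coeff_unit 9"]) (simp add: edge_bubble_def face_edge_bubble_def bary_pt trace_form_def quad_form_def coeff_unit_def)
  have ln: "has_form (edge_bubble T l n m)"
    by (rule has_formI[where c="coeff_unit 10"]) (simp add: edge_bubble_def face_edge_bubble_def bary_pt trace_form_def quad_form_def coeff_unit_def)
  have mn: "has_form (edge_bubble T m n l)"
    by (rule has_formI[where c="coeff_unit 11"]) (simp add: edge_bubble_def face_edge_bubble_def bary_pt trace_form_def quad_form_def coeff_unit_def)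
  have z: "has_form (edge_bubble T a b c)" if "i = a \<or> i = b \<or> i = c"
  proof (rule has_form_zeroI)
    fix \<alpha> \<beta> \<gamma> :: real assume "\<alpha> + \<beta> + \<gamma> = 1"
    then have "bary T i (pt \<alpha> \<beta> \<gamma>) = 0" by (rule bary_pt)
    then have "bary T a (pt \<alpha> \<beta> \<gamma>) = 0 \<or> bary T b (pt \<alpha> \<beta> \<gamma>) = 0 \<or> bary T c (pt \<alpha> \<beta> \<gamma>) = 0"
      using that by metis
    then show "edge_bubble T a b c (pt \<alpha> \<beta> \<gamma>) = 0" unfolding edge_bubble_def by auto
  qed
  show ?thesis using assms lm ln mn z edge_bubble_sym[of a b c] unfolding V_eq by auto
qed

lemma has_form_face_bubble:
  assumes "j \<in> V" shows "has_form (face_bubble T j)"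
proof (cases "j = i")
  case True
  show ?thesis
    by (rule has_formI[where c="coeff_unit 12"])
      (use face_verts in \<open>simp add: True face_bubble_def lmn(2) bary_pt trace_form_def quad_form_def coeff_unit_def mult.assoc\<close>)
next
  case False
  show ?thesis
  proof (rule has_form_zeroI)
    fix \<alpha> \<beta> \<gamma> :: real assume "\<alpha> + \<beta> + \<gamma> = 1"
    then have "bary T i (pt \<alpha> \<beta> \<gamma>) = 0" by (rule bary_pt)
    then show "face_bubble T j (pt \<alpha> \<beta> \<gamma>) = 0" unfolding face_bubble_def using False i by (intro prod_zero) auto
  qed
qed

lemma path_continuous:
  fixes f :: "real^3 \<Rightarrow> real"
  assumes "continuous_on T f" "continuous_on {0..1} a" "continuous_on {0..1} b" "continuous_on {0..1} g"
    "\<And>s. s \<in> {0..1::real} \<Longrightarrow> barycentric (a s) (b s) (g s)"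
  shows "continuous_on {0..1} (\<lambda>s. f (pt (a s) (b s) (g s)))"
proof (rule continuous_on_compose2[OF assms(1)])
  show "continuous_on {0..1} (\<lambda>s. pt (a s) (b s) (g s))" using assms by (intro continuous_intros)
  show "(\<lambda>s. pt (a s) (b s) (g s)) ` {0..1} \<subseteq> T" using pt_in_T assms(5) by blast
qed

text \<open>A point of the closed face is approached along the segment from the barycentre, which stays in the relative
interior up to its end.\<close>

lemma extend_to_boundary:
  fixes f :: "real^3 \<Rightarrow> real"
  assumes f: "continuous_on T f"
    and eq: "\<And>\<alpha> \<beta> \<gamma>. 0 < \<alpha> \<Longrightarrow> 0 < \<beta> \<Longrightarrow> 0 < \<gamma> \<Longrightarrow> \<alpha> + \<beta> + \<gamma> = 1 \<Longrightarrow> f (pt \<alpha> \<beta> \<gamma>) = h \<alpha> \<beta> \<gamma>"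
    and bc: "barycentric \<alpha> \<beta> \<gamma>"
    and h: "continuous_on {0..1} (\<lambda>s. h ((1 - s) * \<alpha> + s / 3) ((1 - s) * \<beta> + s / 3) ((1 - s) * \<gamma> + s / 3))"
  shows "f (pt \<alpha> \<beta> \<gamma>) = h \<alpha> \<beta> \<gamma>"
proof -
  let ?a = "\<lambda>s. (1 - s) * \<alpha> + s / 3" and ?b = "\<lambda>s. (1 - s) * \<beta> + s / 3" and ?g = "\<lambda>s. (1 - s) * \<gamma> + s / 3"
  have sum: "?a s + ?b s + ?g s = 1" for s
  proof -
    have "?a s + ?b s + ?g s = (1 - s) * (\<alpha> + \<beta> + \<gamma>) + s" by (simp add: algebra_simps)
    then show ?thesis using bc by (simp add: barycentric_def)
  qed
  define F H where "F s = f (pt (?a s) (?b s) (?g s))" and "H s = h (?a s) (?b s) (?g s)" for s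
  have "F 0 = H 0"
  proof (rule eq_at_left_end)
    have "barycentric (?a s) (?b s) (?g s)" if "s \<in> {0..1}" for s
      using that bc sum[of s] by (auto simp: barycentric_def)
    then show "continuous_on {0..1} F" unfolding F_def
      by (intro path_continuous[OF f]) (auto intro!: continuous_intros)
    show "continuous_on {0..1} H" unfolding H_def by (rule h)
    show "F s = H s" if "0 < s" "s \<le> 1" for s
    proof -
      have "0 < ?a s" "0 < ?b s" "0 < ?g s"
        using that bc unfolding barycentric_def by (intro add_nonneg_pos mult_nonneg_nonneg; simp)+
      then show ?thesis unfolding F_def H_def by (rule eq[OF _ _ _ sum])
    qed
  qed
  then show ?thesis by (simp add: F_def H_def)
qed

context
  fixes w
  assumes w: "w \<in> Z3_cub T"
begin

lemma has_form_bval: "has_form (bval T w)"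
proof -
  obtain z b where zb: "z \<in> Z3_e T" "b \<in> B_cub T"
    "w = (\<lambda>x. z x - (\<Sum>j\<in>V. normal_lift T j (q_part T j z) x) + b x)" using Z3_cub_E[OF w] .
  obtain p s e where d: "p \<in> polys 2" "s \<in> span {antisym i j | i j. i \<in> V \<and> j \<in> V \<and> i \<noteq> j}"
    "e \<in> span {edge_bubble T l m n | l m n. l \<in> V \<and> m \<in> V \<and> l \<noteq> m \<and> n \<in> V - {l, m}}"
    "z = (\<lambda>x. p x + s x + e x)" using Z3_e_E[OF zb(1)] .
  have s: "has_form s" by (rule has_form_span[OF d(2)]) (auto intro: has_form_antisym)
  have e: "has_form e" by (rule has_form_span[OF d(3)]) (auto intro!: has_form_edge_bubble)
  have b: "has_form b" using zb(2) unfolding B_cub_def by (rule has_form_span) (auto intro: has_form_face_bubble)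
  have "has_form (\<lambda>x. 1 * (1 * (1 * p x + s x) + e x) + b x)"
    by (intro has_form_lincomb has_form_polys2[OF d(1)] s e b)
  then obtain c where c: "\<And>\<alpha> \<beta> \<gamma>. 0 < \<alpha> \<Longrightarrow> 0 < \<beta> \<Longrightarrow> 0 < \<gamma> \<Longrightarrow> \<alpha> + \<beta> + \<gamma> = 1 \<Longrightarrow>
     z (pt \<alpha> \<beta> \<gamma>) + b (pt \<alpha> \<beta> \<gamma>) = trace_form c \<alpha> \<beta> \<gamma>"
    unfolding has_form_def d(4) by auto
  show ?thesis
  proof (rule has_formI[where c=c])
    fix \<alpha> \<beta> \<gamma> :: real assume p: "0 < \<alpha>" "0 < \<beta>" "0 < \<gamma>" "\<alpha> + \<beta> + \<gamma> = 1"
    let ?x = "pt \<alpha> \<beta> \<gamma>"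
    have x: "?x \<in> rel_interior (opp_face T i)" by (rule pt_relint[OF p])
    have "bval T w ?x = w ?x"
      using bval_eq[OF region_facts bdd2_Z3_cub[OF w]] relint_T_region[OF i x] by blast
    also have "\<dots> = z ?x + b ?x"
      unfolding zb(3) using normal_lift_zero_on_faces[OF _ i x] by simp
    also have "\<dots> = trace_form c \<alpha> \<beta> \<gamma>" by (rule c[OF p])
    finally show "bval T w ?x = trace_form c \<alpha> \<beta> \<gamma>" .
  qed
qed

lemma continuous_bval: "continuous_on T (bval T w)"
  using bval_lipschitz[OF region_facts bdd2_Z3_cub[OF w]] lipschitz_on_continuous_on by blast

lemma continuous_bgrad: "continuous_on T (bgrad T w)"
  using bgrad_lipschitz[OF region_facts bdd2_Z3_cub[OF w]] lipschitz_on_continuous_on by blast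

text \<open>The edges are reached from the interior of the face. At a vertex some edge bubbles are quotients \<open>0 / 0\<close>,
whose value is 0; to see that this is the correct value, a vertex is approached along an edge, on which the
trace is a cubic polynomial.\<close>

lemma bval_trace_form:
  "\<exists>c. \<forall>\<alpha> \<beta> \<gamma>. barycentric \<alpha> \<beta> \<gamma> \<longrightarrow> bval T w (pt \<alpha> \<beta> \<gamma>) = trace_form c \<alpha> \<beta> \<gamma>"
proof -
  obtain c where c: "\<And>\<alpha> \<beta> \<gamma>. 0 < \<alpha> \<Longrightarrow> 0 < \<beta> \<Longrightarrow> 0 < \<gamma> \<Longrightarrow> \<alpha> + \<beta> + \<gamma> = 1 \<Longrightarrow>
     bval T w (pt \<alpha> \<beta> \<gamma>) = trace_form c \<alpha> \<beta> \<gamma>" using has_form_bval unfolding has_form_def by blast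
  have ext: "bval T w (pt \<alpha> \<beta> \<gamma>) = trace_form c \<alpha> \<beta> \<gamma>"
    if bc: "barycentric \<alpha> \<beta> \<gamma>" and sums: "0 < \<alpha> + \<beta>" "0 < \<alpha> + \<gamma>" "0 < \<beta> + \<gamma>" for \<alpha> \<beta> \<gamma>
  proof (rule extend_to_boundary[OF continuous_bval c bc])
    have nz: "((1 - s) * p + s / 3) + ((1 - s) * q + s / 3) \<noteq> 0" if "0 < p + q" "s \<in> {0..1}" for p q s :: real
    proof -
      have "((1 - s) * p + s / 3) + ((1 - s) * q + s / 3) = (1 - s) * (p + q) + 2 * s / 3" by (simp add: algebra_simps)
      moreover have "0 < (1 - s) * (p + q) + 2 * s / 3"
        using that by (cases "s = 0") (auto intro: add_nonneg_pos)
      ultimately show ?thesis by simp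
    qed
    show "continuous_on {0..1} (\<lambda>s. trace_form c ((1 - s) * \<alpha> + s / 3) ((1 - s) * \<beta> + s / 3) ((1 - s) * \<gamma> + s / 3))"
      unfolding trace_form_def quad_form_def face_edge_bubble_def
      using nz[of \<alpha> \<beta>] nz[of \<alpha> \<gamma>] nz[of \<beta> \<gamma>] nz[of \<beta> \<alpha>] nz[of \<gamma> \<alpha>] nz[of \<gamma> \<beta>] sums
      by (intro continuous_intros) (auto simp: add.commute)
  qed
  have ext_l: "bval T w (pt 1 0 0) = trace_form c 1 0 0"
  proof -
    have ct: "continuous_on {0..1} (\<lambda>s. bval T w (pt (1 - s/2) (s/2) 0))"
      by (rule path_continuous[OF continuous_bval]) (auto simp: barycentric_def intro!: continuous_intros)
    have "bval T w (pt (1 - s/2) (s/2) 0) = c 0 * (1 - s/2)\<^sup>2 + c 1 * (s/2)\<^sup>2 + c 3 * ((1 - s/2) * (s/2))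
        + c 6 * ((1 - s/2)\<^sup>2 * (s/2) - (s/2)\<^sup>2 * (1 - s/2))" if "0 < s" "s \<le> 1" for s
      by (subst ext) (use that in \<open>auto simp: barycentric_def trace_form_def quad_form_def face_edge_bubble_def algebra_simps\<close>)
    from cubic_left_end[OF ct this] show ?thesis by (simp add: trace_form_def quad_form_def face_edge_bubble_def)
  qed
  have ext_m: "bval T w (pt 0 1 0) = trace_form c 0 1 0"
  proof -
    have ct: "continuous_on {0..1} (\<lambda>s. bval T w (pt (s/2) (1 - s/2) 0))"
      by (rule path_continuous[OF continuous_bval]) (auto simp: barycentric_def intro!: continuous_intros)
    have "bval T w (pt (s/2) (1 - s/2) 0) = c 1 * (1 - s/2)\<^sup>2 + c 0 * (s/2)\<^sup>2 + c 3 * ((1 - s/2) * (s/2))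
        + (- c 6) * ((1 - s/2)\<^sup>2 * (s/2) - (s/2)\<^sup>2 * (1 - s/2))" if "0 < s" "s \<le> 1" for s
      by (subst ext) (use that in \<open>auto simp: barycentric_def trace_form_def quad_form_def face_edge_bubble_def algebra_simps\<close>)
    from cubic_left_end[OF ct this] show ?thesis by (simp add: trace_form_def quad_form_def face_edge_bubble_def)
  qed
  have ext_n: "bval T w (pt 0 0 1) = trace_form c 0 0 1"
  proof -
    have ct: "continuous_on {0..1} (\<lambda>s. bval T w (pt (s/2) 0 (1 - s/2)))"
      by (rule path_continuous[OF continuous_bval]) (auto simp: barycentric_def intro!: continuous_intros)
    have "bval T w (pt (s/2) 0 (1 - s/2)) = c 2 * (1 - s/2)\<^sup>2 + c 0 * (s/2)\<^sup>2 + c 4 * ((1 - s/2) * (s/2))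
        + (- c 7) * ((1 - s/2)\<^sup>2 * (s/2) - (s/2)\<^sup>2 * (1 - s/2))" if "0 < s" "s \<le> 1" for s
      by (subst ext) (use that in \<open>auto simp: barycentric_def trace_form_def quad_form_def face_edge_bubble_def algebra_simps\<close>)
    from cubic_left_end[OF ct this] show ?thesis by (simp add: trace_form_def quad_form_def face_edge_bubble_def)
  qed
  have "bval T w (pt \<alpha> \<beta> \<gamma>) = trace_form c \<alpha> \<beta> \<gamma>"
    if h: "barycentric \<alpha> \<beta> \<gamma>" for \<alpha> \<beta> \<gamma>
  proof -
    consider "\<alpha> = 1" "\<beta> = 0" "\<gamma> = 0" | "\<alpha> = 0" "\<beta> = 1" "\<gamma> = 0" | "\<alpha> = 0" "\<beta> = 0" "\<gamma> = 1"
      | "0 < \<alpha> + \<beta>" "0 < \<alpha> + \<gamma>" "0 < \<beta> + \<gamma>" using h unfolding barycentric_def by linarith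
    then show ?thesis using ext[OF h] ext_l ext_m ext_n by cases auto
  qed
  then show ?thesis by blast
qed

text \<open>A vector orthogonal to the face is a multiple of the outer normal.\<close>

lemma bgrad_normal_quad_form:
  assumes N: "N \<bullet> (m - l) = 0" "N \<bullet> (n - l) = 0"
  shows "\<exists>c. \<forall>\<alpha> \<beta> \<gamma>. barycentric \<alpha> \<beta> \<gamma> \<longrightarrow> bgrad T w (pt \<alpha> \<beta> \<gamma>) \<bullet> N = quad_form c \<alpha> \<beta> \<gamma>"
proof -
  have "V - {l} = {i, m, n}" using V_eq face_verts by auto
  then have "N = (N \<bullet> (i - l)) *\<^sub>R lgrad i"
    using dual_basis_expansion[OF face_verts(2), of N] N face_verts by simp
  moreover have "lgrad i = (- norm (lgrad i)) *\<^sub>R outer_normal T i"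
    using outer_normal_eq[OF i] lgrad_nonzero[OF i] by simp
  ultimately obtain r where r: "N = r *\<^sub>R outer_normal T i" by (metis scaleR_scaleR)
  obtain p where p: "p \<in> polys 2" "\<And>x. x \<in> rel_interior (opp_face T i) \<Longrightarrow> bgrad T w x \<bullet> outer_normal T i = p x"
    using normal_derivative_quadratic[OF w i] by blast
  obtain c where c: "\<And>\<alpha> \<beta> \<gamma>. \<alpha> + \<beta> + \<gamma> = 1 \<Longrightarrow> p (pt \<alpha> \<beta> \<gamma>) = quad_form c \<alpha> \<beta> \<gamma>"
    using polys2_quad_form[OF p(1)] by blast
  have "bgrad T w (pt \<alpha> \<beta> \<gamma>) \<bullet> N = quad_form (\<lambda>k. r * c k) \<alpha> \<beta> \<gamma>" if bc: "barycentric \<alpha> \<beta> \<gamma>" for \<alpha> \<beta> \<gamma>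
  proof (rule extend_to_boundary[OF _ _ bc, where f="\<lambda>x. bgrad T w x \<bullet> N"])
    show "continuous_on T (\<lambda>x. bgrad T w x \<bullet> N)" by (intro continuous_intros continuous_bgrad)
    show "bgrad T w (pt \<alpha> \<beta> \<gamma>) \<bullet> N = quad_form (\<lambda>k. r * c k) \<alpha> \<beta> \<gamma>"
      if pos: "0 < \<alpha>" "0 < \<beta>" "0 < \<gamma>" and sum: "\<alpha> + \<beta> + \<gamma> = 1" for \<alpha> \<beta> \<gamma>
    proof -
      have "bgrad T w (pt \<alpha> \<beta> \<gamma>) \<bullet> N = r * quad_form c \<alpha> \<beta> \<gamma>"
        using p(2)[OF pt_relint[OF pos sum]] c[OF sum] unfolding r by simp
      then show ?thesis by (simp add: quad_form_def algebra_simps)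
    qed
    show "continuous_on {0..1} (\<lambda>s. quad_form (\<lambda>k. r * c k) ((1 - s) * \<alpha> + s / 3) ((1 - s) * \<beta> + s / 3) ((1 - s) * \<gamma> + s / 3))"
      unfolding quad_form_def by (intro continuous_intros; simp)
  qed
  then show ?thesis by blast
qed

end

end

end

section \<open>Matching across shared edges and faces\<close>

text \<open>The coefficient of \<open>t * (1 - t)\<close> carries no factor 2.\<close>

definition bernstein2 :: "real \<Rightarrow> real \<Rightarrow> real \<Rightarrow> real \<Rightarrow> real" where
  "bernstein2 p q r t = p * (1 - t)\<^sup>2 + q * t\<^sup>2 + r * (t * (1 - t))"

definition cubic :: "real \<Rightarrow> real \<Rightarrow> real \<Rightarrow> real \<Rightarrow> real \<Rightarrow> real" where
  "cubic a b c e t = bernstein2 a b c t + e * ((1 - t)\<^sup>2 * t - t\<^sup>2 * (1 - t))"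

lemma cubic_has_derivative:
  "(cubic a b c e has_real_derivative bernstein2 (c + e - 2 * a) (2 * b - c + e) (2 * b - 2 * a - 4 * e) t) (at t within S)"
  unfolding cubic_def bernstein2_def
  by (rule derivative_eq_intros refl)+ (simp add: power2_eq_square algebra_simps)

lemma bernstein2_lincomb:
  "u * bernstein2 p q r t + v * bernstein2 p' q' r' t = bernstein2 (u * p + v * p') (u * q + v * q') (u * r + v * r') t"
  unfolding bernstein2_def by (simp add: algebra_simps)

lemma bernstein2_zero:
  assumes "bernstein2 p q r 0 = 0" "bernstein2 p q r 1 = 0" "bernstein2 p q r (1/2) = 0"
  shows "bernstein2 p q r t = 0"
  using assms by (simp add: bernstein2_def power2_eq_square)

lemma unit_interval_derivative_unique:
  fixes f g :: "real \<Rightarrow> real"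
  assumes "t \<in> {0..1}" "(f has_real_derivative D) (at t within {0..1})" "(g has_real_derivative E) (at t within {0..1})"
    "\<And>s. s \<in> {0..1} \<Longrightarrow> f s = g s"
  shows "D = E"
proof -
  have "(f has_real_derivative E) (at t within {0..1})"
    by (rule has_field_derivative_transform_within[OF assms(3) zero_less_one assms(1)]) (use assms(4) in auto)
  then show ?thesis
    using vector_derivative_unique_within_closed_interval[of 0 1 t f D E] assms(1,2)
    by (simp add: has_real_derivative_iff_has_vector_derivative)
qed

context tetrahedron
begin

lemma segment_in_T:
  assumes "x \<in> T" "y \<in> T" "t \<in> {0..1}" shows "x + t *\<^sub>R (y - x) \<in> T"
proof -
  have "x + t *\<^sub>R (y - x) = (1 - t) *\<^sub>R x + t *\<^sub>R y" by (simp add: algebra_simps)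
  then show ?thesis using convexD[OF convex_T assms(1,2), of "1 - t" t] assms(3) by simp
qed

lemma bval_segment_derivative:
  assumes w: "w \<in> Z3_cub T" and xy: "x \<in> T" "y \<in> T" and t: "t \<in> {0..1}"
  shows "((\<lambda>t. bval T w (x + t *\<^sub>R (y - x))) has_real_derivative bgrad T w (x + t *\<^sub>R (y - x)) \<bullet> (y - x)) (at t within {0..1})"
proof -
  let ?c = "\<lambda>t. x + t *\<^sub>R (y - x)"
  have "?c ` {0..1} \<subseteq> T" using segment_in_T[OF xy] by blast
  then have 1: "(bval T w has_derivative (\<lambda>h. h \<bullet> bgrad T w (?c t))) (at (?c t) within ?c ` {0..1})"
    using bval_has_derivative[OF region_facts bdd2_Z3_cub[OF w] segment_in_T[OF xy t]] has_derivative_subset by blast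
  have 2: "(?c has_derivative (\<lambda>h. h *\<^sub>R (y - x))) (at t within {0..1})"
    by (auto intro!: derivative_eq_intros)
  have eq: "(\<lambda>h. (h *\<^sub>R (y - x)) \<bullet> bgrad T w (?c t)) = (*) (bgrad T w (?c t) \<bullet> (y - x))"
    by (auto simp: inner_commute mult.commute)
  show ?thesis using has_derivative_in_compose[OF 2 1]
    unfolding has_field_derivative_def eq .
qed

lemma two_other_vertices:
  assumes "l \<in> V" "m \<in> V" "l \<noteq> m"
  obtains i n where "i \<in> V" "n \<in> V" "i \<noteq> n" "V - {i} = {l, m, n}" "V - {n} = {l, m, i}" "V - {l} = {i, m, n}" "distinct [l, m, n]" "distinct [l, m, i]"
proof -
  have "card (V - {l, m}) = 2" using assms card_V by (subst card_Diff_subset) auto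
  then obtain i n where "V - {l, m} = {i, n}" "i \<noteq> n" unfolding card_2_iff by blast
  then have "V = {l, m, i, n}" "i \<notin> {l, m}" "n \<notin> {l, m}" using assms by blast+
  then show ?thesis using assms \<open>i \<noteq> n\<close> by (intro that[of i n]) auto
qed

lemma vertex_in_T: "v \<in> V \<Longrightarrow> v \<in> T"
  using V_hull hull_subset[of V convex] by blast

context
  fixes w l m
  assumes w: "w \<in> Z3_cub T" and lm: "l \<in> V" "m \<in> V" "l \<noteq> m"
begin

lemma bval_edge_cubic: "\<exists>a b c e. \<forall>t\<in>{0..1}. bval T w (l + t *\<^sub>R (m - l)) = cubic a b c e t"
proof -
  obtain i n where v: "i \<in> V" "n \<in> V" "i \<noteq> n" "V - {i} = {l, m, n}" "V - {n} = {l, m, i}" "V - {l} = {i, m, n}" "distinct [l, m, n]" "distinct [l, m, i]"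
    using two_other_vertices[OF lm] .
  obtain c where c: "\<And>\<alpha> \<beta> \<gamma>. barycentric \<alpha> \<beta> \<gamma> \<Longrightarrow> bval T w (\<alpha> *\<^sub>R l + \<beta> *\<^sub>R m + \<gamma> *\<^sub>R n) = trace_form c \<alpha> \<beta> \<gamma>"
    using bval_trace_form[OF v(1,7,4) w] by blast
  have "bval T w (l + t *\<^sub>R (m - l)) = cubic (c 0) (c 1) (c 3) (c 6) t" if "t \<in> {0..1}" for t
  proof -
    have "l + t *\<^sub>R (m - l) = (1 - t) *\<^sub>R l + t *\<^sub>R m + 0 *\<^sub>R n" by (simp add: algebra_simps)
    then show ?thesis using c[of "1 - t" t 0] that
      by (simp add: barycentric_def trace_form_def quad_form_def face_edge_bubble_def cubic_def bernstein2_def mult.commute)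
  qed
  then show ?thesis by blast
qed

definition quadratic_on_edge :: "real^3 \<Rightarrow> bool" where
  "quadratic_on_edge N \<longleftrightarrow> (\<exists>p q r. \<forall>t\<in>{0..1}. bgrad T w (l + t *\<^sub>R (m - l)) \<bullet> N = bernstein2 p q r t)"

lemma quadratic_on_edge_lincomb:
  assumes "quadratic_on_edge N" "quadratic_on_edge M" shows "quadratic_on_edge (u *\<^sub>R N + v *\<^sub>R M)"
proof -
  obtain p q r p' q' r' where "\<forall>t\<in>{0..1}. bgrad T w (l + t *\<^sub>R (m - l)) \<bullet> N = bernstein2 p q r t"
    "\<forall>t\<in>{0..1}. bgrad T w (l + t *\<^sub>R (m - l)) \<bullet> M = bernstein2 p' q' r' t"
    using assms unfolding quadratic_on_edge_def by blast
  then have "\<forall>t\<in>{0..1}. bgrad T w (l + t *\<^sub>R (m - l)) \<bullet> (u *\<^sub>R N + v *\<^sub>R M)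
      = bernstein2 (u * p + v * p') (u * q + v * q') (u * r + v * r') t"
    by (simp add: inner_add_right bernstein2_lincomb)
  then show ?thesis unfolding quadratic_on_edge_def by blast
qed

lemma quadratic_on_edge_face_normal:
  assumes "i \<in> V" "V - {i} = {l, m, n}" "distinct [l, m, n]"
  shows "quadratic_on_edge (lgrad i)"
proof -
  have face_verts: "n \<in> V" "i \<noteq> l" "i \<noteq> m" "i \<noteq> n" using assms(2) by auto
  have "lgrad i \<bullet> (m - l) = 0" "lgrad i \<bullet> (n - l) = 0"
    using lgrad_edge[OF assms(1) lm(2,1)] lgrad_edge[OF assms(1) face_verts(1) lm(1)] face_verts by (simp_all add: inner_commute)
  then obtain c where c: "\<And>\<alpha> \<beta> \<gamma>. barycentric \<alpha> \<beta> \<gamma> \<Longrightarrow>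
     bgrad T w (\<alpha> *\<^sub>R l + \<beta> *\<^sub>R m + \<gamma> *\<^sub>R n) \<bullet> lgrad i = quad_form c \<alpha> \<beta> \<gamma>"
    using bgrad_normal_quad_form[OF assms(1,3,2) w] by blast
  have "bgrad T w (l + t *\<^sub>R (m - l)) \<bullet> lgrad i = bernstein2 (c 0) (c 1) (c 3) t" if "t \<in> {0..1}" for t
  proof -
    have "l + t *\<^sub>R (m - l) = (1 - t) *\<^sub>R l + t *\<^sub>R m + 0 *\<^sub>R n" by (simp add: algebra_simps)
    then show ?thesis using c[of "1 - t" t 0] that by (simp add: barycentric_def quad_form_def bernstein2_def mult.commute)
  qed
  then show ?thesis unfolding quadratic_on_edge_def by blast
qed

lemma quadratic_on_edge_tangent: "quadratic_on_edge (m - l)"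
proof -
  obtain a b c e where c: "\<And>t. t \<in> {0..1} \<Longrightarrow> bval T w (l + t *\<^sub>R (m - l)) = cubic a b c e t"
    using bval_edge_cubic by blast
  have "bgrad T w (l + t *\<^sub>R (m - l)) \<bullet> (m - l) = bernstein2 (c + e - 2 * a) (2 * b - c + e) (2 * b - 2 * a - 4 * e) t"
    if t: "t \<in> {0..1}" for t
    by (rule unit_interval_derivative_unique[OF t bval_segment_derivative[OF w vertex_in_T[OF lm(1)] vertex_in_T[OF lm(2)] t] cubic_has_derivative c])
  then show ?thesis unfolding quadratic_on_edge_def by blast
qed

text \<open>The tangent and the normals of the two faces through the edge span the space. In the normal directions
the gradient is quadratic on the whole face, in the tangential direction it is the derivative of a cubic.\<close>

lemma bgrad_edge_quadratic: "quadratic_on_edge N"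
proof -
  obtain i n where v: "i \<in> V" "n \<in> V" "i \<noteq> n" "V - {i} = {l, m, n}" "V - {n} = {l, m, i}" "V - {l} = {i, m, n}" "distinct [l, m, n]" "distinct [l, m, i]"
    using two_other_vertices[OF lm] .
  have i: "quadratic_on_edge (lgrad i)" by (rule quadratic_on_edge_face_normal[OF v(1,4,7)])
  have n: "quadratic_on_edge (lgrad n)" by (rule quadratic_on_edge_face_normal[OF v(2,5,8)])
  have expand: "N = (N \<bullet> (i - l)) *\<^sub>R lgrad i + (N \<bullet> (m - l)) *\<^sub>R lgrad m + (N \<bullet> (n - l)) *\<^sub>R lgrad n" for N
  proof -
    have "N = (\<Sum>a\<in>{i, m, n}. (N \<bullet> (a - l)) *\<^sub>R lgrad a)"
      using dual_basis_expansion[OF lm(1), of N] unfolding v(6) .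
    also have "\<dots> = (N \<bullet> (i - l)) *\<^sub>R lgrad i + (N \<bullet> (m - l)) *\<^sub>R lgrad m + (N \<bullet> (n - l)) *\<^sub>R lgrad n"
      using v(3,7,8) not_sym[of m i] by (simp add: add.assoc)
    finally show ?thesis .
  qed
  \<comment> \<open>The tangent has a positive coefficient at \<open>lgrad m\<close>, which can thus be expressed by the tangent and the normals.\<close>
  define s where "s = (m - l) \<bullet> (m - l)"
  have s: "s \<noteq> 0" using lm by (simp add: s_def)
  let ?R = "((m - l) \<bullet> (i - l)) *\<^sub>R lgrad i + ((m - l) \<bullet> (n - l)) *\<^sub>R lgrad n"
  have "m - l = s *\<^sub>R lgrad m + ?R" unfolding s_def by (subst expand[of "m - l"]) simp
  then have "s *\<^sub>R lgrad m = (m - l) - ?R" by (metis add_diff_cancel_right')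
  then have "lgrad m = (1 / s) *\<^sub>R ((m - l) - ?R)" using s by (metis divideR_right inverse_eq_divide)
  then have eq: "lgrad m = (1 / s) *\<^sub>R (m - l) + (- (1 / s)) *\<^sub>R ?R" by (simp add: scaleR_diff_right)
  have m: "quadratic_on_edge (lgrad m)"
    by (subst eq) (intro quadratic_on_edge_lincomb quadratic_on_edge_tangent i n)
  have "quadratic_on_edge (1 *\<^sub>R ((N \<bullet> (i - l)) *\<^sub>R lgrad i + (N \<bullet> (m - l)) *\<^sub>R lgrad m) + (N \<bullet> (n - l)) *\<^sub>R lgrad n)"
    by (intro quadratic_on_edge_lincomb i n m)
  then show ?thesis by (subst expand) simp
qed

end

end

lemma zero_if_orthogonal_to_frame:
  fixes d g0 g1 v :: "real^3"
  assumes "independent {g0, g1}" "g0 \<noteq> g1" "g0 \<bullet> v = 0" "g1 \<bullet> v = 0" "v \<noteq> 0" "d \<bullet> g0 = 0" "d \<bullet> g1 = 0" "d \<bullet> v = 0"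
  shows "d = 0"
proof -
  have "v \<notin> span {g0, g1}"
  proof
    assume "v \<in> span {g0, g1}"
    then have "orthogonal v v"
      by (rule orthogonal_to_span) (use assms in \<open>auto simp: orthogonal_def inner_commute\<close>)
    then show False using assms(5) by (simp add: orthogonal_def)
  qed
  then have ind: "independent {v, g0, g1}" "v \<noteq> g0" "v \<noteq> g1"
    using assms(1) by (auto simp: independent_insert intro: span_base)
  have "card {v, g0, g1} = 3" using ind assms(2) by simp
  then have "UNIV \<subseteq> span {v, g0, g1}"
    using ind by (intro card_ge_dim_independent) auto
  then have "orthogonal d d"
    by (intro orthogonal_to_span[of d "{v, g0, g1}"]) (use assms in \<open>auto simp: orthogonal_def inner_commute\<close>)
  then show ?thesis by (simp add: orthogonal_def)
qed

lemma face_edge_bubble_sym: "face_edge_bubble a b g = face_edge_bubble b a g"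
  by (simp add: face_edge_bubble_def ac_simps)

text \<open>The path runs from the midpoint of an edge towards the opposite vertex. At its start the bubble of that edge
and the face bubble both have slope 1/4, while the other two edge bubbles are of second order.\<close>

lemma midpoint_slope:
  assumes d: "(f has_real_derivative 0) (at 0 within {0..1})"
    and f: "\<And>t a. t \<in> {0..1} \<Longrightarrow> a = (1 - t) / 2 \<Longrightarrow> f t = e * face_edge_bubble a a t
      + (e2 + e3) * face_edge_bubble a t a + c * (a * a * t)"
  shows "e + c = 0"
proof -
  define h where "h t = e * ((1 - t) / 2)^4 / ((1 + t) / 2)\<^sup>2 + (e2 + e3) * ((1 - t) / 2)\<^sup>2 * t / (1 + t) + c * ((1 - t) / 2)\<^sup>2" for t :: real
  have "isCont h 0" unfolding h_def by (intro continuous_intros) auto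
  then have "((\<lambda>t. t * h t) has_real_derivative h 0) (at 0)"
    unfolding CARAT_DERIV by (intro exI[of _ h]) simp
  then have D: "((\<lambda>t. t * h t) has_real_derivative h 0) (at 0 within {0..1})"
    by (rule has_field_derivative_at_within)
  have "0 = h 0"
  proof (rule unit_interval_derivative_unique[OF _ d D])
    fix t :: real assume t: "t \<in> {0..1}"
    define a where "a = (1 - t) / 2"
    have at: "a + t = (1 + t) / 2" by (simp add: a_def field_simps)
    have nz: "(1 + t) / 2 \<noteq> 0" "1 + t \<noteq> 0" using t by auto
    have "face_edge_bubble a a t = t * (a^4 / ((1 + t) / 2)\<^sup>2)"
      by (simp add: face_edge_bubble_def at[unfolded add.commute[of a]] power2_eq_square power4_eq_xxxx)
    moreover have "face_edge_bubble a t a = t * (a\<^sup>2 * t / (1 + t))"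
    proof (cases "a = 0")
      case False
      have den: "(a + a) * ((1 + t) / 2) = a * (1 + t)" by simp
      show ?thesis unfolding face_edge_bubble_def at den using False by (simp add: power2_eq_square)
    qed (simp add: face_edge_bubble_def)
    ultimately show "f t = t * h t"
      unfolding f[OF t a_def] h_def a_def[symmetric] by (simp add: algebra_simps power2_eq_square)
  qed simp
  then show ?thesis by (simp add: h_def power2_eq_square power4_eq_xxxx)
qed

text \<open>Along an edge the bubbles vanish, and the values at \<open>t = 0, 1, 1/2, 1/3\<close> determine the four remaining
coefficients one after the other.\<close>

lemma trace_form_bubbles:
  assumes "\<And>t. t \<in> {0..1} \<Longrightarrow> trace_form k (1 - t) t 0 = 0" "\<And>t. t \<in> {0..1} \<Longrightarrow> trace_form k (1 - t) 0 t = 0"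
    "\<And>t. t \<in> {0..1} \<Longrightarrow> trace_form k 0 (1 - t) t = 0"
  shows "trace_form k \<alpha> \<beta> \<gamma> = k 9 * face_edge_bubble \<alpha> \<beta> \<gamma> + k 10 * face_edge_bubble \<alpha> \<gamma> \<beta>
     + k 11 * face_edge_bubble \<beta> \<gamma> \<alpha> + k 12 * (\<alpha> * \<beta> * \<gamma>)"
proof -
  note tf = trace_form_def quad_form_def face_edge_bubble_def
  have k012: "k 0 = 0" "k 1 = 0" "k 2 = 0"
    using assms(1)[of 0] assms(1)[of 1] assms(2)[of 1] by (simp_all add: tf)
  have k345: "k 3 = 0" "k 4 = 0" "k 5 = 0"
    using assms(1)[of "1/2"] assms(2)[of "1/2"] assms(3)[of "1/2"] k012 by (simp_all add: tf power2_eq_square)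
  have k678: "k 6 = 0" "k 7 = 0" "k 8 = 0"
    using assms(1)[of "1/3"] assms(2)[of "1/3"] assms(3)[of "1/3"] k012 k345 by (simp_all add: tf power2_eq_square)
  show ?thesis unfolding trace_form_def quad_form_def k012 k345 k678 by simp
qed

locale tetrahedron_pair = T: tetrahedron T + T': tetrahedron T' for T T' +
  fixes w w'
  assumes w: "w \<in> Z3_cub T" and w': "w' \<in> Z3_cub T'"
begin

lemma bgrad_match_tangential:
  assumes xy: "x \<in> T" "y \<in> T" "x \<in> T'" "y \<in> T'"
    and eq: "\<And>t. t \<in> {0..1} \<Longrightarrow> bval T w (x + t *\<^sub>R (y - x)) = bval T' w' (x + t *\<^sub>R (y - x))"
    and t: "t \<in> {0..1}"
  shows "bgrad T w (x + t *\<^sub>R (y - x)) \<bullet> (y - x) = bgrad T' w' (x + t *\<^sub>R (y - x)) \<bullet> (y - x)"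
  by (rule unit_interval_derivative_unique[OF t T.bval_segment_derivative[OF w xy(1,2) t]
        T'.bval_segment_derivative[OF w' xy(3,4) t] eq])

text \<open>The traces agree because a cubic is determined by values and slopes at both ends. At the midpoint the
tangential parts of the gradients then agree as well, and \<open>g0\<close> and \<open>g1\<close> account for the orthogonal parts;
with the values at the ends this determines the quadratic gradients.\<close>

lemma edge_match:
  assumes lm: "l \<in> verts T" "m \<in> verts T" "l \<in> verts T'" "m \<in> verts T'" "l \<noteq> m"
    and vals: "bval T w l = bval T' w' l" "bval T w m = bval T' w' m"
    and grads: "bgrad T w l = bgrad T' w' l" "bgrad T w m = bgrad T' w' m"
    and g: "independent {g0, g1}" "g0 \<noteq> g1" "g0 \<bullet> (m - l) = 0" "g1 \<bullet> (m - l) = 0"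
    and mid: "bgrad T w (l + (1/2) *\<^sub>R (m - l)) \<bullet> g0 = bgrad T' w' (l + (1/2) *\<^sub>R (m - l)) \<bullet> g0"
      "bgrad T w (l + (1/2) *\<^sub>R (m - l)) \<bullet> g1 = bgrad T' w' (l + (1/2) *\<^sub>R (m - l)) \<bullet> g1"
    and t: "t \<in> {0..1}"
  shows "bval T w (l + t *\<^sub>R (m - l)) = bval T' w' (l + t *\<^sub>R (m - l))"
    and "bgrad T w (l + t *\<^sub>R (m - l)) = bgrad T' w' (l + t *\<^sub>R (m - l))"
proof -
  let ?x = "\<lambda>t. l + t *\<^sub>R (m - l)"
  note lT = T.vertex_in_T[OF lm(1)] and mT = T.vertex_in_T[OF lm(2)]
    and lT' = T'.vertex_in_T[OF lm(3)] and mT' = T'.vertex_in_T[OF lm(4)]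
  obtain a b c e where c: "\<And>t. t \<in> {0..1} \<Longrightarrow> bval T w (?x t) = cubic a b c e t"
    using T.bval_edge_cubic[OF w lm(1,2,5)] by blast
  obtain a' b' c' e' where c': "\<And>t. t \<in> {0..1} \<Longrightarrow> bval T' w' (?x t) = cubic a' b' c' e' t"
    using T'.bval_edge_cubic[OF w' lm(3,4,5)] by blast
  have ab: "a = a'" "b = b'"
    using vals c[of 0] c'[of 0] c[of 1] c'[of 1] by (simp_all add: cubic_def bernstein2_def)
  have D: "bgrad T w (?x t) \<bullet> (m - l) = bernstein2 (c + e - 2 * a) (2 * b - c + e) (2 * b - 2 * a - 4 * e) t"
    if t: "t \<in> {0..1}" for t
    by (rule unit_interval_derivative_unique[OF t T.bval_segment_derivative[OF w lT mT t] cubic_has_derivative c])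
  have D': "bgrad T' w' (?x t) \<bullet> (m - l) = bernstein2 (c' + e' - 2 * a') (2 * b' - c' + e') (2 * b' - 2 * a' - 4 * e') t"
    if t: "t \<in> {0..1}" for t
    by (rule unit_interval_derivative_unique[OF t T'.bval_segment_derivative[OF w' lT' mT' t] cubic_has_derivative c'])
  have "c + e = c' + e'" "e - c = e' - c'"
    using D[of 0] D'[of 0] D[of 1] D'[of 1] grads ab by (simp_all add: bernstein2_def)
  then have ce: "c = c'" "e = e'" by linarith+
  have val: "bval T w (?x t) = bval T' w' (?x t)" if "t \<in> {0..1}" for t
    using c[OF that] c'[OF that] ab ce by simp
  then show "bval T w (?x t) = bval T' w' (?x t)" using t .
  have tang: "bgrad T w (?x (1/2)) \<bullet> (m - l) = bgrad T' w' (?x (1/2)) \<bullet> (m - l)"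
    by (rule bgrad_match_tangential[OF lT mT lT' mT' val]) auto
  have midz: "bgrad T w (?x (1/2)) - bgrad T' w' (?x (1/2)) = 0"
    by (rule zero_if_orthogonal_to_frame[OF g(1,2,3,4)]) (use lm mid tang in \<open>simp_all add: inner_diff_left\<close>)
  have "(bgrad T w (?x t) - bgrad T' w' (?x t)) \<bullet> N = 0" for N
  proof -
    obtain p q r where p: "\<And>t. t \<in> {0..1} \<Longrightarrow> bgrad T w (?x t) \<bullet> N = bernstein2 p q r t"
      using T.bgrad_edge_quadratic[OF w lm(1,2,5), of N] unfolding T.quadratic_on_edge_def[OF w lm(1,2,5)] by blast
    obtain p' q' r' where p': "\<And>t. t \<in> {0..1} \<Longrightarrow> bgrad T' w' (?x t) \<bullet> N = bernstein2 p' q' r' t"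
      using T'.bgrad_edge_quadratic[OF w' lm(3,4,5), of N] unfolding T'.quadratic_on_edge_def[OF w' lm(3,4,5)] by blast
    have d: "(bgrad T w (?x t) - bgrad T' w' (?x t)) \<bullet> N = bernstein2 (1 * p + (-1) * p') (1 * q + (-1) * q') (1 * r + (-1) * r') t"
      if "t \<in> {0..1}" for t
      unfolding bernstein2_lincomb[symmetric] using p[OF that] p'[OF that] by (simp add: inner_diff_left)
    show ?thesis unfolding d[OF t]
      by (rule bernstein2_zero; subst d[symmetric]) (use grads midz in simp_all)
  qed
  from this[of "bgrad T w (?x t) - bgrad T' w' (?x t)"]
  show "bgrad T w (?x t) = bgrad T' w' (?x t)" by simp
qed

context
  fixes i i' l m n
  assumes i: "i \<in> verts T" "verts T - {i} = {l, m, n}" and i': "i' \<in> verts T'" "verts T' - {i'} = {l, m, n}"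
    and dist: "distinct [l, m, n]"
    and edges: "\<And>a b t. a \<in> {l, m, n} \<Longrightarrow> b \<in> {l, m, n} \<Longrightarrow> a \<noteq> b \<Longrightarrow> t \<in> {0..1} \<Longrightarrow>
      bval T w (a + t *\<^sub>R (b - a)) = bval T' w' (a + t *\<^sub>R (b - a)) \<and>
      bgrad T w (a + t *\<^sub>R (b - a)) = bgrad T' w' (a + t *\<^sub>R (b - a))"
begin

definition face_point :: "real \<Rightarrow> real \<Rightarrow> real \<Rightarrow> real^3" where
  "face_point \<alpha> \<beta> \<gamma> = \<alpha> *\<^sub>R l + \<beta> *\<^sub>R m + \<gamma> *\<^sub>R n"

definition bval_jump :: "real \<Rightarrow> real \<Rightarrow> real \<Rightarrow> real" where
  "bval_jump \<alpha> \<beta> \<gamma> = bval T w (face_point \<alpha> \<beta> \<gamma>) - bval T' w' (face_point \<alpha> \<beta> \<gamma>)"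

definition bgrad_jump :: "real \<Rightarrow> real \<Rightarrow> real \<Rightarrow> real^3" where
  "bgrad_jump \<alpha> \<beta> \<gamma> = bgrad T w (face_point \<alpha> \<beta> \<gamma>) - bgrad T' w' (face_point \<alpha> \<beta> \<gamma>)"

lemma face_point_in: "barycentric \<alpha> \<beta> \<gamma> \<Longrightarrow> face_point \<alpha> \<beta> \<gamma> \<in> T" "barycentric \<alpha> \<beta> \<gamma> \<Longrightarrow> face_point \<alpha> \<beta> \<gamma> \<in> T'"
  using T.pt_in_T[OF i(1) dist i(2)] T'.pt_in_T[OF i'(1) dist i'(2)] by (simp_all add: face_point_def)

lemma jumps_on_edges:
  assumes "t \<in> {0..1}"
  shows "bval_jump (1 - t) t 0 = 0" "bval_jump (1 - t) 0 t = 0" "bval_jump 0 (1 - t) t = 0"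
    "bgrad_jump (1 - t) t 0 = 0" "bgrad_jump (1 - t) 0 t = 0" "bgrad_jump 0 (1 - t) t = 0"
proof -
  have "face_point (1 - t) t 0 = l + t *\<^sub>R (m - l)" "face_point (1 - t) 0 t = l + t *\<^sub>R (n - l)"
    "face_point 0 (1 - t) t = m + t *\<^sub>R (n - m)" by (simp_all add: face_point_def algebra_simps)
  then show "bval_jump (1 - t) t 0 = 0" "bval_jump (1 - t) 0 t = 0" "bval_jump 0 (1 - t) t = 0"
    "bgrad_jump (1 - t) t 0 = 0" "bgrad_jump (1 - t) 0 t = 0" "bgrad_jump 0 (1 - t) t = 0"
    using edges[of l m t] edges[of l n t] edges[of m n t] assms dist
    by (simp_all add: bval_jump_def bgrad_jump_def)
qed

lemma midpoint_bgrad_jumps: "bgrad_jump (1/2) (1/2) 0 = 0" "bgrad_jump (1/2) 0 (1/2) = 0" "bgrad_jump 0 (1/2) (1/2) = 0"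
  using jumps_on_edges(4-6)[of "1/2"] by simp_all

lemma vertex_bgrad_jumps: "bgrad_jump 1 0 0 = 0" "bgrad_jump 0 1 0 = 0" "bgrad_jump 0 0 1 = 0"
  using jumps_on_edges(4)[of 0] jumps_on_edges(4)[of 1] jumps_on_edges(5)[of 1] by simp_all

lemma bval_jump_slope:
  assumes "barycentric p q r" "barycentric a b g" "bgrad_jump p q r = 0"
  shows "((\<lambda>t. bval_jump (p + t * (a - p)) (q + t * (b - q)) (r + t * (g - r))) has_real_derivative 0) (at 0 within {0..1})"
proof -
  let ?x = "face_point p q r" and ?y = "face_point a b g"
  have "face_point (p + t * (a - p)) (q + t * (b - q)) (r + t * (g - r)) = ?x + t *\<^sub>R (?y - ?x)" for t
    by (simp add: face_point_def algebra_simps)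
  then show ?thesis
    using DERIV_diff[OF T.bval_segment_derivative[OF w face_point_in(1)[OF assms(1)] face_point_in(1)[OF assms(2)], of 0]
        T'.bval_segment_derivative[OF w' face_point_in(2)[OF assms(1)] face_point_in(2)[OF assms(2)], of 0]] assms(3)
    by (simp add: bval_jump_def bgrad_jump_def)
qed

text \<open>If \<open>c\<close> is the coefficient of the face bubble, then the slopes at the midpoints make all coefficients of edge
bubbles equal to \<open>- c\<close>. The value at the barycentre is therefore \<open>- 3 * c / 108 + c / 27 = c / 108\<close>.\<close>

lemma bval_match_face:
  assumes center: "bval_jump (1/3) (1/3) (1/3) = 0" and bc: "barycentric \<alpha> \<beta> \<gamma>"
  shows "bval_jump \<alpha> \<beta> \<gamma> = 0"
proof -
  obtain c where c: "\<And>\<alpha> \<beta> \<gamma>. barycentric \<alpha> \<beta> \<gamma> \<Longrightarrow> bval T w (face_point \<alpha> \<beta> \<gamma>) = trace_form c \<alpha> \<beta> \<gamma>"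
    using T.bval_trace_form[OF i(1) dist i(2) w] unfolding face_point_def by blast
  obtain c' where c': "\<And>\<alpha> \<beta> \<gamma>. barycentric \<alpha> \<beta> \<gamma> \<Longrightarrow> bval T' w' (face_point \<alpha> \<beta> \<gamma>) = trace_form c' \<alpha> \<beta> \<gamma>"
    using T'.bval_trace_form[OF i'(1) dist i'(2) w'] unfolding face_point_def by blast
  define k where "k = (\<lambda>j. - 1 * c' j + c j)"
  have k: "bval_jump \<alpha> \<beta> \<gamma> = trace_form k \<alpha> \<beta> \<gamma>" if "barycentric \<alpha> \<beta> \<gamma>" for \<alpha> \<beta> \<gamma>
    using c[OF that] c'[OF that] trace_form_lincomb[of "- 1" c' \<alpha> \<beta> \<gamma> c] by (simp add: k_def bval_jump_def)
  have z: "trace_form k (1 - t) t 0 = 0" "trace_form k (1 - t) 0 t = 0" "trace_form k 0 (1 - t) t = 0" if "t \<in> {0..1}" for t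
    using k[of "1 - t" t 0] k[of "1 - t" 0 t] k[of 0 "1 - t" t] jumps_on_edges[OF that] that by (simp_all add: barycentric_def)
  have form: "trace_form k \<alpha> \<beta> \<gamma> = k 9 * face_edge_bubble \<alpha> \<beta> \<gamma> + k 10 * face_edge_bubble \<alpha> \<gamma> \<beta>
     + k 11 * face_edge_bubble \<beta> \<gamma> \<alpha> + k 12 * (\<alpha> * \<beta> * \<gamma>)" for \<alpha> \<beta> \<gamma>
    by (rule trace_form_bubbles) (rule z, assumption)+
  have eq: "1/2 + t * (0 - 1/2) = a" "0 + t * (1 - 0) = t" "barycentric a a t" "barycentric a t a" "barycentric t a a"
    if "t \<in> {0..1}" "a = (1 - t) / 2" for t a :: real
    using that by (auto simp: barycentric_def field_simps)
  have bc0: "barycentric 1 0 0" "barycentric 0 1 0" "barycentric 0 0 1"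
    "barycentric (1/2) (1/2) 0" "barycentric (1/2) 0 (1/2)" "barycentric 0 (1/2) (1/2)" by (simp_all add: barycentric_def)
  have "k 9 + k 12 = 0"
  proof (rule midpoint_slope[OF bval_jump_slope[OF bc0(4,3) midpoint_bgrad_jumps(1)]])
    fix t a :: real assume ta: "t \<in> {0..1}" "a = (1 - t) / 2"
    show "bval_jump (1/2 + t * (0 - 1/2)) (1/2 + t * (0 - 1/2)) (0 + t * (1 - 0))
      = k 9 * face_edge_bubble a a t + (k 10 + k 11) * face_edge_bubble a t a + k 12 * (a * a * t)"
      unfolding eq(1,2)[OF ta] k[OF eq(3)[OF ta]] form by (simp add: algebra_simps)
  qed
  moreover have "k 10 + k 12 = 0"
  proof (rule midpoint_slope[OF bval_jump_slope[OF bc0(5,2) midpoint_bgrad_jumps(2)]])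
    fix t a :: real assume ta: "t \<in> {0..1}" "a = (1 - t) / 2"
    show "bval_jump (1/2 + t * (0 - 1/2)) (0 + t * (1 - 0)) (1/2 + t * (0 - 1/2))
      = k 10 * face_edge_bubble a a t + (k 9 + k 11) * face_edge_bubble a t a + k 12 * (a * a * t)"
      unfolding eq(1,2)[OF ta] k[OF eq(4)[OF ta]] form by (simp add: face_edge_bubble_sym[of t a] algebra_simps)
  qed
  moreover have "k 11 + k 12 = 0"
  proof (rule midpoint_slope[OF bval_jump_slope[OF bc0(6,1) midpoint_bgrad_jumps(3)]])
    fix t a :: real assume ta: "t \<in> {0..1}" "a = (1 - t) / 2"
    show "bval_jump (0 + t * (1 - 0)) (1/2 + t * (0 - 1/2)) (1/2 + t * (0 - 1/2))
      = k 11 * face_edge_bubble a a t + (k 9 + k 10) * face_edge_bubble a t a + k 12 * (a * a * t)"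
      unfolding eq(1,2)[OF ta] k[OF eq(5)[OF ta]] form by (simp add: face_edge_bubble_sym[of t a] algebra_simps)
  qed
  ultimately have neg: "k 9 = - k 12" "k 10 = - k 12" "k 11 = - k 12" by (simp_all add: eq_neg_iff_add_eq_0)
  have "trace_form k (1/3) (1/3) (1/3) = 0" using k[of "1/3" "1/3" "1/3"] center by (simp add: barycentric_def)
  then have "(k 9 + k 10 + k 11) / 108 + k 12 / 27 = 0"
    unfolding form by (simp add: face_edge_bubble_def power2_eq_square add_divide_distrib)
  then have "k 12 = 0" unfolding neg by simp
  then show ?thesis unfolding k[OF bc] form neg by simp
qed

text \<open>The tangential part vanishes because the traces agree on the whole face. The normal part is a quadratic form
in the barycentric coordinates which vanishes at the vertices and at the midpoints of the edges.\<close>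

lemma bgrad_match_face:
  assumes center: "bval_jump (1/3) (1/3) (1/3) = 0" and bc: "barycentric \<alpha> \<beta> \<gamma>"
  shows "bgrad_jump \<alpha> \<beta> \<gamma> = 0"
proof -
  have tang: "bgrad_jump \<alpha> \<beta> \<gamma> \<bullet> (face_point a b g - face_point \<alpha> \<beta> \<gamma>) = 0" if bc': "barycentric a b g" for a b g
  proof -
    let ?x = "face_point \<alpha> \<beta> \<gamma>" and ?y = "face_point a b g"
    have "bval T w (?x + t *\<^sub>R (?y - ?x)) = bval T' w' (?x + t *\<^sub>R (?y - ?x))" if t: "t \<in> {0..1}" for t
    proof -
      let ?a = "(1 - t) * \<alpha> + t * a" and ?b = "(1 - t) * \<beta> + t * b" and ?g = "(1 - t) * \<gamma> + t * g"
      have eq: "?x + t *\<^sub>R (?y - ?x) = face_point ?a ?b ?g" by (simp add: face_point_def algebra_simps)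
      have "?a + ?b + ?g = (1 - t) * (\<alpha> + \<beta> + \<gamma>) + t * (a + b + g)" by (simp add: algebra_simps)
      then have "barycentric ?a ?b ?g" using bc bc' t by (auto simp: barycentric_def)
      from bval_match_face[OF center this] show ?thesis unfolding eq bval_jump_def by simp
    qed
    from bgrad_match_tangential[OF face_point_in(1)[OF bc] face_point_in(1)[OF bc'] face_point_in(2)[OF bc] face_point_in(2)[OF bc'] this, of 0]
    show ?thesis by (simp add: bgrad_jump_def inner_diff_left)
  qed
  let ?N = "T.lgrad i" and ?d = "bgrad_jump \<alpha> \<beta> \<gamma>"
  have vT: "l \<in> verts T" "m \<in> verts T" "n \<in> verts T" "i \<noteq> l" "i \<noteq> m" "i \<noteq> n" using i(2) by auto
  have perp: "?N \<bullet> (m - l) = 0" "?N \<bullet> (n - l) = 0"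
    using T.lgrad_edge[OF i(1) vT(2,1)] T.lgrad_edge[OF i(1) vT(3,1)] vT by (simp_all add: inner_commute)
  obtain q where q: "\<And>\<alpha> \<beta> \<gamma>. barycentric \<alpha> \<beta> \<gamma> \<Longrightarrow> bgrad T w (face_point \<alpha> \<beta> \<gamma>) \<bullet> ?N = quad_form q \<alpha> \<beta> \<gamma>"
    using T.bgrad_normal_quad_form[OF i(1) dist i(2) w perp] unfolding face_point_def by blast
  obtain q' where q': "\<And>\<alpha> \<beta> \<gamma>. barycentric \<alpha> \<beta> \<gamma> \<Longrightarrow> bgrad T' w' (face_point \<alpha> \<beta> \<gamma>) \<bullet> ?N = quad_form q' \<alpha> \<beta> \<gamma>"
    using T'.bgrad_normal_quad_form[OF i'(1) dist i'(2) w' perp] unfolding face_point_def by blast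
  define r where "r = (\<lambda>j. - 1 * q' j + q j)"
  have r: "bgrad_jump \<alpha> \<beta> \<gamma> \<bullet> ?N = quad_form r \<alpha> \<beta> \<gamma>" if "barycentric \<alpha> \<beta> \<gamma>" for \<alpha> \<beta> \<gamma>
    using q[OF that] q'[OF that] quad_form_lincomb[of "- 1" q' \<alpha> \<beta> \<gamma> q] by (simp add: r_def bgrad_jump_def inner_diff_left)
  have r012: "r 0 = 0" "r 1 = 0" "r 2 = 0"
    using r[of 1 0 0] r[of 0 1 0] r[of 0 0 1] vertex_bgrad_jumps by (simp_all add: barycentric_def quad_form_def)
  have r345: "r 3 = 0" "r 4 = 0" "r 5 = 0"
    using r[of "1/2" "1/2" 0] r[of "1/2" 0 "1/2"] r[of 0 "1/2" "1/2"] midpoint_bgrad_jumps r012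
    by (simp_all add: barycentric_def quad_form_def)
  have normal: "?d \<bullet> ?N = 0" unfolding r[OF bc] quad_form_def r012 r345 by simp
  have "?d \<bullet> (l - face_point \<alpha> \<beta> \<gamma>) = 0" "?d \<bullet> (m - face_point \<alpha> \<beta> \<gamma>) = 0" "?d \<bullet> (n - face_point \<alpha> \<beta> \<gamma>) = 0"
    using tang[of 1 0 0] tang[of 0 1 0] tang[of 0 0 1] by (simp_all add: face_point_def barycentric_def)
  then have ort: "?d \<bullet> (m - l) = 0" "?d \<bullet> (n - l) = 0" by (simp_all add: inner_diff_right)
  have "verts T - {l} = {i, m, n}" using i vT dist by auto
  then have "?d = (?d \<bullet> (i - l)) *\<^sub>R ?N"
    using T.dual_basis_expansion[OF vT(1), of ?d] ort vT dist by simp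
  then have "?d \<bullet> ?d = (?d \<bullet> (i - l)) * (?d \<bullet> ?N)" by (metis inner_scaleR_right)
  then show ?thesis using normal by simp
qed

lemma face_match:
  assumes "bval T w ((1/3) *\<^sub>R l + (1/3) *\<^sub>R m + (1/3) *\<^sub>R n) = bval T' w' ((1/3) *\<^sub>R l + (1/3) *\<^sub>R m + (1/3) *\<^sub>R n)"
    and "barycentric \<alpha> \<beta> \<gamma>"
  shows "bval T w (\<alpha> *\<^sub>R l + \<beta> *\<^sub>R m + \<gamma> *\<^sub>R n) = bval T' w' (\<alpha> *\<^sub>R l + \<beta> *\<^sub>R m + \<gamma> *\<^sub>R n) \<and>
    bgrad T w (\<alpha> *\<^sub>R l + \<beta> *\<^sub>R m + \<gamma> *\<^sub>R n) = bgrad T' w' (\<alpha> *\<^sub>R l + \<beta> *\<^sub>R m + \<gamma> *\<^sub>R n)"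
proof -
  have "bval_jump (1/3) (1/3) (1/3) = 0" using assms(1) by (simp add: bval_jump_def face_point_def)
  then show ?thesis using bval_match_face bgrad_match_face assms(2)
    unfolding bval_jump_def bgrad_jump_def face_point_def by simp
qed

end

end

section \<open>Gluing over the mesh\<close>

context tetrahedron
begin

lemma hull_subset_verts:
  assumes "C \<subseteq> V"
  shows "verts (convex hull C) = C" "convex hull C face_of T" "aff_dim (convex hull C) = int (card C) - 1"
proof -
  have C: "\<not> affine_dependent C" using V_indep assms by (rule affine_independent_subset)
  then show "verts (convex hull C) = C" by (rule verts_convex_hull)
  show "convex hull C face_of T"
    using face_of_convex_hull_affine_independent[OF V_indep, of "convex hull C"] assms V_hull by auto
  show "aff_dim (convex hull C) = int (card C) - 1"
    using aff_dim_affine_independent[OF C] by (simp add: aff_dim_convex_hull)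
qed

lemma aff_dim_T: "aff_dim T = 3"
  using hull_subset_verts(3)[OF order_refl] V_hull card_V by simp

lemma hull_edge: assumes "a \<in> V" "b \<in> V" "a \<noteq> b" shows "convex hull {a, b} edge_of T"
  using hull_subset_verts[of "{a, b}"] assms by (simp add: edge_of_def)

lemma hull_facet: assumes "C \<subseteq> V" "card C = 3" shows "convex hull C facet_of T"
proof -
  have "C \<noteq> {}" using assms by auto
  then show ?thesis using hull_subset_verts[OF assms(1)] assms(2) aff_dim_T by (auto simp: facet_of_def)
qed

end

context tetrahedron_pair
begin

context
  fixes \<gamma> :: "(real^3) set \<Rightarrow> nat \<Rightarrow> real^3"
  assumes vert: "\<And>v. v \<in> verts T \<Longrightarrow> v \<in> verts T' \<Longrightarrow> bval T w v = bval T' w' v \<and> bgrad T w v = bgrad T' w' v"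
    and edge: "\<And>e j. e edge_of T \<Longrightarrow> e edge_of T' \<Longrightarrow> j \<in> {0, 1} \<Longrightarrow> edge_functional \<gamma> T w e j = edge_functional \<gamma> T' w' e j"
    and facet: "\<And>f. f facet_of T \<Longrightarrow> f facet_of T' \<Longrightarrow> facet_functional T w f = facet_functional T' w' f"
    and perp: "\<And>e j. e edge_of T \<Longrightarrow> j \<in> {0, 1} \<Longrightarrow> \<gamma> e j \<in> edge_perp e"
    and indep: "\<And>e. e edge_of T \<Longrightarrow> \<gamma> e 0 \<noteq> \<gamma> e 1 \<and> independent {\<gamma> e 0, \<gamma> e 1}"
begin

text \<open>Any two common vertices span a common edge, whether or not it is the intersection of the two tetrahedra.\<close>

lemma match_on_edge:
  assumes ab: "a \<in> verts T" "b \<in> verts T" "a \<in> verts T'" "b \<in> verts T'" "a \<noteq> b" and t: "t \<in> {0..1}"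
  shows "bval T w (a + t *\<^sub>R (b - a)) = bval T' w' (a + t *\<^sub>R (b - a)) \<and>
    bgrad T w (a + t *\<^sub>R (b - a)) = bgrad T' w' (a + t *\<^sub>R (b - a))"
proof -
  let ?e = "convex hull {a, b}"
  have e: "?e edge_of T" "?e edge_of T'"
    using T.hull_edge[OF ab(1,2,5)] T'.hull_edge[OF ab(3,4,5)] .
  have ve: "verts ?e = {a, b}" using T.hull_subset_verts(1)[of "{a, b}"] ab by simp
  have "mid ?e = a + (1/2) *\<^sub>R (b - a)"
  proof -
    have "mid ?e = (1/2) *\<^sub>R (a + b)" unfolding mid_def ve using ab(5) by simp
    also have "\<dots> = a + (1/2) *\<^sub>R (b - a)" by (simp add: vec_eq_iff field_simps)
    finally show ?thesis .
  qed
  then have md: "bgrad T w (a + (1/2) *\<^sub>R (b - a)) \<bullet> \<gamma> ?e j = bgrad T' w' (a + (1/2) *\<^sub>R (b - a)) \<bullet> \<gamma> ?e j"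
    if "j \<in> {0, 1}" for j using edge[OF e that] by (simp add: edge_functional_def)
  have pp: "\<gamma> ?e j \<bullet> (b - a) = 0" if "j \<in> {0, 1}" for j
    using perp[OF e(1) that] hull_inc[of _ "{a, b}" convex] by (simp add: edge_perp_def)
  show ?thesis
    using edge_match[OF ab _ _ _ _ _ _ _ _ _ _ t, of "\<gamma> ?e 0" "\<gamma> ?e 1"]
      vert[OF ab(1,3)] vert[OF ab(2,4)] indep[OF e(1)] pp[of 0] pp[of 1] md[of 0] md[of 1] by simp
qed

text \<open>The intersection is the convex hull of a set of common vertices. Their number distinguishes a shared vertex,
edge or face; four common vertices leave only the case of equal tetrahedra.\<close>

lemma match_on_intersection:
  assumes F: "T \<inter> T' face_of T" "T \<inter> T' face_of T'" and x: "x \<in> T" "x \<in> T'"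
  shows "bval T w x = bval T' w' x \<and> bgrad T w x = bgrad T' w' x \<or> T = T'"
proof -
  obtain C where C: "C \<subseteq> verts T" "T \<inter> T' = convex hull C"
    using F(1) face_of_convex_hull_affine_independent[OF T.V_indep] T.V_hull by metis
  obtain C' where C': "C' \<subseteq> verts T'" "T \<inter> T' = convex hull C'"
    using F(2) face_of_convex_hull_affine_independent[OF T'.V_indep] T'.V_hull by metis
  have "C = C'" using T.hull_subset_verts(1)[OF C(1)] T'.hull_subset_verts(1)[OF C'(1)] C C' by simp
  then have CV': "C \<subseteq> verts T'" using C' by simp
  have fin: "finite C" using C(1) T.finite_V finite_subset by blast
  have xC: "x \<in> convex hull C" using x C by blast
  have "card C \<le> 4" using card_mono[OF T.finite_V C(1)] T.card_V by simp
  moreover have "card C \<noteq> 0" using xC fin by auto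
  ultimately consider "card C = 1" | "card C = 2" | "card C = 3" | "card C = 4" by linarith
  then show ?thesis
  proof cases
    case 1
    then obtain v where "C = {v}" using card_1_singletonE by blast
    then show ?thesis using xC vert[of v] C(1) CV' by simp
  next
    case 2
    then obtain l m where lm: "C = {l, m}" "l \<noteq> m" unfolding card_2_iff by blast
    have "x \<in> closed_segment l m" using xC unfolding lm segment_convex_hull .
    then obtain t where t: "0 \<le> t" "t \<le> 1" "x = (1 - t) *\<^sub>R l + t *\<^sub>R m" unfolding in_segment by blast
    then have "x = l + t *\<^sub>R (m - l)" by (simp add: algebra_simps)
    then show ?thesis using match_on_edge[of l m t] lm C(1) CV' t by simp
  next
    case 3
    then obtain l m n where lmn: "C = {l, m, n}" "l \<noteq> m" "m \<noteq> n" "l \<noteq> n" unfolding card_3_iff by blast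
    have dist: "distinct [l, m, n]" using lmn by simp
    have fac: "convex hull C facet_of T" "convex hull C facet_of T'"
      using T.hull_facet[OF C(1) 3] T'.hull_facet[OF CV' 3] .
    have vf: "verts (convex hull C) = C" by (rule T.hull_subset_verts(1)[OF C(1)])
    have vC: "bval T w v = bval T' w' v" "bgrad T w v = bgrad T' w' v" if "v \<in> C" for v
      using vert[of v] that C(1) CV' by blast+
    have s1: "(\<Sum>v\<in>C. bval T w v) = (\<Sum>v\<in>C. bval T' w' v)" by (intro sum.cong refl vC)
    have s2: "(\<Sum>v\<in>C. bgrad T w v \<bullet> (v - p)) = (\<Sum>v\<in>C. bgrad T' w' v \<bullet> (v - p))" for p
      by (intro sum.cong refl) (simp only: vC)
    \<comment> \<open>Since the vertex contributions agree, the facet functional determines the value at the barycentre.\<close>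
    have "bval T w (mid (convex hull C)) = bval T' w' (mid (convex hull C))"
      using facet[OF fac] unfolding facet_functional_def vf s1 s2 by simp
    moreover have "mid (convex hull C) = (1/3) *\<^sub>R l + (1/3) *\<^sub>R m + (1/3) *\<^sub>R n"
      unfolding mid_def vf 3 unfolding lmn(1) using lmn by (simp add: scaleR_add_right add.assoc)
    ultimately have center: "bval T w ((1/3) *\<^sub>R l + (1/3) *\<^sub>R m + (1/3) *\<^sub>R n) = bval T' w' ((1/3) *\<^sub>R l + (1/3) *\<^sub>R m + (1/3) *\<^sub>R n)"
      by simp
    have opp: "\<exists>i\<in>S. S - {i} = C" if "finite S" "card S = 4" "C \<subseteq> S" for S :: "(real^3) set"
    proof -
      have "card (S - C) = 1" using that 3 fin by (simp add: card_Diff_subset)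
      then obtain i where "S - C = {i}" using card_1_singletonE by blast
      then have "i \<in> S" "S - {i} = C" using that(3) by auto
      then show ?thesis by blast
    qed
    obtain i where i: "i \<in> verts T" "verts T - {i} = {l, m, n}"
      using opp[OF T.finite_V T.card_V C(1)] unfolding lmn(1) by blast
    obtain i' where i': "i' \<in> verts T'" "verts T' - {i'} = {l, m, n}"
      using opp[OF T'.finite_V T'.card_V CV'] unfolding lmn(1) by blast
    have edges: "bval T w (a + t *\<^sub>R (b - a)) = bval T' w' (a + t *\<^sub>R (b - a)) \<and>
      bgrad T w (a + t *\<^sub>R (b - a)) = bgrad T' w' (a + t *\<^sub>R (b - a))"
      if "a \<in> {l, m, n}" "b \<in> {l, m, n}" "a \<noteq> b" "t \<in> {0..1}" for a b t
      using that C(1) CV' unfolding lmn(1) by (intro match_on_edge) auto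
    obtain \<alpha> \<beta> \<gamma>' where "barycentric \<alpha> \<beta> \<gamma>'" "x = \<alpha> *\<^sub>R l + \<beta> *\<^sub>R m + \<gamma>' *\<^sub>R n"
      using xC unfolding lmn(1) convex_hull_3 barycentric_def by blast
    then show ?thesis using face_match[OF i i' dist edges center] by simp
  next
    case 4
    then have "C = verts T" "C = verts T'"
      using card_seteq[OF T.finite_V C(1)] card_seteq[OF T'.finite_V CV'] T.card_V T'.card_V by auto
    then show ?thesis using T.V_hull T'.V_hull by simp
  qed
qed

end

end

context piecewise_lipschitz
begin

lemma AE_inner_part: "AE x in lebesgue_on \<Omega>. x \<in> inner_part"
proof -
  have O: "\<Omega> \<in> sets lebesgue" using op by auto
  have N: "(\<Union>T\<in>\<T>. frontier T) \<in> null_sets lebesgue"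
    using null_frontiers by (rule null_sets_completionI)
  have "AE x in lebesgue. x \<in> \<Omega> \<longrightarrow> x \<in> inner_part"
  proof (rule AE_I'[OF N], rule subsetI)
    fix x assume "x \<in> {x \<in> space lebesgue. \<not> (x \<in> \<Omega> \<longrightarrow> x \<in> inner_part)}"
    then have x: "x \<in> \<Omega>" "x \<notin> inner_part" by auto
    then obtain T where T: "T \<in> \<T>" "x \<in> T" using cover by blast
    then have "x \<in> frontier T" using x closure_subset[of T] by (auto simp: frontier_def)
    then show "x \<in> (\<Union>T\<in>\<T>. frontier T)" using T by blast
  qed
  then show ?thesis using O by (simp add: AE_restrict_space_iff)
qed

end

lemma L2_integral_cong:
  assumes "f \<in> L2 \<Omega>" "g \<in> L2 \<Omega>" "AE x in lebesgue_on \<Omega>. f x = g x" "\<phi> \<in> test_functions \<Omega>"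
  shows "(LINT x|lebesgue_on \<Omega>. f x * \<phi> x) = (LINT x|lebesgue_on \<Omega>. g x * \<phi> x)"
proof -
  have [measurable]: "f \<in> borel_measurable (lebesgue_on \<Omega>)" "g \<in> borel_measurable (lebesgue_on \<Omega>)"
    using assms by (auto simp: L2_def)
  have "\<phi> \<in> borel_measurable lborel"
    using test_continuous[OF assms(4)] by (simp add: borel_measurable_continuous_onI)
  then have [measurable]: "\<phi> \<in> borel_measurable (lebesgue_on \<Omega>)"
    by (intro measurable_restrict_space1 measurable_completion)
  show ?thesis
  proof (rule integral_cong_AE)
    show "AE x in lebesgue_on \<Omega>. f x * \<phi> x = g x * \<phi> x" using assms(3) by eventually_elim simp
  qed measurable
qed

theorem theorem3p17:
  fixes \<Omega> :: "(real^3) set"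
    and \<T> :: "(real^3) set set"
    and \<gamma> :: "(real^3) set \<Rightarrow> nat \<Rightarrow> real^3"
  assumes "bounded \<Omega>" and "polyhedral_domain \<Omega>"
    and "conforming_triangulation \<T> \<Omega>"
    and "\<And>T e j. T \<in> \<T> \<Longrightarrow> e edge_of T \<Longrightarrow> j \<in> {0, 1} \<Longrightarrow> \<gamma> e j \<in> edge_perp e"
    and "\<And>T e. T \<in> \<T> \<Longrightarrow> e edge_of T \<Longrightarrow> \<gamma> e 0 \<noteq> \<gamma> e 1 \<and> independent {\<gamma> e 0, \<gamma> e 1}"
  shows "Z3_cub_mesh \<Omega> \<T> \<gamma> \<subseteq> sobolev_H 2 \<Omega>"
proof
  fix z assume z: "z \<in> Z3_cub_mesh \<Omega> \<T> \<gamma>"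
  then obtain w where zL2: "z \<in> L2 \<Omega>"
    and wT: "\<And>T. T \<in> \<T> \<Longrightarrow> w T \<in> Z3_cub T"
    and zw: "\<And>T. T \<in> \<T> \<Longrightarrow> AE x in lebesgue_on T. z x = w T x"
    and vert: "\<And>T T' v. T \<in> \<T> \<Longrightarrow> T' \<in> \<T> \<Longrightarrow> v \<in> verts T \<Longrightarrow> v \<in> verts T' \<Longrightarrow>
       bval T (w T) v = bval T' (w T') v \<and> bgrad T (w T) v = bgrad T' (w T') v"
    and edge: "\<And>T T' e j. T \<in> \<T> \<Longrightarrow> T' \<in> \<T> \<Longrightarrow> e edge_of T \<Longrightarrow> e edge_of T' \<Longrightarrow> j \<in> {0, 1} \<Longrightarrow>
       edge_functional \<gamma> T (w T) e j = edge_functional \<gamma> T' (w T') e j"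
    and facet: "\<And>T T' f. T \<in> \<T> \<Longrightarrow> T' \<in> \<T> \<Longrightarrow> f facet_of T \<Longrightarrow> f facet_of T' \<Longrightarrow>
       facet_functional T (w T) f = facet_functional T' (w T') f"
    unfolding Z3_cub_mesh_def by blast
  have tri: "triangulation \<T>" "\<And>T. T \<in> \<T> \<Longrightarrow> 3 simplex T" "\<Union>\<T> = closure \<Omega>"
    using assms(3) unfolding conforming_triangulation_def by blast+
  have op: "open \<Omega>" using assms(2) unfolding polyhedral_domain_def by blast
  have tet: "tetrahedron T" if "T \<in> \<T>" for T by (rule tetrahedron.intro[OF tri(2)[OF that]])
  have agree: "bval T (w T) x = bval T' (w T') x \<and> bgrad T (w T) x = bgrad T' (w T') x"
    if T: "T \<in> \<T>" "T' \<in> \<T>" and x: "x \<in> T" "x \<in> T'" for T T' x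
  proof -
    interpret tetrahedron_pair T T' "w T" "w T'"
      unfolding tetrahedron_pair_def tetrahedron_pair_axioms_def using tet wT T by blast
    have F: "T \<inter> T' face_of T" "T \<inter> T' face_of T'"
      using tri(1) T unfolding triangulation_def by (metis inf_commute)+
    have "bval T (w T) x = bval T' (w T') x \<and> bgrad T (w T) x = bgrad T' (w T') x \<or> T = T'"
      by (rule match_on_intersection[of \<gamma>, OF vert[OF T] edge[OF T] facet[OF T] assms(4)[OF T(1)] assms(5)[OF T(1)] F x])
    then show ?thesis by auto
  qed
  \<comment> \<open>By \<open>agree\<close>, values and gradients do not depend on the cell chosen here.\<close>
  define cell where "cell x = (SOME T. T \<in> \<T> \<and> x \<in> T)" for x
  define u where "u x = bval (cell x) (w (cell x)) x" for x
  define G where "G x = bgrad (cell x) (w (cell x)) x" for x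
  have uG: "u x = bval T (w T) x" "G x = bgrad T (w T) x" if T: "T \<in> \<T>" "x \<in> T" for T x
  proof -
    have "cell x \<in> \<T> \<and> x \<in> cell x" unfolding cell_def by (rule someI[of _ T]) (use T in blast)
    then show "u x = bval T (w T) x" "G x = bgrad T (w T) x"
      using agree[of "cell x" T x] T unfolding u_def G_def by auto
  qed
  have pl: "piecewise_lipschitz \<T> \<Omega> f" if "\<And>T. T \<in> \<T> \<Longrightarrow> \<exists>L. L-lipschitz_on T f" for f
  proof
    show "finite \<T>" using tri(1) unfolding triangulation_def by blast
    show "compact T" "convex T" if "T \<in> \<T>" for T
      using tetrahedron.compact_T[OF tet[OF that]] tetrahedron.convex_T[OF tet[OF that]] .
    show "\<Omega> \<subseteq> \<Union>\<T>" unfolding tri(3) by (rule closure_subset)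
  qed (use op assms(1) that in auto)
  have lip_u: "\<exists>L. L-lipschitz_on T u" if T: "T \<in> \<T>" for T
  proof -
    interpret tetrahedron T by (rule tet[OF T])
    obtain L where "L-lipschitz_on T (bval T (w T))"
      using bval_lipschitz[OF region_facts bdd2_Z3_cub[OF wT[OF T]]] by blast
    then have "L-lipschitz_on T u" by (rule lipschitz_on_transform) (simp add: uG[OF T])
    then show ?thesis by blast
  qed
  have lip_G: "\<exists>L. L-lipschitz_on T (\<lambda>x. G x \<bullet> b)" if T: "T \<in> \<T>" for T b
  proof -
    interpret tetrahedron T by (rule tet[OF T])
    obtain L where L: "L-lipschitz_on T (bgrad T (w T))"
      using bgrad_lipschitz[OF region_facts bdd2_Z3_cub[OF wT[OF T]]] by blast
    have "(L * norm b)-lipschitz_on T (\<lambda>x. G x \<bullet> b)"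
    proof (rule lipschitz_onI)
      show "0 \<le> L * norm b" using lipschitz_on_nonneg[OF L] by simp
      fix x y assume xy: "x \<in> T" "y \<in> T"
      have "dist (G x \<bullet> b) (G y \<bullet> b) = \<bar>(G x - G y) \<bullet> b\<bar>" by (simp add: dist_real_def inner_diff_left)
      also have "\<dots> \<le> norm (G x - G y) * norm b" by (rule Cauchy_Schwarz_ineq2)
      also have "\<dots> \<le> (L * dist x y) * norm b"
        using lipschitz_onD[OF L xy] uG(2)[OF T xy(1)] uG(2)[OF T xy(2)]
        by (intro mult_right_mono) (auto simp: dist_norm)
      finally show "dist (G x \<bullet> b) (G y \<bullet> b) \<le> L * norm b * dist x y" by (simp add: ac_simps)
    qed
    then show ?thesis by blast
  qed
  interpret u: piecewise_lipschitz \<T> \<Omega> u by (rule pl[OF lip_u])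
  let ?I = "\<Union>T\<in>\<T>. interior T"
  \<comment> \<open>In \<open>\<Omega>\<close> the value 0 is taken on a null set only.\<close>
  define D1 where "D1 b x = (if x \<in> ?I then G x \<bullet> b else 0)" for b x
  define D2 where "D2 b c x = (if x \<in> ?I then frechet_derivative (\<lambda>y. G y \<bullet> c) (at x) b else 0)" for b c x
  have der1: "\<exists>d. (u has_derivative d) (at x) \<and> d b = D1 b x" if T: "T \<in> \<T>" "x \<in> interior T" for T x b
  proof -
    interpret tetrahedron T by (rule tet[OF T(1)])
    have xT: "x \<in> T" using T(2) interior_subset by blast
    have "(bval T (w T) has_derivative (\<lambda>h. h \<bullet> bgrad T (w T) x)) (at x)"
      using bval_has_derivative[OF region_facts bdd2_Z3_cub[OF wT[OF T(1)]] xT] at_within_interior[OF T(2)] by simp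
    then have "(u has_derivative (\<lambda>h. h \<bullet> bgrad T (w T) x)) (at x)"
      by (rule has_derivative_transform_within_open[OF _ open_interior T(2)])
        (use uG(1)[OF T(1)] interior_subset_T in auto)
    moreover have "b \<bullet> bgrad T (w T) x = D1 b x"
      using T uG(2)[OF T(1) xT] by (auto simp: D1_def inner_commute)
    ultimately show ?thesis by blast
  qed
  have der2: "\<exists>d. ((\<lambda>y. G y \<bullet> c) has_derivative d) (at x) \<and> d b = D2 b c x"
    if T: "T \<in> \<T>" "x \<in> interior T" and c: "c \<in> Basis" for T x b c
  proof -
    interpret tetrahedron T by (rule tet[OF T(1)])
    obtain d where "((\<lambda>y. bgrad T (w T) y \<bullet> c) has_derivative d) (at x)"
      using bgrad_component_differentiable[OF region_facts bdd2_Z3_cub[OF wT[OF T(1)]] T(2) c]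
      unfolding differentiable_def by blast
    then have "((\<lambda>y. G y \<bullet> c) has_derivative d) (at x)"
      by (rule has_derivative_transform_within_open[OF _ open_interior T(2)])
        (use uG(2)[OF T(1)] interior_subset_T in auto)
    then have "((\<lambda>y. G y \<bullet> c) has_derivative frechet_derivative (\<lambda>y. G y \<bullet> c) (at x)) (at x)"
      unfolding frechet_derivative_works[symmetric] by (rule differentiableI)
    moreover have "frechet_derivative (\<lambda>y. G y \<bullet> c) (at x) b = D2 b c x" using T by (auto simp: D2_def)
    ultimately show ?thesis by blast
  qed
  have D0: "D1 b x = 0" "D2 b c x = 0" if "x \<notin> ?I" for b c x using that by (simp_all add: D1_def D2_def)
  have zu: "AE x in lebesgue_on \<Omega>. z x = u x"
  proof -
    have "AE x in lebesgue. \<forall>T\<in>\<T>. x \<in> T \<longrightarrow> z x = w T x"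
    proof (rule AE_finite_allI[OF u.fin])
      fix T assume T: "T \<in> \<T>"
      have "T \<in> sets lebesgue" using compact_imp_closed[OF u.cpt[OF T]] by auto
      then show "AE x in lebesgue. x \<in> T \<longrightarrow> z x = w T x"
        using zw[OF T] by (simp add: AE_restrict_space_iff)
    qed
    then have "AE x in lebesgue_on \<Omega>. \<forall>T\<in>\<T>. x \<in> T \<longrightarrow> z x = w T x"
      using op by (subst AE_restrict_space_iff) (auto elim: eventually_mono)
    then show ?thesis using u.AE_inner_part
    proof eventually_elim
      case (elim x)
      then obtain T where T: "T \<in> \<T>" "x \<in> interior T" by blast
      interpret tetrahedron T by (rule tet[OF T(1)])
      have xT: "x \<in> T" "x \<in> region" using T(2) interior_subset_T interior_subset_region by blast+
      have "z x = w T x" using elim T(1) xT by blast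
      also have "\<dots> = bval T (w T) x" using bval_eq[OF region_facts bdd2_Z3_cub[OF wT[OF T(1)]] xT] ..
      also have "\<dots> = u x" using uG(1)[OF T(1) xT(1)] ..
      finally show ?case .
    qed
  qed
  have wd1: "weak_derivative \<Omega> [b] z (D1 b)" if b: "b \<in> Basis" for b
    unfolding weak_derivative_def
  proof
    fix \<phi> assume \<phi>: "\<phi> \<in> test_functions \<Omega>"
    have "(LINT x|lebesgue_on \<Omega>. z x * partials [b] \<phi> x) = (LINT x|lebesgue_on \<Omega>. u x * partials [b] \<phi> x)"
      by (rule L2_integral_cong[OF zL2 u.u_L2 zu test_partials[OF \<phi> b]])
    also have "\<dots> = - (LINT x|lebesgue_on \<Omega>. D1 b x * \<phi> x)"
      by (rule u.integration_by_parts[OF b der1 D0(1) \<phi>])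
    finally show "(LINT x|lebesgue_on \<Omega>. z x * partials [b] \<phi> x) = (-1) ^ length [b] * (LINT x|lebesgue_on \<Omega>. D1 b x * \<phi> x)"
      by simp
  qed
  have D1L2: "D1 b \<in> L2 \<Omega>" if b: "b \<in> Basis" for b by (rule u.D_L2[OF b der1 D0(1)])
  have order2: "D2 b c \<in> L2 \<Omega> \<and> weak_derivative \<Omega> [c, b] z (D2 b c)" if bc: "b \<in> Basis" "c \<in> Basis" for b c
  proof -
    interpret g: piecewise_lipschitz \<T> \<Omega> "\<lambda>x. G x \<bullet> c" by (rule pl[OF lip_G])
    have ae: "AE x in lebesgue_on \<Omega>. D1 c x = G x \<bullet> c"
      using u.AE_inner_part by eventually_elim (auto simp: D1_def)
    have "weak_derivative \<Omega> [c, b] z (D2 b c)"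
      unfolding weak_derivative_def
    proof
      fix \<phi> assume \<phi>: "\<phi> \<in> test_functions \<Omega>"
      have \<psi>: "partials [b] \<phi> \<in> test_functions \<Omega>" by (rule test_partials[OF \<phi> bc(1)])
      have "(LINT x|lebesgue_on \<Omega>. z x * partials [c, b] \<phi> x) = (LINT x|lebesgue_on \<Omega>. z x * partials [c] (partials [b] \<phi>) x)"
        using partials_append[of "[c]" "[b]" \<phi>] by simp
      also have "\<dots> = - (LINT x|lebesgue_on \<Omega>. D1 c x * partials [b] \<phi> x)"
        using wd1[OF bc(2)] \<psi> unfolding weak_derivative_def by simp
      also have "(LINT x|lebesgue_on \<Omega>. D1 c x * partials [b] \<phi> x) = (LINT x|lebesgue_on \<Omega>. (G x \<bullet> c) * partials [b] \<phi> x)"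
        by (rule L2_integral_cong[OF D1L2[OF bc(2)] g.u_L2 ae \<psi>])
      also have "\<dots> = - (LINT x|lebesgue_on \<Omega>. D2 b c x * \<phi> x)"
        by (rule g.integration_by_parts[OF bc(1) der2[OF _ _ bc(2)] D0(2) \<phi>])
      finally show "(LINT x|lebesgue_on \<Omega>. z x * partials [c, b] \<phi> x) = (-1) ^ length [c, b] * (LINT x|lebesgue_on \<Omega>. D2 b c x * \<phi> x)"
        by simp
    qed
    moreover have "D2 b c \<in> L2 \<Omega>" by (rule g.D_L2[OF bc(1) der2[OF _ _ bc(2)] D0(2)])
    ultimately show ?thesis by blast
  qed
  have "\<exists>v\<in>L2 \<Omega>. weak_derivative \<Omega> bs z v" if bs: "bs \<in> lists Basis" "length bs \<le> 2" for bs
  proof -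
    consider "bs = []" | b where "bs = [b]" | c b where "bs = [c, b]"
      using bs(2) by (cases bs; cases "tl bs") auto
    then show ?thesis
    proof cases
      case 1
      have "weak_derivative \<Omega> [] z z" by (simp add: weak_derivative_def partials_Nil)
      then show ?thesis using 1 zL2 by blast
    next
      case 2
      then show ?thesis using bs wd1[of b] D1L2[of b] by auto
    next
      case 3
      then show ?thesis using bs order2[of b c] by auto
    qed
  qed
  then show "z \<in> sobolev_H 2 \<Omega>" using zL2 unfolding sobolev_H_def by blast
qed

end
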